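(* Fix $n\geq1$ and consider the action of $(\mathbb R^* )^n$ on $V=\mathbb R^n$ by coordinatewise multiplication $gv=(g^1v^1,\dots,g^nv^n)$. There exists a neighbourhood $U$ of the identity $\mathrm{id}=(1,\dots,1)$ in $(\mathbb R^* )^n$ such that the following holds. Given $\kappa>0$ and $\sigma\in(0,n)$, there exists $\epsilon>0$ such that for all $\delta>0$ sufficiently small, if $A\subset U$ and $X\subset B_V(0,\delta^{-\epsilon})$ satisfy: (i) for $j=1,\dots,n$ and all $\rho\geq\delta$, $\mathcal N_\rho(\pi_j(A))\geq \delta^{\epsilon}\rho^{-\kappa}$; (ii) $A$ is $\delta^{\epsilon}$ away from proper unitary subalgebras of $\mathbb R^n$; (iii) for $j=1,\dots,n$ and all $\rho\geq\delta$, $\mathcal N_\rho(\pi_j(X))\geq \delta^{\epsilon}\rho^{-\kappa}$; (iv) $\mathcal N_\delta(X)\leq \delta^{-(n-\sigma)-\epsilon}$; then \[\mathcal N_\delta(X+X)+\sup_{a\in A}\mathcal N_\delta(X+aX)\geq \delta^{-\epsilon}\mathcal N_\delta(X).\]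
   Context: $\pi_j:\mathbb R^n\to\mathbb R$ is the projection to the $j$-th coordinate. For a bounded set $E$ in a metric space, $\mathcal N_\rho(E)$ is the minimal number of closed balls of radius $\rho$ needed to cover $E$. $B_V(0,R)$ is the closed Euclidean ball. $X+aX=\{x+ay: x,y\in X\}$ with coordinatewise product. A set $A$ is said to be $\rho$ away from a set $S$ if there exists $x\in A$ with $d(x,S)\geq\rho$. The maximal proper unitary subalgebras of $\mathbb R^n$ (with coordinatewise multiplication) are the sets $\{x\in\mathbb R^n: x^i=x^j\}$ for $1\leq i<j\leq n$; $A$ is $\rho$ away from proper unitary subalgebras if it is $\rho$ away from each of these sets. *)

theory Defs
  imports "HOL-Analysis.Analysis"
begin

text \<open>Covering number: minimal number of closed balls of radius rho covering E
  (centres anywhere in the ambient metric space); infinity if no finite cover exists.\<close>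
definition covering_number :: "real \<Rightarrow> 'a::metric_space set \<Rightarrow> ennreal" where
  "covering_number \<rho> E =
     Inf {of_nat (card C) | C. finite C \<and> E \<subseteq> (\<Union>c\<in>C. cball c \<rho>)}"

definition sum_dil :: "(real^'n) set \<Rightarrow> real^'n \<Rightarrow> (real^'n) set" where
  "sum_dil X a = {x + a * y | x y. x \<in> X \<and> y \<in> X}"

definition away_from :: "real \<Rightarrow> 'a::metric_space set \<Rightarrow> 'a set \<Rightarrow> bool" where
  "away_from \<rho> A S \<longleftrightarrow> (\<exists>x\<in>A. infdist x S \<ge> \<rho>)"

text \<open>Maximal proper unitary subalgebras of R^n: {x. x_i = x_j}, i \<noteq> j.\<close>
definition away_from_subalgebras :: "real \<Rightarrow> (real^'n) set \<Rightarrow> bool" where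
  "away_from_subalgebras \<rho> A \<longleftrightarrow>
     (\<forall>i j. i \<noteq> j \<longrightarrow> away_from \<rho> A {x. x $ i = x $ j})"

end

theory Submission
  imports Defs
begin

text \<open>
  Suppose \<open>X + X\<close> and all \<open>X + aX\<close> are barely larger than \<open>X\<close>. By the Pluennecke inequality and Ruzsa
  covering, \<open>\<Sum> b\<^sub>i X\<close> is then barely larger than \<open>X\<close> for all \<open>b\<^sub>i\<close> in the sets obtained from \<open>A\<close> by
  boundedly many ring operations. The size of these sets can increase only boundedly often by a
  small power of \<open>1/\<delta>\<close>, so one of them, \<open>W\<close>, is almost closed under ring operations.

  On the line such a set has almost full dimension. At a scale \<open>\<sigma>\<close> around which the covering
  numbers of \<open>W\<close> are almost multiplicative, quotients of elements of \<open>W\<close> of the same size act on \<open>W\<close>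
  at small cost. If these quotients were not dense, then \<open>u/2\<close> or \<open>(u+1)/2\<close> would be far from
  all of them for some quotient \<open>u\<close>, and \<open>(x, y) \<mapsto> x + \<xi> y\<close> with that number \<open>\<xi>\<close> would be injective
  on \<open>W \<times> W\<close>, which is too expensive. So every real acts at small cost, and counting
  the energy over all of them shows that \<open>W\<close> is almost full.

  Since almost full sets have quotients everywhere, each coordinate of \<open>W\<close> can be prescribed.
  If the \<open>j\<close>-th coordinate determined the \<open>i\<close>-th one it would do so almost additively and fix 1, hence
  be almost the identity, contradicting that \<open>A\<close> is away from \<open>{x. x\<^sub>i = x\<^sub>j}\<close>. This gives
  ring elements \<open>u\<^sub>i\<close> concentrated on a single coordinate, and \<open>\<Sum> u\<^sub>i X\<close> has about as many
  elements as the product of the projections of \<open>X\<close>, each of which is almost full by the same energy count.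
\<close>

section \<open>Packing numbers\<close>

text \<open>Quotients are not ring elements. Clearing a denominator of size \<open>\<theta>\<close>
  turns a question at scale \<open>\<omega>\<close> into one about the ring at scale
  \<open>\<omega> * \<theta>\<close>, inside an interval of length about \<open>\<theta>\<close>.
  This is affordable only where the packing number at \<open>\<omega> * \<theta>\<close> is not much
  larger than the product of those at \<open>\<omega>\<close> and \<open>\<theta>\<close>. The
  opposite inequality is automatic, because powers of one small difference supply ring elements of
  every size. So a good scale is selected among roots of \<open>\<delta>\<close> of bounded order,
  and the bound found there is carried back to \<open>\<delta>\<close> by superadditivity. Growth is
  stopped once, in the full space: the fibre inequality passes one growth bound at scale
  \<open>\<delta>\<close> on to every coordinate and every coarser scale. The order of choices
  matters. The number of ring operations is fixed before any bound \<open>R\<close> on the elements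
  is known, so the packing exponent must not depend on \<open>R\<close>; \<open>\<epsilon>\<close>
  comes later still, since each ring operation costs a power of the doubling constant.\<close>

definition separated :: "real \<Rightarrow> 'a::metric_space set \<Rightarrow> bool" where
  "separated r D \<longleftrightarrow> (\<forall>x\<in>D. \<forall>y\<in>D. x \<noteq> y \<longrightarrow> r < dist x y)"

text \<open>Packings are counted because lower bounds then come from explicit separated families.
  The strict inequality in \<open>separated\<close> makes a largest packing a net for closed balls
  of the same radius. \<open>Sup\<close> on \<open>nat\<close> is informative only for bounded sets
  of cardinalities, hence the boundedness assumptions below.\<close>

definition pack :: "real \<Rightarrow> 'a::metric_space set \<Rightarrow> nat" where
  "pack r E = Sup (card ` {D. D \<subseteq> E \<and> finite D \<and> separated r D})"

lemma separatedD: "separated r D \<Longrightarrow> x \<in> D \<Longrightarrow> y \<in> D \<Longrightarrow> x \<noteq> y \<Longrightarrow> r < dist x y"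
  by (simp add: separated_def)

lemma separated_subset: "separated r D \<Longrightarrow> D' \<subseteq> D \<Longrightarrow> separated r D'"
  by (auto simp: separated_def)

lemma separated_mono: "separated s D \<Longrightarrow> r \<le> s \<Longrightarrow> separated r D"
  by (force simp: separated_def)

lemma card_separated_le_cover:
  assumes C: "finite C" "E \<subseteq> (\<Union>c\<in>C. cball c \<rho>)" and D: "D \<subseteq> E" "separated (2 * \<rho>) D"
  shows "finite D \<and> card D \<le> card C"
proof -
  have "\<exists>c. c \<in> C \<and> dist c x \<le> \<rho>" if "x \<in> D" for x
    using that C D by (auto simp: subset_iff)
  then obtain f where f: "\<And>x. x \<in> D \<Longrightarrow> f x \<in> C \<and> dist (f x) x \<le> \<rho>"
    by metis
  have "inj_on f D"
  proof (rule inj_onI)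
    fix x y assume xy: "x \<in> D" "y \<in> D" "f x = f y"
    have "dist x y \<le> dist (f x) x + dist (f x) y"
      by (metis dist_commute dist_triangle)
    also have "\<dots> \<le> 2 * \<rho>" using f[OF xy(1)] f[OF xy(2)] xy(3) by simp
    finally show "x = y" using separatedD[OF D(2) xy(1,2)] by force
  qed
  moreover have "f ` D \<subseteq> C" using f by auto
  ultimately show ?thesis using C(1)
    by (meson card_inj_on_le finite_subset inj_on_finite)
qed

lemma bounded_finite_cover:
  fixes E :: "'a::euclidean_space set"
  assumes "bounded E" "\<rho> > 0"
  shows "\<exists>C. finite C \<and> E \<subseteq> (\<Union>c\<in>C. cball c \<rho>)"
proof -
  have "compact (closure E)" using assms by simp
  then obtain C where C: "finite C" "closure E \<subseteq> (\<Union>c\<in>C. ball c \<rho>)"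
    using assms(2) unfolding compact_eq_totally_bounded by blast
  have "E \<subseteq> (\<Union>c\<in>C. cball c \<rho>)"
    using closure_subset[of E] C(2) ball_subset_cball by blast
  then show ?thesis using C(1) by blast
qed

lemma separated_finite_bound:
  fixes E :: "'a::euclidean_space set"
  assumes "bounded E" "r > 0"
  shows "\<exists>n. \<forall>D. D \<subseteq> E \<longrightarrow> separated r D \<longrightarrow> finite D \<and> card D \<le> n"
proof -
  obtain C where "finite C" "E \<subseteq> (\<Union>c\<in>C. cball c (r/2))"
    using bounded_finite_cover[OF assms(1), of "r/2"] assms(2) by auto
  from card_separated_le_cover[OF this] show ?thesis by auto
qed

lemma separated_card_le_pack:
  fixes E :: "'a::euclidean_space set"
  assumes "bounded E" "r > 0" "D \<subseteq> E" "separated r D"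
  shows "finite D" "card D \<le> pack r E"
proof -
  obtain n where n: "\<And>D. D \<subseteq> E \<Longrightarrow> separated r D \<Longrightarrow> finite D \<and> card D \<le> n"
    using separated_finite_bound[OF assms(1,2)] by blast
  show f: "finite D" using n assms by blast
  show "card D \<le> pack r E" unfolding pack_def
    by (rule cSup_upper) (use f n assms in \<open>auto intro!: bdd_aboveI[of _ n]\<close>)
qed

text \<open>A point further than \<open>r\<close> from a largest separated subset could be added to
  it. Most arguments use both properties of the same \<open>D\<close>: separation to count from
  below, the net property to cover.\<close>

lemma pack_ex:
  fixes E :: "'a::euclidean_space set"
  assumes "bounded E" "r > 0"
  shows "\<exists>D. D \<subseteq> E \<and> finite D \<and> separated r D \<and> card D = pack r E \<and>
    (\<forall>x\<in>E. \<exists>y\<in>D. dist x y \<le> r)"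
proof -
  let ?S = "card ` {D. D \<subseteq> E \<and> finite D \<and> separated r D}"
  obtain n where n: "\<And>D. D \<subseteq> E \<Longrightarrow> separated r D \<Longrightarrow> finite D \<and> card D \<le> n"
    using separated_finite_bound[OF assms(1,2)] by blast
  have "{} \<in> {D. D \<subseteq> E \<and> finite D \<and> separated r D}" by (simp add: separated_def)
  then have ne: "?S \<noteq> {}" by blast
  have "finite ?S" by (rule finite_subset[of _ "{..n}"]) (use n in auto)
  then have "pack r E \<in> ?S" unfolding pack_def
    unfolding cSup_eq_Max[OF \<open>finite ?S\<close> ne] using ne by (rule Max_in)
  then obtain D where D: "D \<subseteq> E" "finite D" "separated r D" "card D = pack r E" by auto
  have "\<exists>y\<in>D. dist x y \<le> r" if "x \<in> E" for x
  proof (rule ccontr)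
    assume c: "\<not> ?thesis"
    then have "separated r (insert x D)" using D(3)
      by (auto simp: separated_def dist_commute not_le)
    then have "card (insert x D) \<le> pack r E"
      using separated_card_le_pack[OF assms, of "insert x D"] D that by auto
    moreover have "x \<notin> D" using c assms(2) by force
    ultimately show False using D by simp
  qed
  with D show ?thesis by blast
qed

lemma pack_mono:
  fixes E :: "'a::euclidean_space set"
  assumes "bounded F" "r > 0" "E \<subseteq> F" shows "pack r E \<le> pack r F"
proof -
  obtain D where "D \<subseteq> E" "separated r D" "card D = pack r E"
    using pack_ex[OF bounded_subset[OF assms(1,3)] assms(2)] by blast
  then show ?thesis using separated_card_le_pack(2)[OF assms(1,2), of D] assms(3) by auto
qed

lemma pack_antimono:
  fixes E :: "'a::euclidean_space set"
  assumes "bounded E" "r > 0" "r \<le> s" shows "pack s E \<le> pack r E"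
proof -
  obtain D where "D \<subseteq> E" "separated s D" "card D = pack s E"
    using pack_ex[OF assms(1), of s] assms by auto
  then show ?thesis using separated_card_le_pack(2)[OF assms(1,2), of D] assms(3) separated_mono by metis
qed

lemma pack_pos:
  fixes E :: "'a::euclidean_space set"
  assumes "bounded E" "r > 0" "E \<noteq> {}" shows "pack r E \<ge> 1"
proof -
  obtain x where "x \<in> E" using assms by blast
  then have "card {x} \<le> pack r E"
    using separated_card_le_pack(2)[OF assms(1,2), of "{x}"] by (auto simp: separated_def)
  then show ?thesis by simp
qed

lemma pack_Union_le:
  fixes E :: "'a::euclidean_space set"
  assumes "bounded E" "r > 0" "finite I" "E \<subseteq> (\<Union>i\<in>I. F i)" "\<And>i. i \<in> I \<Longrightarrow> bounded (F i)"
  shows "pack r E \<le> (\<Sum>i\<in>I. pack r (F i))"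
proof -
  obtain D where D: "D \<subseteq> E" "finite D" "separated r D" "card D = pack r E"
    using pack_ex[OF assms(1,2)] by blast
  have "card D \<le> card (\<Union>i\<in>I. D \<inter> F i)"
    by (rule card_mono) (use D assms in auto)
  also have "\<dots> \<le> (\<Sum>i\<in>I. card (D \<inter> F i))" by (rule card_UN_le[OF assms(3)])
  also have "\<dots> \<le> (\<Sum>i\<in>I. pack r (F i))"
    by (rule sum_mono) (use assms D in \<open>auto intro!: separated_card_le_pack(2) separated_subset[OF D(3)]\<close>)
  finally show ?thesis using D by simp
qed

lemma pack_affine:
  fixes E :: "'a::euclidean_space set"
  assumes "bounded E" "r > 0" "c > 0"
  shows "pack (c * r) ((\<lambda>x. v + c *\<^sub>R x) ` E) = pack r E"
proof (rule antisym)
  let ?f = "\<lambda>x::'a. v + c *\<^sub>R x"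
  have bd: "bounded (?f ` E)"
    using bounded_translation[OF bounded_scaling[OF assms(1), of c], of v] by (simp add: image_image)
  have dist: "dist (?f x) (?f y) = c * dist x y" for x y
  proof -
    have "?f x - ?f y = c *\<^sub>R (x - y)" by (simp add: scaleR_diff_right)
    then show ?thesis using assms(3) by (simp only: dist_norm norm_scaleR)
  qed
  have inj: "inj ?f" using assms by (auto simp: inj_def)
  show "pack (c * r) (?f ` E) \<le> pack r E"
  proof -
    obtain D where D: "D \<subseteq> ?f ` E" "finite D" "separated (c*r) D" "card D = pack (c*r) (?f ` E)"
      using pack_ex[OF bd, of "c*r"] assms by auto
    then obtain D' where D': "D' \<subseteq> E" "D = ?f ` D'" by (meson subset_imageE)
    have "separated r D'" unfolding separated_def
    proof safe
      fix x y assume xy: "x \<in> D'" "y \<in> D'" "x \<noteq> y"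
      have "c * r < dist (?f x) (?f y)"
        by (rule separatedD[OF D(3)]) (use xy D' inj in \<open>auto dest: injD\<close>)
      then show "r < dist x y" using dist assms by simp
    qed
    moreover have "card D = card D'" using D' inj
      by (metis card_image inj_on_subset subset_UNIV)
    ultimately show ?thesis using separated_card_le_pack(2)[OF assms(1,2) D'(1)] D by simp
  qed
  show "pack r E \<le> pack (c * r) (?f ` E)"
  proof -
    obtain D where D: "D \<subseteq> E" "finite D" "separated r D" "card D = pack r E"
      using pack_ex[OF assms(1,2)] by blast
    have "separated (c*r) (?f ` D)" unfolding separated_def
    proof safe
      fix x y assume xy: "x \<in> D" "y \<in> D" "?f x \<noteq> ?f y"
      then have "r < dist x y" using separatedD[OF D(3)] by blast
      then show "c * r < dist (?f x) (?f y)" using dist assms by simp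
    qed
    then have "card (?f ` D) \<le> pack (c * r) (?f ` E)"
      using separated_card_le_pack(2)[OF bd, of "c*r" "?f ` D"] D assms by auto
    then show ?thesis using D inj
      by (metis card_image inj_on_subset subset_UNIV)
  qed
qed

lemma pack_cball:
  fixes x :: "'a::euclidean_space"
  assumes "r > 0"
  shows "pack r (cball x R) = pack 1 (cball (0::'a) (R/r))"
proof -
  have "(\<lambda>y. x + r *\<^sub>R y) ` cball 0 (R/r) = cball x R"
  proof (intro equalityI subsetI)
    fix y assume "y \<in> cball x R"
    then have "(1/r) *\<^sub>R (y - x) \<in> cball 0 (R/r)" using assms
      by (simp add: dist_norm norm_minus_commute divide_right_mono)
    moreover have "y = x + r *\<^sub>R ((1/r) *\<^sub>R (y - x))" using assms by simp
    ultimately show "y \<in> (\<lambda>y. x + r *\<^sub>R y) ` cball 0 (R/r)" by (rule rev_image_eqI)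
  next
    fix y assume "y \<in> (\<lambda>y. x + r *\<^sub>R y) ` cball 0 (R/r)"
    then obtain z where z: "norm z \<le> R/r" "y = x + r *\<^sub>R z" by auto
    have "dist x y = r * norm z" using z(2) assms by (simp add: dist_norm)
    also have "\<dots> \<le> R" using z(1) assms by (simp add: field_simps)
    finally show "y \<in> cball x R" by simp
  qed
  then show ?thesis using pack_affine[of "cball (0::'a) (R/r)" 1 r x] assms by simp
qed

text \<open>Balls of radius \<open>e + s\<close> about an \<open>s\<close>-net of \<open>F\<close>
  cover \<open>E\<close>. In units of \<open>r\<close>, one such ball holds a bounded number of
  separated points as long as \<open>e\<close> and \<open>s\<close> are comparable to
  \<open>r\<close>.\<close>

lemma pack_perturb:
  fixes E F :: "'a::euclidean_space set"
  assumes "bounded E" "bounded F" "r > 0" "s > 0" and EF: "\<And>x. x \<in> E \<Longrightarrow> \<exists>y\<in>F. dist x y \<le> e"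
  shows "pack r E \<le> pack 1 (cball (0::'a) ((e + s) / r)) * pack s F"
proof -
  obtain D where D: "D \<subseteq> F" "finite D" "card D = pack s F"
    "\<forall>x\<in>F. \<exists>y\<in>D. dist x y \<le> s"
    using pack_ex[OF assms(2,4)] by blast
  have "E \<subseteq> (\<Union>d\<in>D. cball d (e + s))"
  proof
    fix x assume "x \<in> E"
    then obtain y where "y \<in> F" "dist x y \<le> e" using EF by blast
    moreover then obtain d where "d \<in> D" "dist y d \<le> s" using D by blast
    ultimately have "dist d x \<le> e + s"
      by (smt (verit) dist_commute dist_triangle)
    then show "x \<in> (\<Union>d\<in>D. cball d (e + s))" using \<open>d \<in> D\<close> by auto
  qed
  then have "pack r E \<le> (\<Sum>d\<in>D. pack r (cball d (e + s)))"
    using assms D by (intro pack_Union_le) auto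
  also have "\<dots> = pack 1 (cball (0::'a) ((e + s) / r)) * pack s F"
    using D by (simp add: pack_cball[OF assms(3)])
  finally show ?thesis .
qed

lemma pack_rescale:
  fixes E :: "'a::euclidean_space set"
  assumes "bounded E" "r > 0" "L > 0"
  shows "pack r E \<le> pack 1 (cball (0::'a) L) * pack (L * r) E"
  using pack_perturb[of E E r "L*r" 0] assms by fastforce

lemma separated_card_interval:
  fixes D :: "real set"
  assumes "D \<subseteq> {a..a+l}" "separated r D" "r > 0" "l \<ge> 0"
  shows "finite D" "real (card D) \<le> l / r + 1"
proof -
  show fin: "finite D"
    using separated_card_le_pack(1)[of "{a..a+l}" r D] assms by auto
  let ?f = "\<lambda>x. \<lfloor>(x - a) / r\<rfloor>"
  have inj: "inj_on ?f D"
  proof (rule inj_onI)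
    fix x y assume xy: "x \<in> D" "y \<in> D" "?f x = ?f y"
    have "\<bar>(x - a) / r - (y - a) / r\<bar> < 1" using xy(3) by linarith
    then have "\<bar>x - y\<bar> < r" using assms by (simp add: abs_if divide_simps split: if_splits)
    then show "x = y" using separatedD[OF assms(2) xy(1,2)] by (force simp: dist_real_def)
  qed
  have sub: "?f ` D \<subseteq> {0..\<lfloor>l/r\<rfloor>}"
  proof
    fix k assume "k \<in> ?f ` D"
    then obtain x where x: "x \<in> D" "k = ?f x" by auto
    then have "a \<le> x" "x \<le> a + l" using assms by auto
    then have "0 \<le> (x - a) / r" "(x - a) / r \<le> l / r" using assms by (auto simp: divide_simps)
    then show "k \<in> {0..\<lfloor>l/r\<rfloor>}" using x by (auto intro: floor_mono)
  qed
  have "card D \<le> card {0..\<lfloor>l/r\<rfloor>}"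
    by (rule card_inj_on_le[OF inj sub]) simp
  also have "\<dots> = nat (\<lfloor>l/r\<rfloor> + 1)" by simp
  finally have "real (card D) \<le> real (nat (\<lfloor>l/r\<rfloor> + 1))" by linarith
  also have "\<dots> = of_int (\<lfloor>l/r\<rfloor> + 1)" using assms by simp
  also have "\<dots> \<le> l / r + 1" by linarith
  finally show "real (card D) \<le> l / r + 1" .
qed

lemma pack_interval:
  fixes E :: "real set"
  assumes "E \<subseteq> {a..a+l}" "r > 0" "l \<ge> 0"
  shows "real (pack r E) \<le> l / r + 1"
proof -
  have "bounded E" using assms bounded_closed_interval bounded_subset by blast
  then obtain D where "D \<subseteq> E" "separated r D" "card D = pack r E"
    using pack_ex[of E r] assms(2) by blast
  then show ?thesis using separated_card_interval(2)[of D a l r] assms by simp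
qed

text \<open>On the line the constant is linear in \<open>L\<close>; this lets a later rescaling by
  \<open>K ^ p1\<close> cost only about \<open>K ^ p1\<close>.\<close>

lemma pack_rescale_real:
  fixes E :: "real set"
  assumes "bounded E" "r > 0" "L > 0"
  shows "real (pack r E) \<le> (2 * L + 1) * real (pack (L * r) E)"
proof -
  have "real (pack 1 (cball (0::real) L)) \<le> 2 * L / 1 + 1"
    by (rule pack_interval[of _ "-L"]) (use assms in \<open>auto simp: dist_real_def\<close>)
  then have "real (pack 1 (cball (0::real) L) * pack (L * r) E) \<le> (2*L+1) * real (pack (L * r) E)"
    by (simp add: mult_right_mono)
  then show ?thesis using pack_rescale[OF assms] by linarith
qed

section \<open>Comparison of packing and covering numbers\<close>

lemma covering_number_le_pack:
  fixes E :: "'a::euclidean_space set"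
  assumes "bounded E" "r > 0"
  shows "covering_number r E \<le> of_nat (pack r E)"
proof -
  obtain D where D: "D \<subseteq> E" "finite D" "card D = pack r E"
    "\<forall>x\<in>E. \<exists>y\<in>D. dist x y \<le> r"
    using pack_ex[OF assms] by auto
  have "E \<subseteq> (\<Union>c\<in>D. cball c r)" using D(4) by (fastforce simp: dist_commute)
  then show ?thesis unfolding covering_number_def using D
    by (intro Inf_lower) (auto intro!: exI[of _ D])
qed

lemma pack_le_covering_number:
  fixes E :: "'a::euclidean_space set"
  assumes "bounded E" "r > 0"
  shows "of_nat (pack (2 * r) E) \<le> covering_number r E"
proof -
  obtain D where D: "D \<subseteq> E" "separated (2*r) D" "card D = pack (2*r) E"
    using pack_ex[of E "2*r"] assms by auto
  show ?thesis unfolding covering_number_def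
  proof (rule Inf_greatest)
    fix z :: ennreal assume "z \<in> {of_nat (card C) | C. finite C \<and> E \<subseteq> (\<Union>c\<in>C. cball c r)}"
    then obtain C where C: "finite C" "E \<subseteq> (\<Union>c\<in>C. cball c r)" "z = of_nat (card C)" by auto
    then have "card D \<le> card C" using card_separated_le_cover[OF C(1,2) D(1,2)] by simp
    then show "of_nat (pack (2 * r) E) \<le> z" using C D by (simp add: of_nat_mono)
  qed
qed

section \<open>Sums of finite sets\<close>

text \<open>Petridis' argument: the subset of \<open>A\<close> minimizing \<open>card (A' + B) / card A'\<close> works for every \<open>C\<close>.\<close>

lemma petridis:
  fixes A B :: "'a::ab_group_add set"
  assumes fin: "finite A" "finite B" "A \<noteq> {}" and K: "real (card (A + B)) \<le> K * real (card A)"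
  shows "\<exists>A'. A' \<subseteq> A \<and> A' \<noteq> {} \<and> (\<exists>K'\<le>K. 0 \<le> K' \<and> (\<forall>C. finite C \<longrightarrow> real (card (A' + B + C)) \<le> K' * real (card (A' + C))))"
proof -
  let ?F = "{A'. A' \<subseteq> A \<and> A' \<noteq> {}}"
  let ?q = "\<lambda>A'. real (card (A' + B)) / real (card A')"
  have finF: "finite ?F" by (rule finite_subset[of _ "Pow A"]) (use fin in auto)
  have neF: "?F \<noteq> {}" using fin by auto
  define X where "X = arg_min_on ?q ?F"
  have X: "X \<in> ?F" "\<And>A'. A' \<in> ?F \<Longrightarrow> ?q X \<le> ?q A'"
    using arg_min_if_finite(1)[OF finF neF, of ?q] arg_min_least[OF finF neF, of _ ?q]
    unfolding X_def by blast+
  define k where "k = ?q X"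
  have finX: "finite X" using X fin finite_subset by auto
  have cX: "card X > 0" using X finX by (simp add: card_gt_0_iff)
  have cA: "card A > 0" using fin by (simp add: card_gt_0_iff)
  have k0: "k \<ge> 0" by (simp add: k_def)
  have min: "k * real (card Y) \<le> real (card (Y + B))" if "Y \<subseteq> X" for Y
  proof (cases "Y = {}")
    case True then show ?thesis by simp
  next
    case False
    then have "Y \<in> ?F" using that X by auto
    moreover have "card Y > 0" using that False finX finite_subset by (auto simp: card_gt_0_iff)
    ultimately show ?thesis using X(2)[of Y] unfolding k_def by (simp add: field_simps)
  qed
  have eq: "k * real (card X) = real (card (X + B))" using cX by (simp add: k_def)
  have "?q X \<le> ?q A" using X(2)[of A] fin by auto
  also have "\<dots> \<le> K" using K cA by (simp add: divide_simps)
  finally have kK: "k \<le> K" by (simp add: k_def)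
  have main: "real (card (X + B + C)) \<le> k * real (card (X + C))" if "finite C" for C
    using that
  proof (induction C rule: finite_induct)
    case empty
    then show ?case by (simp add: set_plus_def)
  next
    case (insert c C)
    \<comment> \<open>For \<open>x\<close> in \<open>Y\<close> the sums \<open>x + b + c\<close> are
      already in \<open>X + B + C\<close>. So adding \<open>c\<close> creates at most
      \<open>card (X + B) - card (Y + B)\<close> new sums on the left, while \<open>X + C\<close>
      gains exactly \<open>card X - card Y\<close>. Minimality of the ratio at \<open>X\<close>,
      applied to \<open>Y\<close>, compares the two.\<close>
    define Y where "Y = {x \<in> X. x + c \<in> X + C}"
    define S where "S = (\<lambda>x. x + c) ` (X + B)"
    define S' where "S' = (\<lambda>x. x + c) ` (Y + B)"
    have YX: "Y \<subseteq> X" by (auto simp: Y_def)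
    have finS: "finite (X + B)" "finite (Y + B)" "finite (X + C)" "finite (X + B + C)"
      using finX fin insert finite_subset[OF YX] by (auto simp: finite_set_plus)
    have sub1: "X + B + insert c C \<subseteq> (X + B + C) \<union> (S - S')"
    proof
      fix z assume "z \<in> X + B + insert c C"
      then obtain x b d where z: "x \<in> X" "b \<in> B" "d \<in> insert c C" "z = x + b + d"
        by (auto simp: set_plus_def)
      show "z \<in> (X + B + C) \<union> (S - S')"
      proof (cases "d \<in> C \<or> z \<in> S'")
        case False
        then have "z \<in> S" using z by (auto simp: S_def set_plus_def intro!: image_eqI[of _ _ "x+b"])
        then show ?thesis using False by auto
      next
        case True
        then show ?thesis
        proof
          assume "d \<in> C"
          then show ?thesis using z by (auto simp: set_plus_def)
        next
          assume "z \<in> S'"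
          then obtain y b where y: "y \<in> Y" "b \<in> B" "z = y + b + c" by (auto simp: S'_def set_plus_def)
          then obtain x' c' where "x' \<in> X" "c' \<in> C" "y + c = x' + c'" by (auto simp: Y_def set_plus_def)
          then have "z = x' + b + c'" using y by (metis add.assoc add.commute)
          moreover have "x' + b + c' \<in> X + B + C"
            using \<open>x' \<in> X\<close> \<open>c' \<in> C\<close> y(2) by (intro set_plus_intro)
          ultimately show ?thesis by simp
        qed
      qed
    qed
    have cS: "card S = card (X + B)" unfolding S_def by (rule card_image) simp
    have cS': "card S' = card (Y + B)" unfolding S'_def by (rule card_image) simp
    have S'S: "S' \<subseteq> S" using YX by (auto simp: S_def S'_def set_plus_def)
    have finSS: "finite S" unfolding S_def using finS(1) by simp
    have "card (X + B + insert c C) \<le> card ((X + B + C) \<union> (S - S'))"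
      using sub1 finSS finS(4) by (intro card_mono) auto
    also have "\<dots> \<le> card (X + B + C) + card (S - S')" by (rule card_Un_le)
    finally have "card (X + B + insert c C) \<le> card (X + B + C) + card (S - S')" .
    moreover have "card (S - S') = card (X + B) - card (Y + B)"
      using S'S finS cS cS' by (simp add: card_Diff_subset S'_def)
    moreover have "card (Y + B) \<le> card (X + B)"
      using S'S finS cS cS' by (metis S_def card_mono finite_imageI)
    ultimately have "real (card (X + B + insert c C)) \<le> real (card (X + B + C)) + (real (card (X + B)) - real (card (Y + B)))"
      by linarith
    also have "\<dots> \<le> k * real (card (X + C)) + (k * real (card X) - k * real (card Y))"
      using insert.IH min[OF YX] eq by linarith
    also have "\<dots> = k * (real (card (X + C)) + (real (card X) - real (card Y)))" by (simp add: algebra_simps)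
    also have "\<dots> \<le> k * real (card (X + insert c C))"
    proof (rule mult_left_mono[OF _ k0])
      have e: "X + insert c C = (X + C) \<union> ((\<lambda>x. x + c) ` (X - Y))"
        by (auto simp: set_plus_def Y_def)
      have d: "(X + C) \<inter> ((\<lambda>x. x + c) ` (X - Y)) = {}"
        by (auto simp: Y_def)
      have "card (X + insert c C) = card (X + C) + card ((\<lambda>x. x + c) ` (X - Y))"
        unfolding e by (rule card_Un_disjoint) (use finS finX d in auto)
      also have "card ((\<lambda>x. x + c) ` (X - Y)) = card (X - Y)" by (rule card_image) simp
      also have "\<dots> = card X - card Y" using YX finite_subset[OF YX finX] by (rule card_Diff_subset[rotated])
      finally show "real (card (X + C)) + (real (card X) - real (card Y)) \<le> real (card (X + insert c C))"
        using card_mono[OF finX YX] by linarith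
    qed
    finally show ?case .
  qed
  show ?thesis using X kK k0 main by (intro exI[of _ X]) auto
qed

fun nsum :: "nat \<Rightarrow> 'a::ab_group_add set \<Rightarrow> 'a set" where
  "nsum 0 B = {0}"
| "nsum (Suc h) B = B + nsum h B"

lemma finite_nsum: "finite B \<Longrightarrow> finite (nsum h B)"
  by (induction h) (auto simp: finite_set_plus)

text \<open>Fix one representation \<open>d = f d - g d\<close> of each difference. The pair
  \<open>(x + f d, x + g d)\<close> determines \<open>d\<close> as the difference of its entries,
  and then \<open>x\<close>.\<close>

lemma ruzsa_triangle:
  fixes X Y Z :: "'a::ab_group_add set"
  assumes "finite X" "finite Y" "finite Z"
  shows "card X * card (Y + uminus ` Z) \<le> card (X + Y) * card (X + Z)"
proof -
  have "\<exists>y z. y \<in> Y \<and> z \<in> Z \<and> d = y - z" if "d \<in> Y + uminus ` Z" for d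
    using that by (auto simp: set_plus_def)
  then obtain f g where fg: "\<And>d. d \<in> Y + uminus ` Z \<Longrightarrow> f d \<in> Y \<and> g d \<in> Z \<and> d = f d - g d"
    by metis
  let ?h = "\<lambda>(x, d). (x + f d, x + g d)"
  have "inj_on ?h (X \<times> (Y + uminus ` Z))"
  proof (rule inj_onI, clarify)
    fix x d x' d'
    assume h: "x \<in> X" "x' \<in> X" "d \<in> Y + uminus ` Z" "d' \<in> Y + uminus ` Z"
      "x + f d = x' + f d'" "x + g d = x' + g d'"
    have "d = (x + f d) - (x + g d)" using fg[OF h(3)] by simp
    also have "\<dots> = d'" using h(5,6) fg[OF h(4)] by simp
    finally show "x = x' \<and> d = d'" using h(5) by simp
  qed
  moreover have "?h ` (X \<times> (Y + uminus ` Z)) \<subseteq> (X + Y) \<times> (X + Z)"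
    using fg by (auto simp: set_plus_def) blast+
  moreover have "finite ((X + Y) \<times> (X + Z))" using assms by (simp add: finite_set_plus)
  ultimately have "card (X \<times> (Y + uminus ` Z)) \<le> card ((X + Y) \<times> (X + Z))"
    by (rule card_inj_on_le)
  then show ?thesis by (simp add: card_cartesian_product)
qed

text \<open>Added to the Petridis subset \<open>A'\<close>, each further copy of \<open>B\<close>
  costs only a factor \<open>K\<close>. The triangle inequality with \<open>A'\<close> as pivot then
  removes \<open>A'\<close> and produces the difference set; one power of \<open>card A'\<close>
  cancels and the other is at most \<open>card B\<close>.\<close>

lemma plunnecke:
  fixes B :: "'a::ab_group_add set"
  assumes fin: "finite B" "B \<noteq> {}" and K: "real (card (B + B)) \<le> K * real (card B)"
  shows "real (card (nsum h B + uminus ` nsum h B)) \<le> K ^ (2 * h) * real (card B)"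
proof -
  obtain A' K' where A': "A' \<subseteq> B" "A' \<noteq> {}" "K' \<le> K" "0 \<le> K'"
    "\<And>C. finite C \<Longrightarrow> real (card (A' + B + C)) \<le> K' * real (card (A' + C))"
    using petridis[OF fin(1) fin(1) fin(2) K] by auto
  have finA: "finite A'" using A' fin finite_subset by blast
  have it: "real (card (A' + nsum h B)) \<le> K' ^ h * real (card A')" for h
  proof (induction h)
    case 0 then show ?case by (simp add: set_plus_def)
  next
    case (Suc h)
    have "real (card (A' + nsum (Suc h) B)) \<le> K' * real (card (A' + nsum h B))"
      using A'(5)[OF finite_nsum[OF fin(1)], of h] by (simp add: add.assoc)
    also have "\<dots> \<le> K' * (K' ^ h * real (card A'))" using Suc A' by (intro mult_left_mono) auto
    finally show ?case by (simp add: mult.assoc)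
  qed
  have c: "card A' > 0" using A' finA by (simp add: card_gt_0_iff)
  have "real (card A') * real (card (nsum h B + uminus ` nsum h B)) \<le> real (card (A' + nsum h B)) * real (card (A' + nsum h B))"
    using ruzsa_triangle[OF finA finite_nsum[OF fin(1)] finite_nsum[OF fin(1)], of h h]
    by (metis of_nat_le_iff of_nat_mult)
  also have "\<dots> \<le> (K' ^ h * real (card A')) * (K' ^ h * real (card A'))"
    using it A' by (intro mult_mono) auto
  also have "\<dots> = real (card A') * (K' ^ (2*h) * real (card A'))" by (simp add: mult_2 power_add)
  finally have "real (card (nsum h B + uminus ` nsum h B)) \<le> K' ^ (2*h) * real (card A')"
    using c by simp
  also have "\<dots> \<le> K ^ (2*h) * real (card B)"
    using A' fin by (intro mult_mono power_mono) (auto simp: card_mono)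
  finally show ?thesis .
qed


section \<open>From finite sets to bounded sets by rounding to a lattice\<close>

lemma bounded_set_plus:
  fixes A B :: "'a::real_normed_vector set"
  assumes "bounded A" "bounded B" shows "bounded (A + B)"
proof -
  have "A + B = (\<lambda>(x, y). x + y) ` (A \<times> B)" by (auto simp: set_plus_def)
  then show ?thesis using bounded_plus[OF assms] by simp
qed

lemma bounded_uminus_image:
  fixes A :: "'a::real_normed_vector set"
  assumes "bounded A" shows "bounded (uminus ` A)"
  using assms by (simp add: bounded_iff)

lemma bounded_nsum: "bounded A \<Longrightarrow> bounded (nsum h A)"
  for A :: "'a::real_normed_vector set"
  by (induction h) (auto intro: bounded_set_plus)

definition grid :: "real \<Rightarrow> 'a::euclidean_space set" where
  "grid \<delta> = {x. \<forall>b\<in>Basis. \<exists>k::int. x \<bullet> b = \<delta> * of_int k}"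

definition to_grid :: "real \<Rightarrow> 'a::euclidean_space \<Rightarrow> 'a" where
  "to_grid \<delta> x = (\<Sum>b\<in>Basis. (\<delta> * of_int \<lfloor>(x \<bullet> b) / \<delta>\<rfloor>) *\<^sub>R b)"

lemma to_grid_in: "to_grid \<delta> x \<in> grid \<delta>"
  unfolding grid_def to_grid_def by auto

lemma dist_to_grid:
  fixes x :: "'a::euclidean_space"
  assumes "\<delta> > 0" shows "dist x (to_grid \<delta> x) \<le> real DIM('a) * \<delta>"
proof -
  have "norm (x - to_grid \<delta> x) \<le> (\<Sum>b\<in>Basis. \<bar>(x - to_grid \<delta> x) \<bullet> b\<bar>)" by (rule norm_le_l1)
  also have "\<dots> \<le> (\<Sum>b\<in>(Basis::'a set). \<delta>)"
  proof (rule sum_mono)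
    fix b :: 'a assume b: "b \<in> Basis"
    have "(x - to_grid \<delta> x) \<bullet> b = x \<bullet> b - \<delta> * of_int \<lfloor>(x \<bullet> b) / \<delta>\<rfloor>"
      using b by (simp add: to_grid_def inner_diff_left)
    moreover have "\<delta> * of_int \<lfloor>(x \<bullet> b) / \<delta>\<rfloor> \<le> \<delta> * ((x \<bullet> b) / \<delta>)"
      using assms by (intro mult_left_mono) auto
    moreover have "\<delta> * ((x \<bullet> b) / \<delta>) \<le> \<delta> * (of_int \<lfloor>(x \<bullet> b) / \<delta>\<rfloor> + 1)"
      using assms by (intro mult_left_mono real_of_int_floor_add_one_ge) auto
    moreover have "\<delta> * ((x \<bullet> b) / \<delta>) = x \<bullet> b" using assms by simp
    moreover have "\<delta> * (of_int \<lfloor>(x \<bullet> b) / \<delta>\<rfloor> + 1) = \<delta> * of_int \<lfloor>(x \<bullet> b) / \<delta>\<rfloor> + \<delta>"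
      by (simp add: algebra_simps)
    ultimately show "\<bar>(x - to_grid \<delta> x) \<bullet> b\<bar> \<le> \<delta>" by linarith
  qed
  finally show ?thesis by (simp add: dist_norm)
qed

lemma grid_plus: "x \<in> grid \<delta> \<Longrightarrow> y \<in> grid \<delta> \<Longrightarrow> x + y \<in> grid \<delta>"
  unfolding grid_def by (fastforce simp: inner_add_left distrib_left[symmetric] simp flip: of_int_add)

lemma grid_uminus: "x \<in> grid \<delta> \<Longrightarrow> - x \<in> grid \<delta>"
  unfolding grid_def by (auto simp: minus_mult_right simp flip: of_int_minus)

lemma grid_nsum: "A \<subseteq> grid \<delta> \<Longrightarrow> nsum h A \<subseteq> grid \<delta>"
proof (induction h)
  case 0 show ?case by (auto simp: grid_def intro: exI[of _ 0])
next
  case (Suc h) then show ?case by (auto simp: set_plus_def intro!: grid_plus)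
qed

text \<open>Neighbouring lattice points are exactly \<open>\<delta>\<close> apart, which is not
  enough for the strict inequality in \<open>separated\<close>; hence the half.\<close>

lemma separated_grid:
  assumes "\<delta> > 0" shows "separated (\<delta>/2) (grid \<delta> :: 'a::euclidean_space set)"
  unfolding separated_def
proof safe
  fix x y :: 'a assume xy: "x \<in> grid \<delta>" "y \<in> grid \<delta>" "x \<noteq> y"
  then obtain b where b: "b \<in> Basis" "x \<bullet> b \<noteq> y \<bullet> b" by (meson euclidean_eqI)
  obtain k l :: int where kl: "x \<bullet> b = \<delta> * of_int k" "y \<bullet> b = \<delta> * of_int l"
    using xy(1,2) b(1) unfolding grid_def by blast
  then have "k \<noteq> l" using b by auto
  then have "1 \<le> \<bar>k - l\<bar>" by linarith
  then have "1 \<le> \<bar>real_of_int k - real_of_int l\<bar>" by linarith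
  then have "\<delta> * 1 \<le> \<delta> * \<bar>real_of_int k - real_of_int l\<bar>" using assms by (intro mult_left_mono) auto
  also have "\<dots> = \<bar>(x - y) \<bullet> b\<bar>" using kl assms
    by (simp add: inner_diff_left abs_mult flip: right_diff_distrib)
  also have "\<dots> \<le> dist x y" using b(1) by (simp add: dist_norm Basis_le_norm)
  finally show "\<delta>/2 < dist x y" using assms by simp
qed

lemma card_le_pack_grid:
  assumes "\<delta> > 0" "bounded L" "L \<subseteq> grid \<delta>"
  shows "finite L" "card L \<le> pack (\<delta>/2) L"
  using separated_card_le_pack[of L "\<delta>/2" L] separated_subset[OF separated_grid assms(3)] assms by auto

lemma pack_le_card:
  fixes E :: "'a::euclidean_space set"
  assumes "finite E" "r > 0" shows "pack r E \<le> card E"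
  using pack_ex[of E r] assms finite_imp_bounded card_mono by metis

lemma dist_add_le: "dist (a + b) (c + d) \<le> dist a c + dist b d"
  for a b c d :: "'a::real_normed_vector"
  by (metis dist_norm add_diff_add norm_triangle_ineq)

lemma set_plus_perturb:
  fixes A B :: "'a::real_normed_vector set"
  assumes "\<forall>x\<in>A. \<exists>y\<in>A'. dist x y \<le> e" "\<forall>x\<in>B. \<exists>y\<in>B'. dist x y \<le> e'"
  shows "\<forall>x\<in>A + B. \<exists>y\<in>A' + B'. dist x y \<le> e + e'"
proof
  fix x assume "x \<in> A + B"
  then obtain a b where ab: "a \<in> A" "b \<in> B" "x = a + b" by (auto simp: set_plus_def)
  then obtain a' b' where "a' \<in> A'" "dist a a' \<le> e" "b' \<in> B'" "dist b b' \<le> e'" using assms by blast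
  then show "\<exists>y\<in>A' + B'. dist x y \<le> e + e'"
    using ab dist_add_le[of a b a' b'] by (intro bexI[of _ "a' + b'"]) auto
qed

lemma nsum_perturb:
  fixes A B :: "'a::real_normed_vector set"
  assumes "\<forall>x\<in>A. \<exists>y\<in>A'. dist x y \<le> e"
  shows "\<forall>x\<in>nsum h A. \<exists>y\<in>nsum h A'. dist x y \<le> real h * e"
proof (induction h)
  case (Suc h)
  have "e + real h * e = real (Suc h) * e" by (simp add: algebra_simps)
  then show ?case using set_plus_perturb[OF assms Suc] by simp
qed simp

text \<open>The difference form is symmetric and additive in \<open>h\<close>, so that sums and
  differences of sets covered by it are again covered by a set of the same form.\<close>

definition ddiff :: "nat \<Rightarrow> 'a::ab_group_add set \<Rightarrow> 'a set" where
  "ddiff h X = nsum h X + uminus ` nsum h X"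

lemma bounded_ddiff: "bounded X \<Longrightarrow> bounded (ddiff h X)"
  for X :: "'a::real_normed_vector set"
  by (simp add: ddiff_def bounded_set_plus bounded_nsum bounded_uminus_image)

lemma ddiff_perturb:
  fixes A B :: "'a::real_normed_vector set"
  assumes "\<forall>x\<in>A. \<exists>y\<in>A'. dist x y \<le> e"
  shows "\<forall>x\<in>ddiff h A. \<exists>y\<in>ddiff h A'. dist x y \<le> 2 * real h * e"
proof -
  have "\<forall>x\<in>uminus ` nsum h A. \<exists>y\<in>uminus ` nsum h A'. dist x y \<le> real h * e"
    using nsum_perturb[OF assms, of h] by (auto simp: dist_minus)
  from set_plus_perturb[OF nsum_perturb[OF assms] this, of h]
  have "\<forall>x\<in>ddiff h A. \<exists>y\<in>ddiff h A'. dist x y \<le> real h * e + real h * e"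
    by (simp only: ddiff_def)
  moreover have "real h * e + real h * e = 2 * real h * e" by simp
  ultimately show ?thesis by simp
qed

text \<open>Rounding to the lattice of mesh \<open>\<delta>\<close> moves points by at most a
  constant times \<open>\<delta>\<close>, also after \<open>2 * h\<close> additions, so packing
  numbers of \<open>X\<close>, \<open>X + X\<close> and \<open>ddiff h X\<close> agree up to
  constants with cardinalities of the rounded sets. These are finite subsets of a group, where
  \<open>plunnecke\<close> applies.\<close>

lemma pack_ddiff_le:
  "\<exists>C\<ge>0. \<forall>(X::'a::euclidean_space set) \<delta> K. bounded X \<longrightarrow> X \<noteq> {} \<longrightarrow> \<delta> > 0 \<longrightarrow> 0 \<le> K \<longrightarrow>
     real (pack \<delta> (X + X)) \<le> K * real (pack \<delta> X) \<longrightarrow>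
     real (pack \<delta> (ddiff h X)) \<le> C * K ^ (2 * h) * real (pack \<delta> X)"
proof -
  define n where "n = real DIM('a)"
  define cst where "cst = (\<lambda>t. real (pack 1 (cball (0::'a) t)))"
  define c0 where "c0 = cst (2 * n + 2)"
  define c1 where "c1 = cst (4 * n + 2)"
  define c2 where "c2 = cst (n + 1/2)"
  define c3 where "c3 = cst (2 * h * n + 1/2)"
  define C where "C = c3 * ((c1 * c2) ^ (2 * h) * c0)"
  have nn: "c0 \<ge> 0" "c1 \<ge> 0" "c2 \<ge> 0" "c3 \<ge> 0" by (auto simp: c0_def c1_def c2_def c3_def cst_def)
  have perturb: "real (pack r E) \<le> cst ((e + s) / r) * real (pack s F)"
    if "bounded E" "bounded F" "r > 0" "s > 0" "\<forall>x\<in>E. \<exists>y\<in>F. dist x y \<le> e" for E F :: "'a set" and r s e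
    using pack_perturb[of E F r s e] that unfolding cst_def of_nat_mult[symmetric] of_nat_le_iff by blast
  show ?thesis
  proof (intro exI[of _ C] conjI allI impI)
    show "0 \<le> C" using nn by (simp add: C_def)
    fix X :: "'a set" and \<delta> K :: real
    assume X: "bounded X" "X \<noteq> {}" "\<delta> > 0" "0 \<le> K" and K: "real (pack \<delta> (X + X)) \<le> K * real (pack \<delta> X)"
    define L where "L = to_grid \<delta> ` X"
    have XL: "\<forall>x\<in>X. \<exists>y\<in>L. dist x y \<le> n * \<delta>"
      using dist_to_grid[OF X(3)] by (auto simp: L_def n_def)
    have LX: "\<forall>x\<in>L. \<exists>y\<in>X. dist x y \<le> n * \<delta>"
      using dist_to_grid[OF X(3)] by (auto simp: L_def n_def dist_commute)
    have Lg: "L \<subseteq> grid \<delta>" by (auto simp: L_def to_grid_in)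
    have bL: "bounded L"
    proof -
      obtain B where B: "\<forall>x\<in>X. norm x \<le> B" using X(1) bounded_iff by blast
      have "\<forall>x\<in>L. norm x \<le> B + n * \<delta>"
      proof
        fix x assume "x \<in> L"
        then obtain y where y: "y \<in> X" "dist x y \<le> n * \<delta>" using LX by blast
        have "norm x \<le> norm y + norm (x - y)" by (metis add.commute diff_add_cancel norm_triangle_ineq)
        then show "norm x \<le> B + n * \<delta>" using y B by (force simp: dist_norm)
      qed
      then show ?thesis using bounded_iff by blast
    qed
    have half: "\<delta>/2 > 0" using X by simp
    have finL: "finite L" using card_le_pack_grid[OF X(3) bL Lg] by simp
    have Lne: "L \<noteq> {}" using X by (simp add: L_def)
    have "real (card L) \<le> real (pack (\<delta>/2) L)" using card_le_pack_grid[OF X(3) bL Lg] by simp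
    also have "\<dots> \<le> cst ((n * \<delta> + \<delta>) / (\<delta>/2)) * real (pack \<delta> X)"
      by (rule perturb[OF bL X(1) half X(3) LX])
    also have "(n * \<delta> + \<delta>) / (\<delta>/2) = 2 * n + 2" using X by (simp add: field_simps)
    finally have a0: "real (card L) \<le> c0 * real (pack \<delta> X)" by (simp add: c0_def)
    have LLg: "L + L \<subseteq> grid \<delta>" using Lg by (auto simp: set_plus_def intro!: grid_plus)
    have bLL: "bounded (L + L)" using bL by (rule bounded_set_plus) (rule bL)
    have bXX: "bounded (X + X)" using X(1) by (intro bounded_set_plus)
    have "real (card (L + L)) \<le> real (pack (\<delta>/2) (L + L))" using card_le_pack_grid[OF X(3) bLL LLg] by simp
    also have "\<dots> \<le> cst ((n * \<delta> + n * \<delta> + \<delta>) / (\<delta>/2)) * real (pack \<delta> (X + X))"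
      by (rule perturb[OF bLL bXX half X(3) set_plus_perturb[OF LX LX]])
    also have "(n * \<delta> + n * \<delta> + \<delta>) / (\<delta>/2) = 4 * n + 2" using X by (simp add: field_simps)
    finally have a1: "real (card (L + L)) \<le> c1 * real (pack \<delta> (X + X))" by (simp add: c1_def)
    have "real (pack \<delta> X) \<le> cst ((n * \<delta> + \<delta>/2) / \<delta>) * real (pack (\<delta>/2) L)"
      by (rule perturb[OF X(1) bL X(3) half XL])
    also have "(n * \<delta> + \<delta>/2) / \<delta> = n + 1/2" using X by (simp add: field_simps)
    also have "cst (n + 1/2) * real (pack (\<delta>/2) L) \<le> c2 * real (card L)"
      unfolding c2_def[symmetric] using pack_le_card[OF finL half] nn by (intro mult_left_mono) auto
    finally have a2: "real (pack \<delta> X) \<le> c2 * real (card L)" .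
    have "real (card (L + L)) \<le> c1 * (K * (c2 * real (card L)))"
      using a1 K a2 nn X(4) by (meson mult_left_mono order_trans)
    then have dbl: "real (card (L + L)) \<le> (c1 * c2 * K) * real (card L)" by (simp add: mult_ac)
    have Dg: "ddiff h L \<subseteq> grid \<delta>"
      unfolding ddiff_def using grid_nsum[OF Lg, of h]
      by (auto simp: set_plus_def subset_iff simp del: add_uminus_conv_diff intro!: grid_plus grid_uminus)
    have bDL: "bounded (ddiff h L)" using bL by (rule bounded_ddiff)
    have bDX: "bounded (ddiff h X)" using X(1) by (rule bounded_ddiff)
    have finD: "finite (ddiff h L)" using card_le_pack_grid[OF X(3) bDL Dg] by simp
    have "real (pack \<delta> (ddiff h X)) \<le> cst ((2 * real h * (n * \<delta>) + \<delta>/2) / \<delta>) * real (pack (\<delta>/2) (ddiff h L))"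
      by (rule perturb[OF bDX bDL X(3) half ddiff_perturb[OF XL]])
    also have "(2 * real h * (n * \<delta>) + \<delta>/2) / \<delta> = 2 * h * n + 1/2" using X by (simp add: field_simps)
    also have "cst (2 * h * n + 1/2) * real (pack (\<delta>/2) (ddiff h L)) \<le> c3 * real (card (ddiff h L))"
      unfolding c3_def[symmetric] using pack_le_card[OF finD half] nn by (intro mult_left_mono) auto
    also have "\<dots> \<le> c3 * ((c1 * c2 * K) ^ (2 * h) * (c0 * real (pack \<delta> X)))"
    proof (intro mult_left_mono nn)
      have "real (card (ddiff h L)) \<le> (c1 * c2 * K) ^ (2 * h) * real (card L)"
        using plunnecke[OF finL Lne dbl, of h] by (simp add: ddiff_def)
      also have "\<dots> \<le> (c1 * c2 * K) ^ (2 * h) * (c0 * real (pack \<delta> X))"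
        using nn X by (intro mult_left_mono a0) auto
      finally show "real (card (ddiff h L)) \<le> \<dots>" .
    qed
    also have "\<dots> = C * K ^ (2 * h) * real (pack \<delta> X)"
      by (simp add: C_def power_mult_distrib mult_ac)
    finally show "real (pack \<delta> (ddiff h X)) \<le> C * K ^ (2 * h) * real (pack \<delta> X)" .
  qed
qed

section \<open>Slabs, fibres and energy\<close>

lemma card_le_pack_image:
  fixes F :: "'a::euclidean_space set"
  assumes "bounded F" "r > 0" "h ` S \<subseteq> F"
    and sep: "\<And>p q. p \<in> S \<Longrightarrow> q \<in> S \<Longrightarrow> p \<noteq> q \<Longrightarrow> r < dist (h p) (h q)"
  shows "card S \<le> pack r F"
proof -
  have "inj_on h S"
  proof (rule inj_onI, rule ccontr)
    fix p q assume "p \<in> S" "q \<in> S" "h p = h q" "p \<noteq> q"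
    then show False using sep[of p q] assms(2) by simp
  qed
  then have "card S = card (h ` S)" by (simp add: card_image)
  also have "\<dots> \<le> pack r F"
    by (rule separated_card_le_pack(2)[OF assms(1-3)]) (use sep in \<open>auto simp: separated_def\<close>)
  finally show ?thesis .
qed

text \<open>The set \<open>E\<close> has \<open>f\<close>-width at most \<open>r\<close>.
  Translating it by points of \<open>W\<close> whose \<open>f\<close>-values differ by more than
  \<open>2 * r\<close> gives copies whose \<open>f\<close>-values still differ by more than
  \<open>r\<close>, so packings of the copies combine into one.\<close>

lemma pack_slab:
  fixes E W :: "'a::euclidean_space set" and f :: "'a \<Rightarrow> real"
  assumes f: "linear f" "\<And>x. \<bar>f x\<bar> \<le> norm x" and bd: "bounded E" "bounded W"
    and r: "0 < \<delta>" "\<delta> \<le> r" and E: "\<And>x y. x \<in> E \<Longrightarrow> y \<in> E \<Longrightarrow> \<bar>f x - f y\<bar> \<le> r"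
  shows "pack (2 * r) (f ` W) * pack \<delta> E \<le> pack \<delta> (W + E)"
proof -
  have bfW: "bounded (f ` W)"
    using bd(2) f(2) by (auto simp: bounded_iff intro: order_trans)
  obtain D1 where D1: "D1 \<subseteq> f ` W" "separated (2*r) D1" "card D1 = pack (2*r) (f ` W)"
    using pack_ex[OF bfW, of "2*r"] r by auto
  obtain D2 where D2: "D2 \<subseteq> E" "separated \<delta> D2" "card D2 = pack \<delta> E"
    using pack_ex[OF bd(1) r(1)] by blast
  from D1(1) have "\<forall>d\<in>D1. \<exists>w\<in>W. f w = d" by blast
  then obtain g where g: "\<And>d. d \<in> D1 \<Longrightarrow> g d \<in> W \<and> f (g d) = d" by metis
  have "card (D1 \<times> D2) \<le> pack \<delta> (W + E)"
  proof (rule card_le_pack_image[where h = "\<lambda>(d, x). g d + x"])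
    show "bounded (W + E)" using bd by (simp add: bounded_set_plus)
    show "(\<lambda>(d, x). g d + x) ` (D1 \<times> D2) \<subseteq> W + E"
      using g D2(1) by (auto simp: set_plus_def)
    fix p q assume pq: "p \<in> D1 \<times> D2" "q \<in> D1 \<times> D2" "p \<noteq> q"
    obtain d x d' x' where dx: "p = (d, x)" "q = (d', x')" by fastforce
    show "\<delta> < dist ((\<lambda>(d, x). g d + x) p) ((\<lambda>(d, x). g d + x) q)"
    proof (cases "d = d'")
      case True
      then show ?thesis using pq dx separatedD[OF D2(2), of x x'] by (simp add: dist_norm)
    next
      case False
      have "2 * r < \<bar>d - d'\<bar>" using separatedD[OF D1(2), of d d'] pq dx False by (simp add: dist_real_def)
      moreover have "\<bar>f x - f x'\<bar> \<le> r" using E D2(1) pq dx by auto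
      moreover have "f (g d + x - (g d' + x')) = d - d' + (f x - f x')"
        using g pq dx by (simp add: linear_add[OF f(1)] linear_diff[OF f(1)])
      ultimately have "r < \<bar>f (g d + x - (g d' + x'))\<bar>" by linarith
      also have "\<dots> \<le> norm (g d + x - (g d' + x'))" by (rule f(2))
      finally show ?thesis using dx r by (simp add: dist_norm)
    qed
  qed (rule r)
  then show ?thesis using D1 D2 by (simp add: card_cartesian_product)
qed

lemma bounded_linear_image:
  fixes f :: "'a::euclidean_space \<Rightarrow> real"
  assumes "\<And>x. \<bar>f x\<bar> \<le> norm x" "bounded W" shows "bounded (f ` W)"
  using assms by (auto simp: bounded_iff intro: order_trans)

lemma pack_fibre:
  fixes W W' :: "'a::euclidean_space set" and f :: "'a \<Rightarrow> real"
  assumes f: "linear f" "\<And>x. \<bar>f x\<bar> \<le> norm x" and bd: "bounded W" "bounded W'"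
    and r: "0 < \<delta>" "\<delta> \<le> 2 * \<rho>"
  shows "pack (4 * \<rho>) (f ` W') * pack \<delta> W \<le> pack \<rho> (f ` W) * pack \<delta> (W' + W)"
proof -
  have \<rho>: "\<rho> > 0" using r by linarith
  obtain D where D: "D \<subseteq> f ` W" "finite D" "card D = pack \<rho> (f ` W)" "\<forall>x\<in>f ` W. \<exists>y\<in>D. dist x y \<le> \<rho>"
    using pack_ex[OF bounded_linear_image[OF f(2) bd(1)] \<rho>] by blast
  define E where "E = (\<lambda>d. {x \<in> W. dist (f x) d \<le> \<rho>})"
  have bE: "bounded (E d)" for d using bd(1) by (rule bounded_subset) (auto simp: E_def)
  have "pack \<delta> W \<le> (\<Sum>d\<in>D. pack \<delta> (E d))"
    by (rule pack_Union_le[OF bd(1) r(1) D(2)]) (use D(4) bE in \<open>auto simp: E_def\<close>)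
  then have "pack (4*\<rho>) (f ` W') * pack \<delta> W \<le> (\<Sum>d\<in>D. pack (4*\<rho>) (f ` W') * pack \<delta> (E d))"
    by (simp add: sum_distrib_left[symmetric])
  also have "\<dots> \<le> (\<Sum>d\<in>D. pack \<delta> (W' + W))"
  proof (rule sum_mono)
    fix d assume "d \<in> D"
    have "pack (2 * (2*\<rho>)) (f ` W') * pack \<delta> (E d) \<le> pack \<delta> (W' + E d)"
    proof (rule pack_slab[OF f bE bd(2) r])
      fix x y assume "x \<in> E d" "y \<in> E d"
      then show "\<bar>f x - f y\<bar> \<le> 2 * \<rho>" unfolding E_def dist_real_def mem_Collect_eq by linarith
    qed
    also have "\<dots> \<le> pack \<delta> (W' + W)"
      by (rule pack_mono) (use bd r in \<open>auto simp: E_def intro: bounded_set_plus elim!: set_plus_elim intro!: set_plus_intro\<close>)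
    finally show "pack (4*\<rho>) (f ` W') * pack \<delta> (E d) \<le> pack \<delta> (W' + W)" by simp
  qed
  finally show ?thesis using D by simp
qed

lemma card_slab_le:
  fixes W :: "'a::euclidean_space set" and f :: "'a \<Rightarrow> real"
  assumes f: "linear f" "\<And>x. \<bar>f x\<bar> \<le> norm x" and bd: "bounded W"
    and r: "0 < \<delta>" "\<delta> \<le> 2 * \<rho>" and D: "D \<subseteq> W" "separated \<delta> D"
  shows "pack (4 * \<rho>) (f ` W) * card {x \<in> D. \<bar>f x - c\<bar> \<le> \<rho>} \<le> pack \<delta> (W + W)"
proof -
  define E where "E = {x \<in> W. \<bar>f x - c\<bar> \<le> \<rho>}"
  have bE: "bounded E" using bd by (rule bounded_subset) (auto simp: E_def)
  have "card {x \<in> D. \<bar>f x - c\<bar> \<le> \<rho>} \<le> pack \<delta> E"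
    by (rule separated_card_le_pack(2)[OF bE r(1)]) (use D in \<open>auto simp: E_def separated_def\<close>)
  then have "pack (4 * \<rho>) (f ` W) * card {x \<in> D. \<bar>f x - c\<bar> \<le> \<rho>} \<le> pack (2 * (2*\<rho>)) (f ` W) * pack \<delta> E" by simp
  also have "\<dots> \<le> pack \<delta> (W + E)"
  proof (rule pack_slab[OF f bE bd r])
    fix x y assume "x \<in> E" "y \<in> E"
    then show "\<bar>f x - f y\<bar> \<le> 2 * \<rho>" unfolding E_def mem_Collect_eq by linarith
  qed
  also have "\<dots> \<le> pack \<delta> (W + W)"
    by (rule pack_mono) (use bd r in \<open>auto simp: E_def intro: bounded_set_plus elim!: set_plus_elim intro!: set_plus_intro\<close>)
  finally show ?thesis .
qed

text \<open>Cauchy-Schwarz over the fibres of \<open>h\<close>.\<close>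

lemma collision_count:
  assumes "finite S" "finite E" "h ` S \<subseteq> E"
  shows "(real (card S))\<^sup>2 \<le> real (card E) * real (card {(p, q). p \<in> S \<and> q \<in> S \<and> h p = h q})"
proof -
  define F where "F = (\<lambda>e. {p \<in> S. h p = e})"
  have "S = (\<Union>e\<in>E. F e)" using assms by (auto simp: F_def)
  have "card S = card (\<Union>e\<in>E. F e)" using assms by (intro arg_cong[of _ _ card]) (auto simp: F_def)
  also have "\<dots> = (\<Sum>e\<in>E. card (F e))"
    by (rule card_UN_disjoint) (use assms in \<open>auto simp: F_def\<close>)
  finally have c: "real (card S) = (\<Sum>e\<in>E. real (card (F e)))" by simp
  have "{(p, q). p \<in> S \<and> q \<in> S \<and> h p = h q} = (\<Union>e\<in>E. F e \<times> F e)" using assms by (auto simp: F_def)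
  moreover have "card (\<Union>e\<in>E. F e \<times> F e) = (\<Sum>e\<in>E. card (F e \<times> F e))"
    by (rule card_UN_disjoint) (use assms in \<open>auto simp: F_def\<close>)
  ultimately have "real (card {(p, q). p \<in> S \<and> q \<in> S \<and> h p = h q}) = (\<Sum>e\<in>E. (real (card (F e)))\<^sup>2)"
    by (simp add: card_cartesian_product power2_eq_square)
  then show ?thesis using sum_squared_le_sum_of_squares[of "\<lambda>e. real (card (F e))" E] c
    by (simp add: mult.commute)
qed

lemma card_near_le:
  fixes D :: "real set"
  assumes "separated r D" "r > 0" "l \<ge> 0"
  shows "real (card {x \<in> D. \<bar>x - c\<bar> \<le> l}) \<le> 2 * l / r + 1"
proof (rule separated_card_interval(2))
  show "{x \<in> D. \<bar>x - c\<bar> \<le> l} \<subseteq> {c - l..c - l + 2 * l}" by (auto simp: abs_le_iff)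
  show "separated r {x \<in> D. \<bar>x - c\<bar> \<le> l}" by (rule separated_subset[OF assms(1)]) auto
qed (use assms in auto)

text \<open>If \<open>x + t * y\<close> takes only about \<open>K * card D\<close> values on
  \<open>D \<times> D\<close>, then by Cauchy-Schwarz at least \<open>(card D) ^ 3 / K\<close>
  quadruples satisfy \<open>x + t * y = x' + t * y'\<close> up to \<open>2 * \<omega>\<close>.
  Summing over \<open>t\<close> and counting first the \<open>t\<close> compatible with a quadruple
  gives the three terms on the right: pairs with \<open>y' = y\<close>, pairs at distance at most
  \<open>r0\<close>, and distant pairs.\<close>

lemma energy_bound:
  fixes Z T D :: "real set"
  assumes bZ: "bounded Z" and w: "0 < \<omega>" "\<omega> \<le> r0" "r0 \<le> 1" "1 \<le> R" and K: "K > 0"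
    and T: "finite T" "T \<subseteq> {-R..R}" "separated \<omega> T"
    and D: "D \<subseteq> Z" "finite D" "separated \<omega> D" "card D = pack \<omega> Z" "D \<noteq> {}"
    and grow: "\<And>t. t \<in> T \<Longrightarrow> real (pack \<omega> (Z + (*) t ` Z)) \<le> K * real (pack \<omega> Z)"
    and F: "\<And>y. y \<in> D \<Longrightarrow> real (card {y' \<in> D. \<bar>y' - y\<bar> \<le> r0}) \<le> F"
  shows "real (card T) * real (card D) \<le>
    K * (5 * real (card T) + 35 * R * F / \<omega> + 5 * (real (card D))\<^sup>2 / r0)"
proof -
  define N where "N = real (card D)"
  define M where "M = real (card T)"
  have N: "N > 0" unfolding N_def using D(2,5) by (metis card_gt_0_iff of_nat_0_less_iff)
  have M: "M \<ge> 0" by (simp add: M_def)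
  define I where "I = (\<lambda>t x x' y y'. if \<bar>x - x' + t * (y - y')\<bar> \<le> 2 * \<omega> then 1 else (0::real))"
  have lower: "N ^ 3 \<le> K * (\<Sum>x\<in>D. \<Sum>y\<in>D. \<Sum>x'\<in>D. \<Sum>y'\<in>D. I t x x' y y')" if t: "t \<in> T" for t
  proof -
    have bZt: "bounded (Z + (*) t ` Z)"
      using bZ bounded_scaling[OF bZ, of t] by (simp add: bounded_set_plus)
    obtain E where E: "E \<subseteq> Z + (*) t ` Z" "finite E" "card E = pack \<omega> (Z + (*) t ` Z)"
      "\<forall>x\<in>Z + (*) t ` Z. \<exists>y\<in>E. dist x y \<le> \<omega>"
      using pack_ex[OF bZt w(1)] by blast
    have "\<forall>p\<in>D \<times> D. \<exists>e\<in>E. dist (fst p + t * snd p) e \<le> \<omega>"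
      using E(4) D(1) by (fastforce simp: set_plus_def)
    then obtain h where h: "\<And>p. p \<in> D \<times> D \<Longrightarrow> h p \<in> E \<and> dist (fst p + t * snd p) (h p) \<le> \<omega>" by metis
    define Q where "Q = {(p, q). p \<in> D \<times> D \<and> q \<in> D \<times> D \<and> h p = h q}"
    have finQ: "finite Q" by (rule finite_subset[of _ "(D \<times> D) \<times> (D \<times> D)"]) (use D in \<open>auto simp: Q_def\<close>)
    have "real (card Q) = (\<Sum>p\<in>D\<times>D. \<Sum>q\<in>D\<times>D. if h p = h q then 1 else 0)"
    proof -
      have "Q = {pq \<in> (D \<times> D) \<times> (D \<times> D). h (fst pq) = h (snd pq)}" by (auto simp: Q_def)
      then have "real (card Q) = (\<Sum>pq\<in>(D \<times> D) \<times> (D \<times> D). if h (fst pq) = h (snd pq) then 1 else 0)"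
        using D(2) by (simp add: sum.If_cases Int_def)
      then show ?thesis by (simp add: sum.cartesian_product case_prod_unfold)
    qed
    also have "\<dots> \<le> (\<Sum>p\<in>D\<times>D. \<Sum>q\<in>D\<times>D. I t (fst p) (fst q) (snd p) (snd q))"
    proof (intro sum_mono)
      fix p q assume pq: "p \<in> D \<times> D" "q \<in> D \<times> D"
      show "(if h p = h q then 1 else 0) \<le> I t (fst p) (fst q) (snd p) (snd q)"
      proof (cases "h p = h q")
        case True
        have "\<bar>(fst p + t * snd p) - h p\<bar> \<le> \<omega>" "\<bar>(fst q + t * snd q) - h p\<bar> \<le> \<omega>"
          using h[OF pq(1)] h[OF pq(2)] True by (auto simp: dist_real_def)
        then have "\<bar>fst p - fst q + t * (snd p - snd q)\<bar> \<le> 2 * \<omega>" unfolding right_diff_distrib by linarith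
        then show ?thesis by (simp add: I_def)
      qed (simp add: I_def)
    qed
    also have "\<dots> = (\<Sum>x\<in>D. \<Sum>y\<in>D. \<Sum>x'\<in>D. \<Sum>y'\<in>D. I t x x' y y')"
      by (simp add: sum.cartesian_product')
    finally have c: "real (card Q) \<le> (\<Sum>x\<in>D. \<Sum>y\<in>D. \<Sum>x'\<in>D. \<Sum>y'\<in>D. I t x x' y y')" .
    have "(real (card (D \<times> D)))\<^sup>2 \<le> real (card E) * real (card Q)"
      unfolding Q_def by (rule collision_count) (use D E h in auto)
    then have "N ^ 4 \<le> real (card E) * real (card Q)"
      by (simp add: N_def card_cartesian_product power2_eq_square eval_nat_numeral mult_ac)
    also have "\<dots> \<le> (K * N) * real (card Q)"
      using grow[OF t] E(3) D(4) by (intro mult_right_mono) (auto simp: N_def)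
    finally have "N * N ^ 3 \<le> N * (K * real (card Q))" by (simp add: eval_nat_numeral mult_ac)
    then have "N ^ 3 \<le> K * real (card Q)" using N by simp
    also have "\<dots> \<le> K * (\<Sum>x\<in>D. \<Sum>y\<in>D. \<Sum>x'\<in>D. \<Sum>y'\<in>D. I t x x' y y')"
      using c K by (intro mult_left_mono) auto
    finally show ?thesis .
  qed
  have upper: "(\<Sum>x'\<in>D. \<Sum>t\<in>T. I t x x' y y') \<le>
      (if y' = y then 5 * M else 0) + (if \<bar>y' - y\<bar> \<le> r0 then 35 * R / \<omega> else 0) + 5 * N / r0"
    if "x \<in> D" "y \<in> D" "y' \<in> D" for x y y'
  proof (cases "y' = y")
    case True
    have "(\<Sum>x'\<in>D. I t x x' y y') \<le> 5" for t
    proof -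
      have "(\<Sum>x'\<in>D. I t x x' y y') = real (card {x' \<in> D. \<bar>x' - x\<bar> \<le> 2 * \<omega>})"
        unfolding I_def True using D(2) by (simp add: sum.If_cases Int_def abs_minus_commute)
      also have "\<dots> \<le> 2 * (2 * \<omega>) / \<omega> + 1" by (rule card_near_le[OF D(3) w(1)]) (use w in simp)
      finally show ?thesis using w by simp
    qed
    then have "(\<Sum>t\<in>T. \<Sum>x'\<in>D. I t x x' y y') \<le> (\<Sum>t\<in>T. 5)" by (intro sum_mono)
    then have "(\<Sum>x'\<in>D. \<Sum>t\<in>T. I t x x' y y') \<le> 5 * M" by (subst sum.swap) (simp add: M_def)
    moreover have "0 \<le> (if \<bar>y' - y\<bar> \<le> r0 then 35 * R / \<omega> else 0)" "0 \<le> 5 * N / r0" using w N by auto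
    ultimately show ?thesis using True by simp
  next
    case False
    define d where "d = \<bar>y' - y\<bar>"
    have d: "d > \<omega>" using separatedD[OF D(3), of y' y] that False by (auto simp: d_def dist_real_def)
    have d0: "d > 0" using d w by linarith
    have cT: "(\<Sum>t\<in>T. I t x x' y y') \<le> 4 / d + 1" for x'
    proof -
      have "(\<Sum>t\<in>T. I t x x' y y') = real (card {t \<in> T. \<bar>x - x' + t * (y - y')\<bar> \<le> 2 * \<omega>})"
        unfolding I_def using T(1) by (simp add: sum.If_cases Int_def)
      also have "{t \<in> T. \<bar>x - x' + t * (y - y')\<bar> \<le> 2 * \<omega>} = {t \<in> T. \<bar>t - (x - x') / (y' - y)\<bar> \<le> 2 * \<omega> / d}"
      proof -
        have "\<bar>x - x' + t * (y - y')\<bar> = \<bar>t - (x - x') / (y' - y)\<bar> * d" for t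
        proof -
          have "x - x' + t * (y - y') = - ((t - (x - x') / (y' - y)) * (y' - y))" using False by (simp add: field_simps)
          then show ?thesis by (simp add: d_def abs_mult)
        qed
        then show ?thesis using d0 by (simp add: pos_le_divide_eq)
      qed
      also have "real (card \<dots>) \<le> 2 * (2 * \<omega> / d) / \<omega> + 1" by (rule card_near_le[OF T(3) w(1)]) (use w d0 in simp)
      also have "\<dots> = 4 / d + 1" using w by simp
      finally show ?thesis .
    qed
    show ?thesis
    proof (cases "d \<le> r0")
      case True
      have "(\<Sum>t\<in>T. I t x x' y y') \<le> (if \<bar>x' - x\<bar> \<le> 3 * R * d then 5 / d else 0)" for x'
      proof (cases "\<bar>x' - x\<bar> \<le> 3 * R * d")
        case True
        have "1 \<le> 1 / d" using \<open>d \<le> r0\<close> w d0 by (simp add: divide_simps)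
        then show ?thesis using cT[of x'] True by (simp add: add_divide_distrib[symmetric])
      next
        case False
        have "I t x x' y y' = 0" if "t \<in> T" for t
        proof -
          have "\<bar>t * (y - y')\<bar> = \<bar>t\<bar> * d" by (simp add: abs_mult d_def abs_minus_commute)
          also have "\<dots> \<le> R * d"
          proof (rule mult_right_mono)
            have "t \<in> {-R..R}" using that T(2) by blast
            then show "\<bar>t\<bar> \<le> R" by (auto simp: abs_le_iff)
          qed (use d0 in simp)
          finally have "\<bar>t * (y - y')\<bar> \<le> R * d" .
          moreover have "2 * \<omega> < 2 * R * d"
          proof -
            have "1 * d \<le> R * d" using d0 w by (intro mult_right_mono) auto
            then show ?thesis using d by linarith
          qed
          ultimately show ?thesis using False unfolding I_def by (auto simp: abs_if split: if_splits)
        qed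
        then show ?thesis using False by simp
      qed
      then have "(\<Sum>x'\<in>D. \<Sum>t\<in>T. I t x x' y y') \<le> (\<Sum>x'\<in>D. if \<bar>x' - x\<bar> \<le> 3 * R * d then 5 / d else 0)"
        by (rule sum_mono)
      also have "\<dots> = real (card {x' \<in> D. \<bar>x' - x\<bar> \<le> 3 * R * d}) * (5 / d)"
        using D(2) by (simp add: sum.If_cases Int_def)
      also have "\<dots> \<le> (2 * (3 * R * d) / \<omega> + 1) * (5 / d)"
        using d0 w by (intro mult_right_mono card_near_le[OF D(3) w(1)]) auto
      also have "\<dots> \<le> (7 * R * d / \<omega>) * (5 / d)"
      proof (rule mult_right_mono)
        have "1 * \<omega> \<le> R * d" using d w d0 by (intro mult_mono) auto
        then have "1 \<le> R * d / \<omega>" using w by (simp add: pos_le_divide_eq)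
        then show "2 * (3 * R * d) / \<omega> + 1 \<le> 7 * R * d / \<omega>" by simp
      qed (use d0 in simp)
      also have "\<dots> = 35 * R / \<omega>" using d0 by simp
      finally show ?thesis using False True N w by (simp add: d_def) (smt (verit) divide_nonneg_pos)
    next
      case f: False
      have "4 / d + 1 \<le> 5 / r0"
      proof -
        have "4 / d \<le> 4 / r0" using f w by (intro divide_left_mono) auto
        moreover have "1 \<le> 1 / r0" using w by (simp add: divide_simps)
        ultimately show ?thesis by (simp add: add_divide_distrib[symmetric])
      qed
      then have "(\<Sum>x'\<in>D. \<Sum>t\<in>T. I t x x' y y') \<le> (\<Sum>x'\<in>D. 5 / r0)"
        using cT by (intro sum_mono) (meson order_trans)
      then show ?thesis using False f by (simp add: d_def N_def mult.commute)
    qed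
  qed
  have "M * N ^ 3 = (\<Sum>t\<in>T. N ^ 3)" by (simp add: M_def)
  also have "\<dots> \<le> (\<Sum>t\<in>T. K * (\<Sum>x\<in>D. \<Sum>y\<in>D. \<Sum>x'\<in>D. \<Sum>y'\<in>D. I t x x' y y'))"
    by (intro sum_mono lower)
  also have "\<dots> = K * (\<Sum>x\<in>D. \<Sum>y\<in>D. \<Sum>y'\<in>D. \<Sum>x'\<in>D. \<Sum>t\<in>T. I t x x' y y')"
  proof -
    have "(\<Sum>t\<in>T. \<Sum>x\<in>D. \<Sum>y\<in>D. \<Sum>x'\<in>D. \<Sum>y'\<in>D. I t x x' y y') =
        (\<Sum>x\<in>D. \<Sum>t\<in>T. \<Sum>y\<in>D. \<Sum>x'\<in>D. \<Sum>y'\<in>D. I t x x' y y')" by (rule sum.swap)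
    also have "\<dots> = (\<Sum>x\<in>D. \<Sum>y\<in>D. \<Sum>t\<in>T. \<Sum>x'\<in>D. \<Sum>y'\<in>D. I t x x' y y')"
      by (intro sum.cong refl sum.swap)
    also have "\<dots> = (\<Sum>x\<in>D. \<Sum>y\<in>D. \<Sum>t\<in>T. \<Sum>y'\<in>D. \<Sum>x'\<in>D. I t x x' y y')"
      by (intro sum.cong refl sum.swap)
    also have "\<dots> = (\<Sum>x\<in>D. \<Sum>y\<in>D. \<Sum>y'\<in>D. \<Sum>t\<in>T. \<Sum>x'\<in>D. I t x x' y y')"
      by (intro sum.cong refl sum.swap)
    also have "\<dots> = (\<Sum>x\<in>D. \<Sum>y\<in>D. \<Sum>y'\<in>D. \<Sum>x'\<in>D. \<Sum>t\<in>T. I t x x' y y')"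
      by (intro sum.cong refl sum.swap)
    finally show ?thesis by (simp add: sum_distrib_left[symmetric])
  qed
  also have "\<dots> \<le> K * (\<Sum>x\<in>D. \<Sum>y\<in>D. \<Sum>y'\<in>D.
      (if y' = y then 5 * M else 0) + (if \<bar>y' - y\<bar> \<le> r0 then 35 * R / \<omega> else 0) + 5 * N / r0)"
    using K by (intro mult_left_mono sum_mono upper) auto
  also have "\<dots> \<le> K * (\<Sum>x\<in>D. \<Sum>y\<in>D. 5 * M + 35 * R * F / \<omega> + 5 * N\<^sup>2 / r0)"
  proof (intro mult_left_mono sum_mono)
    fix x y assume y: "y \<in> D"
    have "(\<Sum>y'\<in>D. if \<bar>y' - y\<bar> \<le> r0 then 35 * R / \<omega> else 0) = real (card {y' \<in> D. \<bar>y' - y\<bar> \<le> r0}) * (35 * R / \<omega>)"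
      using D(2) by (simp add: sum.If_cases Int_def)
    also have "\<dots> \<le> F * (35 * R / \<omega>)" using F[OF y] w by (intro mult_right_mono) auto
    finally have "(\<Sum>y'\<in>D. if \<bar>y' - y\<bar> \<le> r0 then 35 * R / \<omega> else 0) \<le> 35 * R * F / \<omega>" by (simp add: mult_ac)
    moreover have "(\<Sum>y'\<in>D. if y' = y then 5 * M else 0) = 5 * M" using y D(2) by simp
    moreover have "(\<Sum>y'\<in>D. 5 * N / r0) = 5 * N\<^sup>2 / r0"
      by (simp add: N_def power2_eq_square mult_ac)
    ultimately show "(\<Sum>y'\<in>D. (if y' = y then 5 * M else 0) + (if \<bar>y' - y\<bar> \<le> r0 then 35 * R / \<omega> else 0) + 5 * N / r0)
        \<le> 5 * M + 35 * R * F / \<omega> + 5 * N\<^sup>2 / r0"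
      unfolding sum.distrib by linarith
  qed (use K in simp)
  also have "\<dots> = N\<^sup>2 * (K * (5 * M + 35 * R * F / \<omega> + 5 * N\<^sup>2 / r0))"
    by (simp add: N_def power2_eq_square mult_ac)
  finally have "N\<^sup>2 * (M * N) \<le> N\<^sup>2 * (K * (5 * M + 35 * R * F / \<omega> + 5 * N\<^sup>2 / r0))"
    by (simp add: eval_nat_numeral mult_ac)
  then show ?thesis using N by (simp add: M_def N_def)
qed

section \<open>Multipliers\<close>

text \<open>With 0 and 1 present from the start, the single operation \<open>x * y - z * w\<close>
  contains products, differences and the inclusion of each level in the next; a sum takes two
  levels.\<close>

fun ringgen :: "'a::ring_1 set \<Rightarrow> nat \<Rightarrow> 'a set" where
  "ringgen A 0 = insert 0 (insert 1 A)"
| "ringgen A (Suc k) = {x * y - z * w | x y z w. x \<in> ringgen A k \<and> y \<in> ringgen A k \<and> z \<in> ringgen A k \<and> w \<in> ringgen A k}"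

lemma ringgen_step: "x \<in> ringgen A k \<Longrightarrow> y \<in> ringgen A k \<Longrightarrow> z \<in> ringgen A k \<Longrightarrow> w \<in> ringgen A k \<Longrightarrow>
   x * y - z * w \<in> ringgen A (Suc k)"
  by auto

declare ringgen.simps(2) [simp del]

lemma ringgen_0_1: "0 \<in> ringgen A k \<and> 1 \<in> ringgen A k"
proof (induction k)
  case (Suc k)
  then have "0 * 0 - 0 * 0 \<in> ringgen A (Suc k)" "1 * 1 - 0 * 0 \<in> ringgen A (Suc k)"
    by (blast intro: ringgen_step)+
  then show ?case by simp
qed simp

lemma ringgen_Suc: "x \<in> ringgen A k \<Longrightarrow> x \<in> ringgen A (Suc k)"
  using ringgen_step[of x A k 1 0 0] ringgen_0_1[of A k] by simp

lemma ringgen_mono: "x \<in> ringgen A k \<Longrightarrow> k \<le> l \<Longrightarrow> x \<in> ringgen A l"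
  by (induction l) (auto simp: le_Suc_eq intro: ringgen_Suc)

lemma ringgen_mult: "x \<in> ringgen A k \<Longrightarrow> y \<in> ringgen A k \<Longrightarrow> x * y \<in> ringgen A (Suc k)"
  using ringgen_step[of x A k y 0 0] ringgen_0_1[of A k] by simp

lemma ringgen_diff: "x \<in> ringgen A k \<Longrightarrow> y \<in> ringgen A k \<Longrightarrow> x - y \<in> ringgen A (Suc k)"
  using ringgen_step[of x A k 1 y 1] ringgen_0_1[of A k] by simp

lemma ringgen_add: "x \<in> ringgen A k \<Longrightarrow> y \<in> ringgen A k \<Longrightarrow> x + y \<in> ringgen A (Suc (Suc k))"
  using ringgen_diff[of x A "Suc k" "0 - y"] ringgen_diff[of 0 A k y] ringgen_0_1[of A k] ringgen_Suc[of x A k]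
  by simp

lemma ringgen_bounded:
  "\<exists>R\<ge>1. \<forall>(A::(real^'n) set). (\<forall>a\<in>A. \<forall>i. \<bar>a $ i\<bar> \<le> 2) \<longrightarrow> (\<forall>b\<in>ringgen A k. \<forall>i. \<bar>b $ i\<bar> \<le> R)"
proof (induction k)
  case 0
  have "\<bar>b $ i\<bar> \<le> 2" if A: "\<forall>a\<in>A. \<forall>i. \<bar>a $ i\<bar> \<le> 2" and b: "b \<in> ringgen A 0" for A :: "(real^'n) set" and b i
  proof -
    consider "b = 0" | "b = 1" | "b \<in> A" using b by auto
    then show ?thesis by cases (use A in auto)
  qed
  then show ?case by (intro exI[of _ 2]) simp
next
  case (Suc k)
  then obtain R where R1: "R \<ge> 1" and
    R2: "\<forall>A::(real^'n) set. (\<forall>a\<in>A. \<forall>i. \<bar>a $ i\<bar> \<le> 2) \<longrightarrow> (\<forall>b\<in>ringgen A k. \<forall>i. \<bar>b $ i\<bar> \<le> R)"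
    by (elim exE conjE)
  have R: "R \<ge> 1" "\<And>(A::(real^'n) set) b i. (\<forall>a\<in>A. \<forall>i. \<bar>a $ i\<bar> \<le> 2) \<Longrightarrow> b \<in> ringgen A k \<Longrightarrow> \<bar>b $ i\<bar> \<le> R"
    using R1 R2 by simp_all
  show ?case
  proof (intro exI[of _ "2 * R * R"] conjI allI impI ballI)
    have "1 * 1 \<le> R * R" using R(1) by (intro mult_mono) auto
    then show "1 \<le> 2 * R * R" by simp
    fix A :: "(real^'n) set" and b i
    assume A: "\<forall>a\<in>A. \<forall>i. \<bar>a $ i\<bar> \<le> 2" and b: "b \<in> ringgen A (Suc k)"
    obtain x y z w where b: "b = x * y - z * w" "x \<in> ringgen A k" "y \<in> ringgen A k" "z \<in> ringgen A k" "w \<in> ringgen A k"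
      using b by (auto simp: ringgen.simps(2))
    have "\<bar>x $ i\<bar> * \<bar>y $ i\<bar> \<le> R * R" "\<bar>z $ i\<bar> * \<bar>w $ i\<bar> \<le> R * R"
      using R(2)[OF A] b R(1) by (auto intro!: mult_mono)
    moreover have "\<bar>b $ i\<bar> \<le> \<bar>x $ i\<bar> * \<bar>y $ i\<bar> + \<bar>z $ i\<bar> * \<bar>w $ i\<bar>"
      unfolding b(1) by (simp flip: abs_mult)
    ultimately show "\<bar>b $ i\<bar> \<le> 2 * R * R" by linarith
  qed
qed

lemma norm_le_card_mult:
  fixes x :: "real^'n" assumes "\<And>i. \<bar>x $ i\<bar> \<le> R" shows "norm x \<le> real CARD('n) * R"
proof -
  have "norm x \<le> (\<Sum>i\<in>UNIV. \<bar>x $ i\<bar>)" by (rule norm_le_l1_cart)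
  also have "\<dots> \<le> (\<Sum>i\<in>(UNIV::'n set). R)" by (intro sum_mono assms)
  finally show ?thesis by simp
qed

lemma norm_mult_vec_le:
  fixes b x :: "real^'n" assumes "\<And>i. \<bar>b $ i\<bar> \<le> R" shows "norm (b * x) \<le> R * norm x"
proof -
  have R: "R \<ge> 0" using assms[of undefined] by linarith
  have "norm (b * x) \<le> norm (R *\<^sub>R x)"
    by (rule norm_le_componentwise_cart) (use assms R in \<open>auto simp: abs_mult intro: mult_right_mono\<close>)
  then show ?thesis using R by simp
qed

section \<open>Dilates of \<open>X\<close> covered by few translates of iterated difference
  sets\<close>

lemma nsum_add: "nsum h X + nsum h' X = nsum (h + h') X"
  for X :: "'a::ab_group_add set"
proof (induction h)
  case 0 show ?case by (simp add: set_plus_def)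
next
  case (Suc h) then show ?case by (simp add: add.assoc)
qed

lemma uminus_set_plus: "uminus ` (A + B) = uminus ` A + uminus ` B"
  for A :: "'a::ab_group_add set"
proof -
  have "uminus ` (A + B) = (\<lambda>(x, y). - (x + y)) ` (A \<times> B)" by (auto simp: set_plus_image image_image case_prod_unfold)
  also have "\<dots> = uminus ` A + uminus ` B" by (force simp: set_plus_def)
  finally show ?thesis .
qed

lemma ddiff_add: "ddiff h X + ddiff h' X = ddiff (h + h') X"
  for X :: "'a::ab_group_add set"
  unfolding ddiff_def nsum_add[symmetric] uminus_set_plus by (simp add: add_ac)

lemma ddiff_uminus: "uminus ` ddiff h X = ddiff h X"
  for X :: "'a::ab_group_add set"
  unfolding ddiff_def uminus_set_plus by (simp add: image_image add.commute)

text \<open>Unlike a bound on packing numbers, a covering by \<open>L\<close> translates can be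
  added, negated and dilated, which is what an induction over ring operations needs. The error is
  measured in units of \<open>\<delta>\<close> so that it stays a constant.\<close>

definition acov :: "'a::real_normed_vector set \<Rightarrow> real \<Rightarrow> nat \<Rightarrow> real \<Rightarrow> real \<Rightarrow> 'a set \<Rightarrow> bool" where
  "acov X \<delta> h L e Y \<longleftrightarrow> (\<exists>T. finite T \<and> real (card T) \<le> L \<and> (\<forall>y\<in>Y. \<exists>z\<in>T + ddiff h X. dist y z \<le> e * \<delta>))"

lemma acov_subset: "acov X \<delta> h L e Y \<Longrightarrow> Y' \<subseteq> Y \<Longrightarrow> acov X \<delta> h L e Y'"
  unfolding acov_def by blast

lemma card_set_plus_le: "finite A \<Longrightarrow> finite B \<Longrightarrow> card (A + B) \<le> card A * card B"
  unfolding set_plus_image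
  by (metis card_cartesian_product card_image_le finite_cartesian_product)

lemma acov_plus:
  assumes "acov X \<delta> h L e Y" "acov X \<delta> h' L' e' Y'"
  shows "acov X \<delta> (h + h') (L * L') (e + e') (Y + Y')"
proof -
  obtain T where T: "finite T" "real (card T) \<le> L" "\<forall>y\<in>Y. \<exists>z\<in>T + ddiff h X. dist y z \<le> e * \<delta>"
    using assms(1) unfolding acov_def by blast
  obtain T' where T': "finite T'" "real (card T') \<le> L'" "\<forall>y\<in>Y'. \<exists>z\<in>T' + ddiff h' X. dist y z \<le> e' * \<delta>"
    using assms(2) unfolding acov_def by blast
  have "\<forall>y\<in>Y + Y'. \<exists>z\<in>(T + ddiff h X) + (T' + ddiff h' X). dist y z \<le> e * \<delta> + e' * \<delta>"
    by (rule set_plus_perturb) (use T T' in auto)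
  moreover have "(T + ddiff h X) + (T' + ddiff h' X) = (T + T') + ddiff (h + h') X"
    by (simp add: ddiff_add[symmetric] add_ac)
  moreover have "real (card (T + T')) \<le> L * L'"
  proof -
    have "real (card (T + T')) \<le> real (card T) * real (card T')"
      using card_set_plus_le[OF T(1) T'(1)] by (metis of_nat_le_iff of_nat_mult)
    also have "\<dots> \<le> L * L'" using T T' by (intro mult_mono) auto
    finally show ?thesis .
  qed
  ultimately show ?thesis using T(1) T'(1) unfolding acov_def
    by (intro exI[of _ "T + T'"]) (simp add: finite_set_plus distrib_right)
qed

lemma acov_uminus:
  assumes "acov X \<delta> h L e Y" shows "acov X \<delta> h L e (uminus ` Y)"
proof -
  obtain T where T: "finite T" "real (card T) \<le> L" "\<forall>y\<in>Y. \<exists>z\<in>T + ddiff h X. dist y z \<le> e * \<delta>"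
    using assms(1) unfolding acov_def by blast
  have "\<exists>z\<in>uminus ` T + ddiff h X. dist y z \<le> e * \<delta>" if "y \<in> uminus ` Y" for y
  proof -
    from that obtain y' where y': "y' \<in> Y" "y = - y'" by auto
    then obtain z where z: "z \<in> T + ddiff h X" "dist y' z \<le> e * \<delta>" using T by blast
    then have "- z \<in> uminus ` T + ddiff h X" by (metis ddiff_uminus image_eqI uminus_set_plus)
    then show ?thesis using z y' by (intro bexI[of _ "- z"]) (auto simp: dist_minus)
  qed
  moreover have "card (uminus ` T) = card T" by (simp add: card_image)
  ultimately show ?thesis using T unfolding acov_def by (intro exI[of _ "uminus ` T"]) auto
qed

lemma acov_zero: "acov X \<delta> 0 1 0 {0}"
  unfolding acov_def by (intro exI[of _ "{0}"]) (auto simp: ddiff_def set_plus_def)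

lemma times_set_plus: "(*) b ` (A + B) = (*) b ` A + (*) b ` B"
  for A :: "'a::ring set"
proof (intro equalityI subsetI)
  fix x assume "x \<in> (*) b ` (A + B)"
  then obtain u v where "u \<in> A" "v \<in> B" "x = b * u + b * v"
    by (auto simp: set_plus_def distrib_left)
  then show "x \<in> (*) b ` A + (*) b ` B" by (auto simp: set_plus_def)
next
  fix x assume "x \<in> (*) b ` A + (*) b ` B"
  then obtain u v where uv: "u \<in> A" "v \<in> B" "x = b * u + b * v"
    by (auto simp: set_plus_def)
  then have "x = b * (u + v)" by (simp add: distrib_left)
  then show "x \<in> (*) b ` (A + B)" using uv by (auto simp: set_plus_def)
qed

lemma acov_mult_nsum:
  fixes X :: "(real^'n) set"
  assumes "acov X \<delta> h L e ((*) b ` X)"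
  shows "acov X \<delta> (k * h) (L ^ k) (real k * e) ((*) b ` nsum k X)"
proof (induction k)
  case 0 show ?case using acov_zero[of X \<delta>] by simp
next
  case (Suc k)
  have "e + real k * e = real (Suc k) * e" by (simp add: algebra_simps)
  then show ?case using acov_plus[OF assms Suc] by (simp add: times_set_plus)
qed

lemma acov_mult_ddiff:
  fixes X :: "(real^'n) set"
  assumes "acov X \<delta> h L e ((*) b ` X)"
  shows "acov X \<delta> (2 * k * h) (L ^ (2 * k)) (2 * real k * e) ((*) b ` ddiff k X)"
proof -
  have 1: "(*) b ` uminus ` nsum k X = uminus ` (*) b ` nsum k X" by (simp add: image_image)
  have 2: "k * h + k * h = 2 * k * h" "real k * e + real k * e = 2 * real k * e" by simp_all
  have 3: "L ^ k * L ^ k = L ^ (2 * k)" by (simp only: power_add[symmetric] mult_2)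
  show ?thesis
    using acov_plus[OF acov_mult_nsum[OF assms, of k] acov_uminus[OF acov_mult_nsum[OF assms, of k]]]
    unfolding ddiff_def times_set_plus 1 2 3 .
qed

text \<open>Dilation by \<open>b\<close> maps the \<open>L'\<close> translates to as many translates
  of \<open>b\<close> times \<open>ddiff k X\<close>. The latter is a sum of \<open>2 * k\<close>
  copies of plus or minus \<open>b X\<close>, each covered by \<open>L\<close> translates. Existing
  errors are stretched by at most \<open>R\<close>.\<close>

lemma acov_mult:
  fixes X :: "(real^'n) set"
  assumes b: "acov X \<delta> h L e ((*) b ` X)" and R: "\<And>i. \<bar>b $ i\<bar> \<le> R" and Y: "acov X \<delta> k L' e' Y"
  shows "acov X \<delta> (2 * k * h) (L' * L ^ (2 * k)) (R * e' + 2 * real k * e) ((*) b ` Y)"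
proof -
  have R0: "R \<ge> 0" using R[of undefined] by linarith
  obtain T' where T': "finite T'" "real (card T') \<le> L'" "\<forall>y\<in>Y. \<exists>z\<in>T' + ddiff k X. dist y z \<le> e' * \<delta>"
    using Y unfolding acov_def by blast
  have near: "\<forall>y\<in>(*) b ` Y. \<exists>z\<in>(*) b ` T' + (*) b ` ddiff k X. dist y z \<le> R * e' * \<delta>"
  proof
    fix y assume "y \<in> (*) b ` Y"
    then obtain y' where y': "y' \<in> Y" "y = b * y'" by auto
    then obtain z where z: "z \<in> T' + ddiff k X" "dist y' z \<le> e' * \<delta>" using T' by blast
    have "dist (b * y') (b * z) \<le> R * dist y' z"
      using norm_mult_vec_le[OF R, of "y' - z"] by (simp add: dist_norm right_diff_distrib)
    also have "\<dots> \<le> R * (e' * \<delta>)" using z R0 by (intro mult_left_mono) auto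
    finally have "dist y (b * z) \<le> R * e' * \<delta>" using y' by (simp add: mult.assoc)
    moreover have "b * z \<in> (*) b ` T' + (*) b ` ddiff k X" using z(1) times_set_plus by blast
    ultimately show "\<exists>z\<in>(*) b ` T' + (*) b ` ddiff k X. dist y z \<le> R * e' * \<delta>" by blast
  qed
  obtain S where S: "finite S" "real (card S) \<le> L ^ (2*k)"
    "\<forall>y\<in>(*) b ` ddiff k X. \<exists>z\<in>S + ddiff (2 * k * h) X. dist y z \<le> (2 * real k * e) * \<delta>"
    using acov_mult_ddiff[OF b, of k] unfolding acov_def by blast
  have "\<exists>z\<in>(*) b ` T' + S + ddiff (2 * k * h) X. dist y z \<le> (R * e' + 2 * real k * e) * \<delta>"
    if y: "y \<in> (*) b ` Y" for y
  proof -
    obtain z where z: "z \<in> (*) b ` T' + (*) b ` ddiff k X" "dist y z \<le> R * e' * \<delta>" using near y by blast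
    obtain t d where td: "t \<in> (*) b ` T'" "d \<in> (*) b ` ddiff k X" "z = t + d"
      using z(1) by (rule set_plus_elim)
    obtain z' where z': "z' \<in> S + ddiff (2*k*h) X" "dist d z' \<le> (2 * real k * e) * \<delta>" using S td by blast
    have "dist y (t + z') \<le> dist y z + dist z (t + z')" by (rule dist_triangle)
    also have "dist z (t + z') = dist d z'" using td by (simp add: dist_norm)
    finally have "dist y (t + z') \<le> (R * e' + 2 * real k * e) * \<delta>" using z z' by (simp add: distrib_right)
    moreover have "t + z' \<in> (*) b ` T' + S + ddiff (2 * k * h) X"
      unfolding add.assoc using td z' by (intro set_plus_intro) auto
    ultimately show ?thesis by blast
  qed
  moreover have "real (card ((*) b ` T' + S)) \<le> L' * L ^ (2 * k)"
  proof -
    have "real (card ((*) b ` T' + S)) \<le> real (card ((*) b ` T')) * real (card S)"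
      using card_set_plus_le[of "(*) b ` T'" S] T' S by (metis finite_imageI of_nat_le_iff of_nat_mult)
    also have "\<dots> \<le> L' * L ^ (2 * k)"
    proof (rule mult_mono)
      have "real (card ((*) b ` T')) \<le> real (card T')" using T'(1) by (simp add: card_image_le)
      then show "real (card ((*) b ` T')) \<le> L'" using T'(2) by linarith
      then show "0 \<le> L'" by linarith
    qed (use S in auto)
    finally show ?thesis .
  qed
  ultimately show ?thesis using T'(1) S(1) unfolding acov_def
    by (intro exI[of _ "(*) b ` T' + S"]) (auto simp: finite_set_plus)
qed

lemma pack_acov_le:
  fixes X Y :: "'a::euclidean_space set"
  assumes "acov X \<delta> h L e Y" "bounded X" "bounded Y" "\<delta> > 0" "e \<ge> 0"
  shows "real (pack \<delta> Y) \<le> real (pack 1 (cball (0::'a) (e + 1))) * L * real (pack \<delta> (ddiff h X))"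
proof -
  obtain T where T: "finite T" "real (card T) \<le> L" "\<forall>y\<in>Y. \<exists>z\<in>T + ddiff h X. dist y z \<le> e * \<delta>"
    using assms(1) unfolding acov_def by blast
  let ?c = "real (pack 1 (cball (0::'a) (e + 1)))"
  have bD: "bounded (ddiff h X)" using assms(2) by (rule bounded_ddiff)
  have bt: "bounded ((+) t ` ddiff h X)" for t using bD by (rule bounded_translation)
  have bT: "bounded (T + ddiff h X)" using T(1) bD by (simp add: bounded_set_plus finite_imp_bounded)
  have tr: "pack \<delta> ((+) t ` ddiff h X) = pack \<delta> (ddiff h X)" for t
    using pack_affine[OF bD assms(4), of 1 t] by simp
  have "pack \<delta> (T + ddiff h X) \<le> (\<Sum>t\<in>T. pack \<delta> ((+) t ` ddiff h X))"
    by (rule pack_Union_le[OF bT assms(4) T(1)]) (use bt in \<open>auto elim!: set_plus_elim\<close>)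
  also have "\<dots> = card T * pack \<delta> (ddiff h X)" by (simp add: tr)
  finally have 1: "real (pack \<delta> (T + ddiff h X)) \<le> real (card T) * real (pack \<delta> (ddiff h X))"
    by (metis of_nat_le_iff of_nat_mult)
  have "real (pack \<delta> Y) \<le> real (pack 1 (cball (0::'a) ((e * \<delta> + \<delta>) / \<delta>)) * pack \<delta> (T + ddiff h X))"
    unfolding of_nat_le_iff by (rule pack_perturb[OF assms(3) bT assms(4) assms(4)]) (use T in blast)
  also have "(e * \<delta> + \<delta>) / \<delta> = e + 1" using assms(4) by (simp add: field_simps)
  also have "real (pack 1 (cball (0::'a) (e + 1)) * pack \<delta> (T + ddiff h X)) \<le> ?c * (L * real (pack \<delta> (ddiff h X)))"
  proof -
    have "real (card T) * real (pack \<delta> (ddiff h X)) \<le> L * real (pack \<delta> (ddiff h X))"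
      using T(2) by (intro mult_right_mono) auto
    then show ?thesis using 1 by (simp add: mult_left_mono)
  qed
  finally show ?thesis by (simp add: mult.assoc)
qed

text \<open>Take a largest \<open>T\<close> in \<open>Y\<close> whose translates
  \<open>t + X\<close> are pairwise more than \<open>\<delta>\<close> apart. They pack into
  \<open>Y + X\<close>, so there are at most \<open>K\<close>. For any other \<open>y\<close> some
  \<open>y + x\<close> is within \<open>\<delta>\<close> of some \<open>t + x'\<close>, which puts
  \<open>y\<close> within \<open>\<delta>\<close> of \<open>t + (x' - x)\<close>.\<close>

lemma ruzsa_covering:
  fixes X Y :: "'a::euclidean_space set"
  assumes bd: "bounded X" "bounded Y" and X: "X \<noteq> {}" and \<delta>: "\<delta> > 0"
    and K: "real (pack \<delta> (Y + X)) \<le> K * real (pack \<delta> X)"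
  shows "acov X \<delta> 1 K 1 Y"
proof -
  define far where "far = (\<lambda>T. \<forall>s\<in>T. \<forall>t\<in>T. s \<noteq> t \<longrightarrow> (\<forall>x\<in>X. \<forall>x'\<in>X. \<delta> < dist (s + x) (t + x')))"
  obtain D where D: "D \<subseteq> X" "separated \<delta> D" "card D = pack \<delta> X" "finite D"
    using pack_ex[OF bd(1) \<delta>] by blast
  have bYX: "bounded (Y + X)" using bd by (rule bounded_set_plus[rotated])
  have px: "pack \<delta> X \<ge> 1" by (rule pack_pos[OF bd(1) \<delta> X])
  have far_card: "card T * pack \<delta> X \<le> pack \<delta> (Y + X)" if "T \<subseteq> Y" "far T" for T
  proof -
    have "card (T \<times> D) \<le> pack \<delta> (Y + X)"
    proof (rule card_le_pack_image[OF bYX \<delta>, where h = "\<lambda>(t, x). t + x"])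
      show "(\<lambda>(t, x). t + x) ` (T \<times> D) \<subseteq> Y + X" using that D(1) by (auto simp: set_plus_def)
      fix p q assume pq: "p \<in> T \<times> D" "q \<in> T \<times> D" "p \<noteq> q"
      obtain s x t x' where e: "p = (s, x)" "q = (t, x')" by fastforce
      show "\<delta> < dist (case p of (t, x) \<Rightarrow> t + x) (case q of (t, x) \<Rightarrow> t + x)"
      proof (cases "s = t")
        case True
        then show ?thesis using pq e separatedD[OF D(2), of x x'] by (simp add: dist_norm)
      next
        case False
        have "s \<in> T" "t \<in> T" "x \<in> X" "x' \<in> X" using pq e D(1) by auto
        then have "\<delta> < dist (s + x) (t + x')" using that(2) False unfolding far_def by blast
        then show ?thesis using e by simp
      qed
    qed
    then show ?thesis using D by (simp add: card_cartesian_product)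
  qed
  have farne: "finite T" if "T \<subseteq> Y" "far T" for T
  proof -
    obtain x where "x \<in> X" using X by blast
    then have "separated \<delta> T" using that(2) unfolding far_def separated_def
      by (metis add.commute dist_add_cancel)
    then show ?thesis using separated_card_le_pack(1)[OF bd(2) \<delta> that(1)] by simp
  qed
  define S where "S = card ` {T. T \<subseteq> Y \<and> far T}"
  have "S \<subseteq> {..pack \<delta> (Y + X)}"
  proof
    fix n assume "n \<in> S"
    then obtain T where T: "T \<subseteq> Y" "far T" "n = card T" by (auto simp: S_def)
    have "card T * 1 \<le> card T * pack \<delta> X" using px by (intro mult_le_mono2)
    then show "n \<in> {..pack \<delta> (Y + X)}" using far_card[OF T(1,2)] T(3) unfolding atMost_iff by linarith
  qed
  then have finS: "finite S" using finite_subset by blast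
  have "{} \<in> {T. T \<subseteq> Y \<and> far T}" by (simp add: far_def)
  then have "S \<noteq> {}" unfolding S_def by blast
  then have "Max S \<in> S" using finS by simp
  then obtain T where T: "T \<subseteq> Y" "far T" "card T = Max S" by (auto simp: S_def)
  have finT: "finite T" by (rule farne[OF T(1,2)])
  have "\<exists>z\<in>T + ddiff 1 X. dist y z \<le> 1 * \<delta>" if y: "y \<in> Y" for y
  proof -
    have "\<exists>t\<in>T. \<exists>x\<in>X. \<exists>x'\<in>X. dist (y + x) (t + x') \<le> \<delta>"
    proof (rule ccontr)
      assume c: "\<not> ?thesis"
      then have "far (insert y T)" using T(2) unfolding far_def
        by (auto simp: not_le dist_commute)
      then have "card (insert y T) \<in> S" using T(1) y unfolding S_def by blast
      then have "card (insert y T) \<le> card T" using T(3) finS by simp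
      moreover have "y \<notin> T"
      proof
        assume "y \<in> T"
        moreover obtain x where "x \<in> X" using X by blast
        ultimately have "\<not> dist (y + x) (y + x) \<le> \<delta>" using c by blast
        then show False using \<delta> by simp
      qed
      ultimately show False using finT by simp
    qed
    then obtain t x x' where t: "t \<in> T" "x \<in> X" "x' \<in> X" "dist (y + x) (t + x') \<le> \<delta>" by blast
    have "dist y (t + (x' - x)) = dist (y + x) (t + x')" by (simp add: dist_norm algebra_simps)
    moreover have "x' - x \<in> ddiff 1 X" using t unfolding ddiff_def by (force simp: set_plus_def)
    ultimately show ?thesis using t by (intro bexI[of _ "t + (x' - x)"]) auto
  qed
  moreover have "real (card T) \<le> K"
  proof -
    have "real (card T) * real (pack \<delta> X) \<le> K * real (pack \<delta> X)"
      using far_card[OF T(1,2)] K by (metis of_nat_le_iff of_nat_mult order_trans)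
    then show ?thesis using px by simp
  qed
  ultimately show ?thesis unfolding acov_def using finT by blast
qed

text \<open>The numbers \<open>h\<close>, \<open>p\<close> and \<open>e\<close> are fixed before
  \<open>X\<close>, \<open>A\<close>, \<open>\<delta>\<close> and \<open>K\<close>: a bounded number
  of ring operations costs a fixed power of \<open>K\<close>. Generators are covered by
  \<open>ruzsa_covering\<close>, products by two applications through
  \<open>acov_mult\<close>.\<close>

lemma acov_ringgen:
  "\<exists>h p e. e \<ge> 0 \<and> (\<forall>(X::(real^'n) set) A \<delta> K. bounded X \<longrightarrow> X \<noteq> {} \<longrightarrow> \<delta> > 0 \<longrightarrow> K \<ge> 1 \<longrightarrow>
     (\<forall>a\<in>A. \<forall>i. \<bar>a $ i\<bar> \<le> 2) \<longrightarrow>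
     (\<forall>a\<in>A. real (pack \<delta> ((*) a ` X + X)) \<le> K * real (pack \<delta> X)) \<longrightarrow>
     (\<forall>b\<in>ringgen A k. acov X \<delta> h (K ^ p) e ((*) b ` X)))"
proof (induction k)
  case 0
  show ?case
  proof (rule exI[of _ "1::nat"], rule exI[of _ "1::nat"], rule exI[of _ "1::real"], intro conjI allI impI ballI)
    fix X A :: "(real^'n) set" and \<delta> K :: real and b
    assume h: "bounded X" "X \<noteq> {}" "\<delta> > 0" "K \<ge> 1" "\<forall>a\<in>A. \<forall>i. \<bar>a $ i\<bar> \<le> 2"
      "\<forall>a\<in>A. real (pack \<delta> ((*) a ` X + X)) \<le> K * real (pack \<delta> X)" "b \<in> ringgen A 0"
    obtain x0 where x0: "x0 \<in> X" using h by blast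
    have in1: "x - y \<in> ddiff 1 X" if "x \<in> X" "y \<in> X" for x y
      using that unfolding ddiff_def by (force simp: set_plus_def)
    consider "b = 0" | "b = 1" | "b \<in> A" using h(7) by auto
    then show "acov X \<delta> 1 (K ^ 1) 1 ((*) b ` X)"
    proof cases
      case 1
      show ?thesis unfolding acov_def
        by (rule exI[of _ "{0}"]) (use h x0 in1[of x0 x0] 1 in \<open>auto simp: set_plus_def intro!: bexI[of _ 0]\<close>)
    next
      case 2
      show ?thesis unfolding acov_def
      proof (rule exI[of _ "{x0}"], intro conjI ballI)
        fix y assume "y \<in> (*) b ` X"
        then have "y \<in> X" using 2 by auto
        then have "x0 + (y - x0) \<in> {x0} + ddiff 1 X" using in1[OF _ x0] by (intro set_plus_intro) auto
        then show "\<exists>z\<in>{x0} + ddiff 1 X. dist y z \<le> 1 * \<delta>" using h by (intro bexI[of _ y]) auto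
      qed (use h in auto)
    next
      case 3
      have "bounded ((*) b ` X)"
      proof -
        obtain B where B: "\<forall>x\<in>X. norm x \<le> B" using h(1) bounded_iff by blast
        have "norm (b * x) \<le> 2 * B" if "x \<in> X" for x
          using norm_mult_vec_le[of b 2 x] h(5) 3 B that by (smt (verit))
        then show ?thesis by (auto simp: bounded_iff)
      qed
      then show ?thesis using ruzsa_covering[OF h(1) _ h(2,3), of "(*) b ` X" K] h(6) 3 by simp
    qed
  qed simp
next
  case (Suc k)
  then obtain h p e where e: "e \<ge> 0" and IH0: "\<forall>(X::(real^'n) set) A \<delta> K. bounded X \<longrightarrow> X \<noteq> {} \<longrightarrow> \<delta> > 0 \<longrightarrow> K \<ge> 1 \<longrightarrow>
     (\<forall>a\<in>A. \<forall>i. \<bar>a $ i\<bar> \<le> 2) \<longrightarrow>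
     (\<forall>a\<in>A. real (pack \<delta> ((*) a ` X + X)) \<le> K * real (pack \<delta> X)) \<longrightarrow>
     (\<forall>b\<in>ringgen A k. acov X \<delta> h (K ^ p) e ((*) b ` X))" by (elim exE conjE)
  have IH: "\<And>(X::(real^'n) set) A \<delta> K b. bounded X \<Longrightarrow> X \<noteq> {} \<Longrightarrow> \<delta> > 0 \<Longrightarrow> K \<ge> 1 \<Longrightarrow>
     (\<forall>a\<in>A. \<forall>i. \<bar>a $ i\<bar> \<le> 2) \<Longrightarrow>
     (\<forall>a\<in>A. real (pack \<delta> ((*) a ` X + X)) \<le> K * real (pack \<delta> X)) \<Longrightarrow> b \<in> ringgen A k \<Longrightarrow>
     acov X \<delta> h (K ^ p) e ((*) b ` X)" using IH0 by simp
  obtain R where R1: "R \<ge> 1" and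
    R2: "\<forall>A::(real^'n) set. (\<forall>a\<in>A. \<forall>i. \<bar>a $ i\<bar> \<le> 2) \<longrightarrow> (\<forall>b\<in>ringgen A k. \<forall>i. \<bar>b $ i\<bar> \<le> R)"
    using ringgen_bounded[of k, where 'n = 'n] by (elim exE conjE)
  have R: "R \<ge> 1" "\<And>(A::(real^'n) set) b i. (\<forall>a\<in>A. \<forall>i. \<bar>a $ i\<bar> \<le> 2) \<Longrightarrow> b \<in> ringgen A k \<Longrightarrow> \<bar>b $ i\<bar> \<le> R"
    using R1 R2 by simp_all
  let ?h = "2 * h * h" and ?p = "p + p * (2 * h)" and ?e = "R * e + 2 * real h * e"
  show ?case
  proof (rule exI[of _ "?h + ?h"], rule exI[of _ "?p + ?p"], rule exI[of _ "?e + ?e"], intro conjI allI impI ballI)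
    show "0 \<le> ?e + ?e" using e R(1) by simp
    fix X A :: "(real^'n) set" and \<delta> K :: real and b
    assume hyp: "bounded X" "X \<noteq> {}" "\<delta> > 0" "K \<ge> 1" "\<forall>a\<in>A. \<forall>i. \<bar>a $ i\<bar> \<le> 2"
      "\<forall>a\<in>A. real (pack \<delta> ((*) a ` X + X)) \<le> K * real (pack \<delta> X)" "b \<in> ringgen A (Suc k)"
    obtain x y z w where b: "b = x * y - z * w" "x \<in> ringgen A k" "y \<in> ringgen A k" "z \<in> ringgen A k" "w \<in> ringgen A k"
      using hyp(7) by (auto simp: ringgen.simps(2))
    note ih = IH[OF hyp(1-6)]
    have pr: "acov X \<delta> ?h (K ^ ?p) ?e ((*) (u * v) ` X)" if "u \<in> ringgen A k" "v \<in> ringgen A k" for u v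
    proof -
      have "acov X \<delta> (2 * h * h) (K ^ p * (K ^ p) ^ (2 * h)) ?e ((*) u ` (*) v ` X)"
        by (rule acov_mult[OF ih[OF that(1)] R(2)[OF hyp(5) that(1)] ih[OF that(2)]])
      then show ?thesis by (simp add: image_image mult.assoc power_add power_mult)
    qed
    have "acov X \<delta> (?h + ?h) (K ^ ?p * K ^ ?p) (?e + ?e) ((*) (x * y) ` X + uminus ` (*) (z * w) ` X)"
      using b by (intro acov_plus acov_uminus pr)
    then have "acov X \<delta> (?h + ?h) (K ^ ?p * K ^ ?p) (?e + ?e) ((*) b ` X)"
      by (rule acov_subset) (auto simp: b(1) set_plus_def left_diff_distrib)
    then show "acov X \<delta> (?h + ?h) (K ^ (?p + ?p)) (?e + ?e) ((*) b ` X)" by (simp only: power_add)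
  qed
qed

section \<open>Sets almost closed under ring operations\<close>

text \<open>All numerical constants and powers of \<open>R\<close> below are absorbed into powers of \<open>K\<close>; this is the
  reason for 6000.\<close>

locale ring_chain =
  fixes Z :: "nat \<Rightarrow> real set" and m p1 n1 :: nat and K R \<delta> \<kappa> :: real
  assumes zero_one: "0 \<in> Z 0" "1 \<in> Z 0"
    and step: "\<And>l x y z w. x \<in> Z l \<Longrightarrow> y \<in> Z l \<Longrightarrow> z \<in> Z l \<Longrightarrow> w \<in> Z l \<Longrightarrow> x * y - z * w \<in> Z (Suc l)"
    and bnd: "Z m \<subseteq> {-R..R}"
    and grow: "\<And>\<rho>. \<delta> \<le> \<rho> \<Longrightarrow> \<rho> \<le> 1 \<Longrightarrow> real (pack \<rho> (Z m)) \<le> K * real (pack \<rho> (Z 0))"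
    and nonconc: "\<And>\<rho>. \<delta> \<le> \<rho> \<Longrightarrow> \<rho> \<le> 1 \<Longrightarrow> \<rho> powr (-\<kappa>) \<le> K * real (pack \<rho> (Z 0))"
    and R: "1 \<le> R" and K: "6000 * R \<le> K" and \<delta>: "0 < \<delta>" and \<kappa>: "0 < \<kappa>" "\<kappa> \<le> 1"
    and p1: "6 \<le> real p1 * \<kappa>" and n1: "1 \<le> \<delta> * K ^ n1" and m: "n1 + 10 \<le> m"
    and \<delta>p1: "\<delta> * K ^ p1 \<le> 1"
begin

abbreviation P :: "real \<Rightarrow> real" where "P \<rho> \<equiv> real (pack \<rho> (Z 0))"

lemma K_ge: "K \<ge> 6000" "K \<ge> 1" "K > 0" using R K by linarith+

lemma zero_one_all: "0 \<in> Z l \<and> 1 \<in> Z l"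
proof (induction l)
  case (Suc l)
  then show ?case using step[of 0 l 0 0 0] step[of 1 l 1 0 0] by simp
qed (simp add: zero_one)

lemma Z_Suc: "x \<in> Z l \<Longrightarrow> x \<in> Z (Suc l)"
  using step[of x l 1 0 0] zero_one_all[of l] by simp

lemma Z_mono: "x \<in> Z l \<Longrightarrow> l \<le> l' \<Longrightarrow> x \<in> Z l'"
  by (induction l') (auto simp: le_Suc_eq intro: Z_Suc)

lemma Z_mult: "x \<in> Z l \<Longrightarrow> y \<in> Z l \<Longrightarrow> x * y \<in> Z (Suc l)"
  using step[of x l y 0 0] zero_one_all[of l] by simp

lemma Z_diff: "x \<in> Z l \<Longrightarrow> y \<in> Z l \<Longrightarrow> x - y \<in> Z (Suc l)"
  using step[of x l 1 y 1] zero_one_all[of l] by simp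

lemma Z_uminus: "x \<in> Z l \<Longrightarrow> - x \<in> Z (Suc l)"
  using Z_diff[of 0 l x] zero_one_all[of l] by simp

lemma Z_add: "x \<in> Z l \<Longrightarrow> y \<in> Z l \<Longrightarrow> x + y \<in> Z (Suc (Suc l))"
  using Z_diff[of x "Suc l" "- y"] Z_uminus[of y l] Z_Suc[of x l] by simp

lemma Z_bound: "x \<in> Z l \<Longrightarrow> l \<le> m \<Longrightarrow> \<bar>x\<bar> \<le> R"
  using Z_mono[of x l m] bnd by (auto simp: abs_le_iff)

lemma bounded_Z: "l \<le> m \<Longrightarrow> bounded (Z l)"
  using Z_bound by (auto simp: bounded_iff)

lemma P_ge1: "\<rho> > 0 \<Longrightarrow> P \<rho> \<ge> 1"
  using pack_pos[OF bounded_Z[of 0], of \<rho>] zero_one by fastforce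

lemma P_antimono: "0 < \<rho> \<Longrightarrow> \<rho> \<le> \<rho>' \<Longrightarrow> P \<rho>' \<le> P \<rho>"
  using pack_antimono[OF bounded_Z[of 0]] by simp

lemma P_rescale: "0 < \<rho> \<Longrightarrow> 0 < L \<Longrightarrow> P \<rho> \<le> (2 * L + 1) * P (L * \<rho>)"
  using pack_rescale_real[OF bounded_Z[of 0]] by simp

lemma P_upper: "\<rho> > 0 \<Longrightarrow> P \<rho> \<le> 2 * R / \<rho> + 1"
proof -
  have "Z 0 \<subseteq> {-R..-R + 2 * R}" using Z_bound[of _ 0] by (fastforce simp: abs_le_iff)
  then show "\<rho> > 0 \<Longrightarrow> P \<rho> \<le> 2 * R / \<rho> + 1" using pack_interval[of "Z 0" "-R" "2*R" \<rho>] R by simp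
qed

text \<open>At scale \<open>1 / K ^ p1\<close> non-concentration yields at least
  \<open>K ^ 5\<close> separated points, by \<open>6 \<le> p1 * \<kappa>\<close>. An interval of
  length \<open>2 * R\<close> cannot keep so many points \<open>1 / K ^ 3\<close> apart, so two of
  them are closer and their difference is the required element.\<close>

lemma small_element: "\<exists>z\<in>Z 1. 1 / K ^ p1 \<le> \<bar>z\<bar> \<and> \<bar>z\<bar> \<le> 1 / K ^ 3"
proof -
  define r where "r = 1 / K ^ p1"
  have K0: "K ^ p1 > 0" using K_ge by simp
  have r: "r > 0" "\<delta> \<le> r" "r \<le> 1" using K_ge \<delta>p1 K0 by (auto simp: r_def field_simps)
  have "K ^ 6 = K powr 6" using K_ge by simp
  also have "\<dots> \<le> K powr (real p1 * \<kappa>)" using p1 K_ge by (intro powr_mono) auto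
  also have "\<dots> = r powr (-\<kappa>)" using K_ge by (simp add: r_def powr_divide powr_minus powr_powr powr_realpow[symmetric] field_simps)
  also have "\<dots> \<le> K * P r" using nonconc r by simp
  finally have "K * K ^ 5 \<le> K * P r" by (simp add: eval_nat_numeral)
  then have lo: "K ^ 5 \<le> P r" using K_ge by simp
  have "P (1 / K ^ 3) \<le> 2 * R * K ^ 3 + 1" using P_upper[of "1 / K ^ 3"] K_ge by simp
  also have "\<dots> \<le> K * K ^ 3 + 1" using K R K_ge by (intro add_right_mono mult_right_mono) auto
  also have "\<dots> < K ^ 5"
  proof -
    have "1 \<le> K ^ 4" using K_ge by (intro one_le_power) auto
    then have "K ^ 4 + 1 < 6000 * K ^ 4" by linarith
    also have "\<dots> \<le> K * K ^ 4" using K_ge by (intro mult_right_mono) auto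
    finally show ?thesis by (simp add: eval_nat_numeral)
  qed
  finally have lt: "pack (1 / K ^ 3) (Z 0) < pack r (Z 0)" using lo by linarith
  obtain D where D: "D \<subseteq> Z 0" "separated r D" "card D = pack r (Z 0)"
    using pack_ex[OF bounded_Z[of 0] r(1)] by auto
  have "\<not> separated (1 / K ^ 3) D"
    using separated_card_le_pack(2)[OF bounded_Z[of 0], of "1 / K ^ 3" D] D lt K_ge by fastforce
  then obtain x y where xy: "x \<in> D" "y \<in> D" "x \<noteq> y" "dist x y \<le> 1 / K ^ 3"
    unfolding separated_def by (meson not_less)
  have "x - y \<in> Z 1" using Z_diff[of x 0 y] xy D by auto
  moreover have "r < dist x y" using separatedD[OF D(2) xy(1-3)] .
  ultimately show ?thesis using xy by (intro bexI[of _ "x - y"]) (auto simp: r_def dist_real_def)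
qed

text \<open>Powers of a small element \<open>z\<close> decrease from 1 by a factor of at most
  \<open>K ^ p1\<close> at a time and are below \<open>\<delta>\<close> after \<open>n1\<close>
  steps. The first power not exceeding \<open>r\<close> is therefore within \<open>K ^ p1\<close> of
  it.\<close>

lemma scale_element:
  assumes r: "\<delta> \<le> r" "r \<le> 1"
  shows "\<exists>z\<in>Z (Suc n1). r / K ^ p1 \<le> \<bar>z\<bar> \<and> \<bar>z\<bar> \<le> r"
proof -
  obtain z where z: "z \<in> Z 1" "1 / K ^ p1 \<le> \<bar>z\<bar>" "\<bar>z\<bar> \<le> 1 / K ^ 3" using small_element by blast
  have pw: "z ^ k \<in> Z (Suc k)" for k
  proof (induction k)
    case 0 then show ?case using zero_one_all by simp
  next
    case (Suc k)
    then show ?case using Z_mult[of z "Suc k" "z ^ k"] Z_mono[OF z(1), of "Suc k"] by simp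
  qed
  have "\<bar>z\<bar> \<le> 1 / K"
  proof -
    have "K ^ 1 \<le> K ^ 3" using K_ge by (intro power_increasing) auto
    then have "1 / K ^ 3 \<le> 1 / K" using K_ge by (intro divide_left_mono) auto
    then show ?thesis using z by linarith
  qed
  then have "\<bar>z\<bar> ^ n1 \<le> (1 / K) ^ n1" by (intro power_mono) auto
  also have "\<dots> \<le> \<delta>" using n1 K_ge by (simp add: field_simps)
  finally have ex: "\<bar>z\<bar> ^ n1 \<le> r" using r by simp
  define k where "k = (LEAST k. \<bar>z\<bar> ^ k \<le> r)"
  have k: "\<bar>z\<bar> ^ k \<le> r" unfolding k_def by (rule LeastI[of _ n1]) (rule ex)
  have kn: "k \<le> n1" unfolding k_def by (rule Least_le) (rule ex)
  have "r / K ^ p1 \<le> \<bar>z\<bar> ^ k"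
  proof (cases k)
    case 0
    have "1 \<le> K ^ p1" using K_ge by (intro one_le_power) auto
    then have "r / K ^ p1 \<le> r / 1" using r \<delta> by (intro divide_left_mono) auto
    then show ?thesis using 0 r by simp
  next
    case (Suc j)
    then have "\<not> \<bar>z\<bar> ^ j \<le> r" unfolding k_def using not_less_Least by (metis lessI)
    then have "r * (1 / K ^ p1) \<le> \<bar>z\<bar> ^ j * \<bar>z\<bar>" using z r \<delta> K_ge by (intro mult_mono) auto
    then show ?thesis using Suc by (simp add: mult.commute)
  qed
  then show ?thesis using k pw[of k] Z_mono[of "z ^ k" "Suc k" "Suc n1"] kn
    by (intro bexI[of _ "z ^ k"]) (auto simp: power_abs)
qed

lemma two_pow_le: "2 * K ^ p1 + 1 \<le> K ^ (p1 + 1)"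
proof -
  have "1 \<le> K ^ p1" using K_ge by (intro one_le_power) auto
  then have "2 * K ^ p1 + 1 \<le> 3 * K ^ p1" by linarith
  also have "\<dots> \<le> K * K ^ p1" using K_ge by (intro mult_right_mono) auto
  finally show ?thesis by simp
qed

text \<open>With a ring element \<open>z\<close> of size about \<open>r\<close>, the sums
  \<open>x + z * y\<close> place a shrunken copy of the ring at scale \<open>r * r'\<close> around
  each point of an \<open>r\<close>-separated set. All of them are ring elements of bounded level,
  so \<open>grow\<close> applies.\<close>

lemma superadditive:
  assumes r: "0 < r" "r \<le> 1" "0 < r'" "r' \<le> 1" "\<delta> \<le> r * r'"
  shows "P r * P r' \<le> K ^ (p1 + 3) * P (r * r')"
proof -
  have "r * r' \<le> r" using r by (simp add: mult_left_le)
  then have "\<delta> \<le> r" using r by linarith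
  then obtain z where z: "z \<in> Z (Suc n1)" "r / K ^ p1 \<le> \<bar>z\<bar>" "\<bar>z\<bar> \<le> r" using scale_element r by blast
  have Kp: "K ^ p1 > 0" using K_ge by simp
  have b0: "bounded (Z 0)" by (rule bounded_Z) simp
  \<comment> \<open>The spacing \<open>3 * R * r\<close> is there because
    \<open>z * (y - y')\<close> can be as large as \<open>2 * R * r\<close>. The second coordinates
    are spaced by \<open>K ^ p1 * r'\<close> because the size of \<open>z\<close> may fall short of
    \<open>r\<close> by the factor \<open>K ^ p1\<close>.\<close>
  obtain D1 where D1: "D1 \<subseteq> Z 0" "separated (3 * R * r) D1" "card D1 = pack (3 * R * r) (Z 0)"
    using pack_ex[OF b0, of "3 * R * r"] r R by auto
  obtain D2 where D2: "D2 \<subseteq> Z 0" "separated (K ^ p1 * r') D2" "card D2 = pack (K ^ p1 * r') (Z 0)"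
    using pack_ex[OF b0, of "K ^ p1 * r'"] r Kp by auto
  have rr: "r * r' > 0" using r by simp
  have "card (D1 \<times> D2) \<le> pack (r * r') (Z m)"
  proof (rule card_le_pack_image[OF bounded_Z[OF order_refl] rr, where h = "\<lambda>(x, y). x + z * y"])
    have "x + z * y \<in> Z m" if "x \<in> Z 0" "y \<in> Z 0" for x y
    proof -
      have "z * y \<in> Z (Suc (Suc n1))" using Z_mult[OF z(1)] Z_mono[OF that(2)] by simp
      then have "x + z * y \<in> Z (n1 + 4)"
        using Z_add[of x "Suc (Suc n1)" "z * y"] Z_mono[OF that(1)] by (simp add: eval_nat_numeral)
      then show ?thesis by (rule Z_mono) (use m in simp)
    qed
    then show "(\<lambda>(x, y). x + z * y) ` (D1 \<times> D2) \<subseteq> Z m" using D1 D2 by auto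
    fix p q assume pq: "p \<in> D1 \<times> D2" "q \<in> D1 \<times> D2" "p \<noteq> q"
    obtain x y x' y' where e: "p = (x, y)" "q = (x', y')" by fastforce
    have xy: "\<bar>y\<bar> \<le> R" "\<bar>y'\<bar> \<le> R" using Z_bound[of _ 0] pq e D2 by auto
    show "r * r' < dist (case p of (x, y) \<Rightarrow> x + z * y) (case q of (x, y) \<Rightarrow> x + z * y)"
    proof (cases "x = x'")
      case True
      then have "K ^ p1 * r' < \<bar>y - y'\<bar>" using separatedD[OF D2(2), of y y'] pq e by (auto simp: dist_real_def)
      then have "(r / K ^ p1) * (K ^ p1 * r') < \<bar>z\<bar> * \<bar>y - y'\<bar>"
        using z r Kp by (intro mult_le_less_imp_less) auto
      then have "r * r' < \<bar>z * (y - y')\<bar>" using K_ge by (simp add: abs_mult)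
      then show ?thesis using e True by (simp add: dist_real_def right_diff_distrib)
    next
      case False
      then have "3 * R * r < \<bar>x - x'\<bar>" using separatedD[OF D1(2), of x x'] pq e by (auto simp: dist_real_def)
      moreover have "\<bar>z * (y - y')\<bar> \<le> r * (2 * R)"
        unfolding abs_mult using z xy r by (intro mult_mono) auto
      moreover have "r * r' \<le> R * r" using r R mult_mono[of r' R r r] by (simp add: mult.commute)
      ultimately have "r * r' < \<bar>x - x' + z * (y - y')\<bar>" by (simp add: algebra_simps)
      then show ?thesis using e by (simp add: dist_real_def algebra_simps)
    qed
  qed
  then have c: "real (pack (3 * R * r) (Z 0)) * real (pack (K ^ p1 * r') (Z 0)) \<le> real (pack (r * r') (Z m))"
    using D1 D2 by (simp add: card_cartesian_product flip: of_nat_mult)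
  have "r * r' \<le> 1" using r by (simp add: mult_le_one)
  then have "real (pack (r * r') (Z m)) \<le> K * P (r * r')" using grow r by blast
  with c have c: "P (3 * R * r) * P (K ^ p1 * r') \<le> K * P (r * r')" by linarith
  have "P r \<le> (2 * (3 * R) + 1) * P (3 * R * r)" using P_rescale[of r "3 * R"] r R by simp
  also have "\<dots> \<le> K * P (3 * R * r)" using K R by (intro mult_right_mono) auto
  finally have 1: "P r \<le> K * P (3 * R * r)" .
  have "P r' \<le> (2 * K ^ p1 + 1) * P (K ^ p1 * r')" using P_rescale[of r' "K ^ p1"] r Kp by simp
  also have "\<dots> \<le> K ^ (p1 + 1) * P (K ^ p1 * r')" by (intro mult_right_mono two_pow_le) auto
  finally have 2: "P r' \<le> K ^ (p1 + 1) * P (K ^ p1 * r')" .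
  have "P r * P r' \<le> (K * P (3 * R * r)) * (K ^ (p1 + 1) * P (K ^ p1 * r'))"
    using 1 2 K_ge by (intro mult_mono) auto
  also have "\<dots> = K ^ (p1 + 2) * (P (3 * R * r) * P (K ^ p1 * r'))" by (simp add: power_add eval_nat_numeral)
  also have "\<dots> \<le> K ^ (p1 + 2) * (K * P (r * r'))" using c K_ge by (intro mult_left_mono) auto
  also have "\<dots> = K ^ (p1 + 3) * P (r * r')" by (simp add: power_add eval_nat_numeral)
  finally show ?thesis .
qed

text \<open>The exponent of \<open>K\<close> lost whenever two scales are multiplied.\<close>

abbreviation q :: nat where "q \<equiv> p1 + 3"

lemma superadditive_power:
  assumes r: "0 < r" "r \<le> 1" "\<delta> \<le> r ^ l"
  shows "P r ^ l \<le> K ^ (q * l) * P (r ^ l)"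
  using r(3)
proof (induction l)
  case 0
  then show ?case using P_ge1[of 1] by simp
next
  case (Suc l)
  have rl: "0 < r ^ l" "r ^ l \<le> 1" using r by (auto simp: power_le_one)
  have "r * r ^ l \<le> r ^ l" using r rl by (simp add: mult_left_le_one_le)
  then have \<open>\<delta> \<le> r ^ l\<close> using Suc.prems by simp
  then have IH: "P r ^ l \<le> K ^ (q * l) * P (r ^ l)" by (rule Suc.IH)
  have "P r ^ Suc l \<le> P r * (K ^ (q * l) * P (r ^ l))" using IH by (simp add: mult_left_mono)
  also have "\<dots> = K ^ (q * l) * (P r * P (r ^ l))" by simp
  also have "\<dots> \<le> K ^ (q * l) * (K ^ q * P (r * r ^ l))"
    using superadditive[of r "r ^ l"] r rl Suc.prems K_ge by (intro mult_left_mono) auto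
  also have "\<dots> = K ^ (q * Suc l) * P (r ^ Suc l)" by (simp add: power_add)
  finally show ?case .
qed

text \<open>A failure at \<open>i\<close> raises the exponent of growth from scale \<open>i\<close> to scale \<open>i - 1\<close> by a fixed amount, and
  this exponent is at most about 1.\<close>

lemma scale_selection:
  fixes a k :: nat
  assumes a: "a \<ge> 2" and c: "c > 0" "c * real k \<ge> 2 * real a ^ 2" and \<delta>1: "\<delta> < 1" "K * \<delta> < 1"
  shows "\<exists>i. 2 \<le> i \<and> i \<le> k + 1 \<and> P ((\<delta> powr (1 / real a ^ i)) ^ a) \<le>
     (\<delta> powr (1 / real a ^ i)) powr (-c) * P (\<delta> powr (1 / real a ^ i)) ^ a"
proof (rule ccontr)
  assume con: "\<not> ?thesis"
  define s where "s = (\<lambda>i. \<delta> powr (1 / real a ^ i))"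
  have s0: "s i > 0" for i using \<delta> by (simp add: s_def)
  have sa: "s (Suc i) ^ a = s i" for i
  proof -
    have "s (Suc i) ^ a = s (Suc i) powr real a" by (rule powr_realpow[symmetric]) (rule s0)
    also have "\<dots> = \<delta> powr (1 / real a ^ Suc i * real a)" unfolding s_def by (rule powr_powr)
    also have "1 / real a ^ Suc i * real a = 1 / real a ^ i" using a by simp
    finally show ?thesis by (simp add: s_def)
  qed
  have gt: "s i powr (-c) * P (s i) ^ a < P (s (i - 1))" if "2 \<le> i" "i \<le> k + 1" for i
  proof -
    have "s i powr (-c) * P (s i) ^ a < P (s i ^ a)" using con that unfolding s_def by force
    moreover have "s i ^ a = s (i - 1)" using sa[of "i - 1"] that by simp
    ultimately show ?thesis by simp
  qed
  \<comment> \<open>The failure at index \<open>j + 2\<close>, raised to the power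
    \<open>a ^ j\<close>, contributes the factor \<open>\<delta> powr (-(c / a ^ 2))\<close>
    whatever \<open>j\<close> is, since \<open>s (j + 2)\<close> is the root of
    \<open>\<delta>\<close> of order \<open>a ^ (j + 2)\<close>.\<close>
  have main: "\<delta> powr (-(c * real j / real a ^ 2)) * P (s (Suc j)) ^ (a ^ j) \<le> P (s 1)" if "j \<le> k" for j
    using that
  proof (induction j)
    case 0
    then show ?case using \<delta> by simp
  next
    case (Suc j)
    have "\<delta> powr (-(c * real (Suc j) / real a ^ 2)) * P (s (Suc (Suc j))) ^ (a ^ Suc j)
        = \<delta> powr (-(c * real j / real a ^ 2)) * (\<delta> powr (-(c / real a ^ 2)) * (P (s (Suc (Suc j))) ^ a) ^ (a ^ j))"
    proof -
      have ex: "-(c * real (Suc j) / real a ^ 2) = -(c * real j / real a ^ 2) + -(c / real a ^ 2)"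
        by (simp add: distrib_left add_divide_distrib)
      show ?thesis unfolding ex powr_add power_Suc power_mult by (simp only: mult.assoc)
    qed
    also have "\<delta> powr (-(c / real a ^ 2)) = (s (Suc (Suc j)) powr (-c)) ^ (a ^ j)"
    proof -
      have "(s (Suc (Suc j)) powr (-c)) ^ (a ^ j) = \<delta> powr (1 / real a ^ Suc (Suc j) * (-c) * real (a ^ j))"
        using s0[of "Suc (Suc j)"] \<delta> by (simp add: s_def powr_powr powr_realpow[symmetric])
      also have "1 / real a ^ Suc (Suc j) * (-c) * real (a ^ j) = -(c / real a ^ 2)"
        using a by (simp add: field_simps power2_eq_square)
      finally show ?thesis by simp
    qed
    also have "(s (Suc (Suc j)) powr (-c)) ^ (a ^ j) * (P (s (Suc (Suc j))) ^ a) ^ (a ^ j)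
        = (s (Suc (Suc j)) powr (-c) * P (s (Suc (Suc j))) ^ a) ^ (a ^ j)"
      by (simp add: power_mult_distrib)
    also have "\<delta> powr (-(c * real j / real a ^ 2)) * (s (Suc (Suc j)) powr (-c) * P (s (Suc (Suc j))) ^ a) ^ (a ^ j)
       \<le> \<delta> powr (-(c * real j / real a ^ 2)) * P (s (Suc j)) ^ (a ^ j)"
    proof (intro mult_left_mono power_mono)
      show "s (Suc (Suc j)) powr (-c) * P (s (Suc (Suc j))) ^ a \<le> P (s (Suc j))"
        using gt[of "Suc (Suc j)"] Suc.prems by simp
    qed auto
    also have "\<dots> \<le> P (s 1)" using Suc by simp
    finally show ?case .
  qed
  \<comment> \<open>By the choice of \<open>k\<close> the accumulated gain is at least
    \<open>\<delta> powr (-2)\<close>, while an interval of length \<open>2 * R\<close> holds at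
    most \<open>K / \<delta>\<close> separated points.\<close>
  have "\<delta> powr (-2) \<le> \<delta> powr (-(c * real k / real a ^ 2))"
    using c a \<delta> \<delta>1 by (intro powr_mono') (auto simp: field_simps)
  also have "\<dots> = \<delta> powr (-(c * real k / real a ^ 2)) * 1" by simp
  also have "\<dots> \<le> \<delta> powr (-(c * real k / real a ^ 2)) * P (s (Suc k)) ^ (a ^ k)"
    by (intro mult_left_mono one_le_power P_ge1 s0) auto
  also have "\<dots> \<le> P (s 1)" by (rule main) simp
  also have "\<dots> \<le> P \<delta>"
  proof (rule P_antimono[OF \<delta>])
    have "\<delta> powr 1 \<le> \<delta> powr (1 / real a ^ 1)" using a \<delta> \<delta>1 by (intro powr_mono') auto
    then show "\<delta> \<le> s 1" using \<delta> by (simp add: s_def)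
  qed
  also have "\<dots> \<le> 2 * R / \<delta> + 1" by (rule P_upper[OF \<delta>])
  also have "\<dots> \<le> K / \<delta>"
  proof -
    have "1 \<le> 1 / \<delta>" using \<delta> \<delta>1 by simp
    moreover have "(2 * R + 1) / \<delta> \<le> K / \<delta>" using K R \<delta> by (intro divide_right_mono) auto
    ultimately show ?thesis by (simp add: add_divide_distrib)
  qed
  finally have "\<delta> powr (-2) \<le> K / \<delta>" .
  moreover have "\<delta> powr (-2) = 1 / (\<delta> * \<delta>)" using \<delta> by (simp add: powr_minus_divide power2_eq_square)
  ultimately have "1 \<le> K * \<delta>" using \<delta> by (simp add: field_simps)
  then show False using \<delta>1 by simp
qed

end

text \<open>Follow the binary digits of \<open>l\<close> backwards: each digit applies one of the
  maps \<open>v / 2\<close> and \<open>(v + 1) / 2\<close>, which halves the error and adds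
  \<open>\<sigma>\<close>. Such errors converge to \<open>2 * \<sigma>\<close>; the third
  \<open>\<sigma>\<close> absorbs the remaining \<open>(1/2) ^ n\<close>.\<close>

lemma dyadic_dense:
  fixes Q :: "real set"
  assumes Q: "Q \<subseteq> {0..1}" "Q \<noteq> {}" and \<sigma>: "\<sigma> > 0"
    and half: "\<And>q. q \<in> Q \<Longrightarrow> \<exists>u\<in>Q. \<bar>q / 2 - u\<bar> \<le> \<sigma>" "\<And>q. q \<in> Q \<Longrightarrow> \<exists>u\<in>Q. \<bar>(q + 1) / 2 - u\<bar> \<le> \<sigma>"
    and l: "0 \<le> l" "l \<le> 1"
  shows "\<exists>u\<in>Q. \<bar>l - u\<bar> \<le> 3 * \<sigma>"
proof -
  have main: "\<exists>u\<in>Q. \<bar>l - u\<bar> \<le> 2 * \<sigma> + (1/2) ^ n" if "0 \<le> l" "l \<le> 1" for l n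
    using that
  proof (induction n arbitrary: l)
    case 0
    obtain u where "u \<in> Q" using Q by blast
    moreover have "0 \<le> u" "u \<le> 1" using Q(1) \<open>u \<in> Q\<close> by auto
    ultimately show ?case using 0 \<sigma> by (intro bexI[of _ u]) auto
  next
    case (Suc n)
    show ?case
    proof (cases "l \<le> 1/2")
      case True
      then obtain q where q: "q \<in> Q" "\<bar>2 * l - q\<bar> \<le> 2 * \<sigma> + (1/2) ^ n" using Suc.IH[of "2 * l"] Suc.prems by auto
      obtain u where "u \<in> Q" "\<bar>q / 2 - u\<bar> \<le> \<sigma>" using half(1)[OF q(1)] by blast
      then show ?thesis using q by (intro bexI[of _ u]) (auto simp: abs_le_iff)
    next
      case False
      then obtain q where q: "q \<in> Q" "\<bar>(2 * l - 1) - q\<bar> \<le> 2 * \<sigma> + (1/2) ^ n" using Suc.IH[of "2 * l - 1"] Suc.prems by auto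
      obtain u where "u \<in> Q" "\<bar>(q + 1) / 2 - u\<bar> \<le> \<sigma>" using half(2)[OF q(1)] by blast
      then show ?thesis using q by (intro bexI[of _ u]) (auto simp: abs_le_iff add_divide_distrib)
    qed
  qed
  obtain n where "(1/2) ^ n < \<sigma>" using real_arch_pow_inv[OF \<sigma>, of "1/2"] by auto
  then show ?thesis using main[OF l, of n] by force
qed

lemma separated_interval_ex:
  assumes "0 < \<sigma>" "\<sigma> \<le> 1/4"
  shows "\<exists>T. finite T \<and> T \<subseteq> {0..1::real} \<and> separated \<sigma> T \<and> 1 / (4 * \<sigma>) \<le> real (card T)"
proof -
  define n where "n = nat \<lfloor>1 / (2 * \<sigma>)\<rfloor>"
  define T where "T = (\<lambda>i. 2 * \<sigma> * real i) ` {..<n}"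
  have n: "real n \<le> 1 / (2 * \<sigma>)" "1 / (2 * \<sigma>) - 1 \<le> real n" using assms by (auto simp: n_def)
  have inj: "inj_on (\<lambda>i. 2 * \<sigma> * real i) {..<n}" using assms by (auto simp: inj_on_def)
  have "T \<subseteq> {0..1}"
  proof
    fix t assume "t \<in> T"
    then obtain i where i: "i < n" "t = 2 * \<sigma> * real i" by (auto simp: T_def)
    then have "real i \<le> 1 / (2 * \<sigma>)" using n by linarith
    then have "2 * \<sigma> * real i \<le> 2 * \<sigma> * (1 / (2 * \<sigma>))" using assms by (intro mult_left_mono) auto
    then show "t \<in> {0..1}" using i assms by auto
  qed
  moreover have "separated \<sigma> T" unfolding separated_def
  proof safe
    fix x y assume "x \<in> T" "y \<in> T" "x \<noteq> y"
    then obtain i j where ij: "x = 2 * \<sigma> * real i" "y = 2 * \<sigma> * real j" "i \<noteq> j" by (auto simp: T_def)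
    then have "1 \<le> \<bar>real i - real j\<bar>" by linarith
    then have "2 * \<sigma> * 1 \<le> 2 * \<sigma> * \<bar>real i - real j\<bar>" using assms by (intro mult_left_mono) auto
    also have "\<dots> = dist x y" using ij assms by (simp add: dist_real_def abs_mult right_diff_distrib[symmetric])
    finally show "\<sigma> < dist x y" using assms by simp
  qed
  moreover have "1 / (4 * \<sigma>) \<le> real (card T)"
  proof -
    have "1 \<le> 1 / (4 * \<sigma>)" using assms by simp
    moreover have "1 / (2 * \<sigma>) = 1 / (4 * \<sigma>) + 1 / (4 * \<sigma>)" using assms by (simp add: field_simps)
    ultimately have "1 / (4 * \<sigma>) \<le> real n" using n by linarith
    then show ?thesis by (simp add: T_def card_image[OF inj])
  qed
  ultimately show ?thesis by (intro exI[of _ T]) (simp add: T_def)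
qed

context ring_chain
begin

text \<open>After scaling by some \<open>z\<close> with \<open>\<bar>z * y\<bar>\<close> about \<open>\<theta>\<close>, the set on the left becomes a set of ring
  elements at scale \<open>\<omega> * \<theta>\<close> inside an interval of length about \<open>\<theta>\<close>, which holds
  about a fraction \<open>1 / P \<theta>\<close> of the ring.\<close>

lemma quotient_cost:
  assumes \<theta>: "0 < \<theta>" "\<theta> \<le> 1" and \<omega>: "0 < \<omega>" "\<omega> \<le> 1" and sc: "\<delta> * K ^ p1 \<le> \<omega> * \<theta>" "\<delta> * R \<le> \<theta>"
    and sub: "P (\<omega> * \<theta>) \<le> K3 * P \<omega> * P \<theta>"
    and xy: "x \<in> Z 3" "y \<in> Z 3" "\<theta> \<le> \<bar>y\<bar>" "\<bar>x\<bar> \<le> \<bar>y\<bar>"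
  shows "real (pack \<omega> (Z 0 + (*) (x / y) ` Z 0)) \<le> K ^ q * K3 * P \<omega>"
proof -
  have y0: "\<bar>y\<bar> > 0" using xy \<theta> by linarith
  have yR: "\<bar>y\<bar> \<le> R" using Z_bound[OF xy(2)] m by simp
  have "\<delta> * \<bar>y\<bar> \<le> \<delta> * R" using yR \<delta> by (intro mult_left_mono) auto
  then have r: "\<delta> \<le> \<theta> / \<bar>y\<bar>" "\<theta> / \<bar>y\<bar> \<le> 1" using sc xy y0 by (simp_all add: pos_le_divide_eq)
  \<comment> \<open>This size makes the product of the sizes of \<open>z\<close> and
    \<open>y\<close> agree with \<open>\<theta>\<close> up to the factor \<open>K ^ p1\<close>,
    whatever the size of \<open>y\<close>.\<close>
  obtain z where z: "z \<in> Z (Suc n1)" "\<theta> / \<bar>y\<bar> / K ^ p1 \<le> \<bar>z\<bar>" "\<bar>z\<bar> \<le> \<theta> / \<bar>y\<bar>"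
    using scale_element[OF r] by blast
  have Kp: "K ^ p1 > 0" using K_ge by simp
  define c where "c = \<bar>z\<bar> * \<bar>y\<bar>"
  have c: "\<theta> / K ^ p1 \<le> c" "c \<le> \<theta>"
  proof -
    have "\<theta> / \<bar>y\<bar> / K ^ p1 * \<bar>y\<bar> \<le> \<bar>z\<bar> * \<bar>y\<bar>" using z(2) by (rule mult_right_mono) simp
    then show "\<theta> / K ^ p1 \<le> c" using y0 by (simp add: c_def)
    show "c \<le> \<theta>" using z(3) y0 by (simp add: c_def pos_le_divide_eq)
  qed
  have "0 < \<theta> / K ^ p1" using \<theta> Kp by simp
  then have c0: "c > 0" using c by linarith
  obtain z' where z': "z' \<in> Z (Suc (Suc n1))" "z' * y = c"
  proof (cases "z * y \<ge> 0")
    case True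
    then show ?thesis using that[of z] Z_Suc[OF z(1)] by (simp add: c_def flip: abs_mult)
  next
    case False
    then show ?thesis using that[of "- z"] Z_uminus[OF z(1)] by (simp add: c_def flip: abs_mult)
  qed
  have yne: "y \<noteq> 0" using y0 by simp
  define S where "S = Z 0 + (*) (x / y) ` Z 0"
  have b0: "bounded (Z 0)" by (rule bounded_Z) simp
  have bS: "bounded S" unfolding S_def
    using b0 bounded_scaling[OF b0, of "x / y"] by (simp add: bounded_set_plus)
  \<comment> \<open>Since \<open>z' * y = c\<close>, scaling by \<open>c\<close> clears the
    denominator: \<open>c * (u + x / y * v) = z' * (y * u + x * v)\<close>. The summand 0 matches
    the form of \<open>pack_affine\<close>.\<close>
  define Y where "Y = (\<lambda>w. 0 + c *\<^sub>R w) ` S"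
  have Yform0: "\<exists>u v. u \<in> Z 0 \<and> v \<in> Z 0 \<and> w = c * (u + x / y * v)" if w: "w \<in> Y" for w
  proof -
    obtain s where s: "s \<in> S" "w = c * s" using w by (auto simp: Y_def)
    obtain u t where ut: "u \<in> Z 0" "t \<in> (*) (x / y) ` Z 0" "s = u + t"
      using s(1) unfolding S_def by (rule set_plus_elim)
    obtain v where "v \<in> Z 0" "t = x / y * v" using ut(2) by blast
    then show ?thesis using s ut by blast
  qed
  have Yform: "\<exists>u v. u \<in> Z 0 \<and> v \<in> Z 0 \<and> w = z' * (y * u + x * v)" if w: "w \<in> Y" for w
  proof -
    obtain u v where uv: "u \<in> Z 0" "v \<in> Z 0" "w = c * (u + x / y * v)"
      using Yform0[OF w] by blast
    have "w = z' * (y * u + x * v)" unfolding uv(3) z'(2)[symmetric] using yne by (simp add: field_simps)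
    then show ?thesis using uv by blast
  qed
  have bY: "bounded Y" unfolding Y_def using bounded_scaling[OF bS, of c] by simp
  have Ybd: "\<bar>w\<bar> \<le> 2 * R * \<theta>" if w: "w \<in> Y" for w
  proof -
    obtain u v where uv: "u \<in> Z 0" "v \<in> Z 0" "w = c * (u + x / y * v)"
      using Yform0[OF w] by blast
    have "\<bar>x / y * v\<bar> \<le> 1 * R" unfolding abs_mult using xy y0 Z_bound[OF uv(2)]
      by (intro mult_mono) (auto simp: abs_divide)
    moreover have "\<bar>u\<bar> \<le> R" using Z_bound[OF uv(1)] by simp
    ultimately have "\<bar>u\<bar> + \<bar>x / y * v\<bar> \<le> R + 1 * R" by (rule add_mono[rotated])
    then have "\<bar>u + x / y * v\<bar> \<le> 2 * R" using order_trans[OF abs_triangle_ineq] by fastforce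
    then have "\<bar>w\<bar> \<le> c * (2 * R)" unfolding uv(3) abs_mult using c0 by (intro mult_mono) auto
    also have "\<dots> \<le> \<theta> * (2 * R)" using c R by (intro mult_right_mono) auto
    finally show ?thesis by (simp add: mult_ac)
  qed
  have ZY: "Z 0 + Y \<subseteq> Z m"
  proof
    fix w assume "w \<in> Z 0 + Y"
    then obtain s t where st: "s \<in> Z 0" "t \<in> Y" "w = s + t" by (auto simp: set_plus_def)
    obtain u v where uv: "u \<in> Z 0" "v \<in> Z 0" "t = z' * (y * u + x * v)" using Yform[OF st(2)] by blast
    have "y * u \<in> Z 4" using Z_mult[OF xy(2) Z_mono[OF uv(1)]] by simp
    moreover have "x * v \<in> Z 4" using Z_mult[OF xy(1) Z_mono[OF uv(2)]] by simp
    ultimately have "y * u + x * v \<in> Z 6" using Z_add[of "y * u" 4 "x * v"] by (simp add: eval_nat_numeral)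
    then have "z' * (y * u + x * v) \<in> Z (Suc (n1 + 6))"
      by (intro Z_mult) (auto intro: Z_mono[OF z'(1)] Z_mono)
    then have "s + t \<in> Z (Suc (Suc (Suc (n1 + 6))))" using uv st by (intro Z_add) (auto intro: Z_mono)
    then show "w \<in> Z m" unfolding st(3) by (rule Z_mono) (use m in simp)
  qed
  have co: "c * \<omega> > 0" using c0 \<omega> by simp
  have clow: "\<omega> * \<theta> / K ^ p1 \<le> c * \<omega>"
    using mult_left_mono[OF c(1), of \<omega>] \<omega> by (simp add: mult_ac)
  have "c * \<omega> \<le> \<theta> * 1" using c c0 \<omega> by (intro mult_mono) auto
  then have cw: "c * \<omega> \<le> \<theta>" by simp
  \<comment> \<open>The slab inequality with the identity as \<open>f\<close>: \<open>Y\<close> has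
    length at most \<open>4 * R * \<theta>\<close>, so its translates by well separated ring
    elements are counted separately.\<close>
  have "pack (2 * (4 * R * \<theta>)) ((\<lambda>x. x) ` Z 0) * pack (c * \<omega>) Y \<le> pack (c * \<omega>) (Z 0 + Y)"
  proof (rule pack_slab[OF _ _ bY b0 co])
    have "1 * \<theta> \<le> 4 * R * \<theta>" using R \<theta> by (intro mult_right_mono) auto
    then show "c * \<omega> \<le> 4 * R * \<theta>" using cw by simp
    fix w w' assume "w \<in> Y" "w' \<in> Y"
    then show "\<bar>w - w'\<bar> \<le> 4 * R * \<theta>" using Ybd[of w] Ybd[of w'] by linarith
  qed (auto simp: linear_ident)
  also have "\<dots> \<le> pack (c * \<omega>) (Z m)" by (rule pack_mono[OF bounded_Z[OF order_refl] co ZY])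
  finally have "real (pack (8 * R * \<theta>) (Z 0) * pack (c * \<omega>) Y) \<le> real (pack (c * \<omega>) (Z m))"
    unfolding of_nat_le_iff by (simp add: mult.assoc)
  also have "\<dots> \<le> K * P (c * \<omega>)"
  proof (rule grow)
    have "\<delta> \<le> \<omega> * \<theta> / K ^ p1" using sc Kp by (simp add: pos_le_divide_eq)
    then show "\<delta> \<le> c * \<omega>" using clow by linarith
    show "c * \<omega> \<le> 1" using cw \<theta> by linarith
  qed
  also have "P (c * \<omega>) \<le> P (\<omega> * \<theta> / K ^ p1)"
    by (rule P_antimono[OF _ clow]) (use \<omega> \<theta> Kp in simp)
  also have "P (\<omega> * \<theta> / K ^ p1) \<le> (2 * K ^ p1 + 1) * P (K ^ p1 * (\<omega> * \<theta> / K ^ p1))"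
    by (rule P_rescale) (use \<omega> \<theta> Kp in auto)
  also have "K ^ p1 * (\<omega> * \<theta> / K ^ p1) = \<omega> * \<theta>" using K_ge by simp
  also have "(2 * K ^ p1 + 1) * P (\<omega> * \<theta>) \<le> K ^ (p1 + 1) * P (\<omega> * \<theta>)"
    by (intro mult_right_mono two_pow_le) auto
  finally have 1: "P (8 * R * \<theta>) * real (pack (c * \<omega>) Y) \<le> K * (K ^ (p1 + 1) * P (\<omega> * \<theta>))"
    using K_ge by (simp add: mult_left_mono)
  have "P \<theta> \<le> (2 * (8 * R) + 1) * P (8 * R * \<theta>)" using P_rescale[of \<theta> "8 * R"] \<theta> R by simp
  also have "\<dots> \<le> K * P (8 * R * \<theta>)" using K R by (intro mult_right_mono) auto
  finally have 2: "P \<theta> \<le> K * P (8 * R * \<theta>)" .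
  have eqY: "pack (c * \<omega>) Y = pack \<omega> S" unfolding Y_def by (rule pack_affine[OF bS \<omega>(1) c0])
  have "P \<theta> * real (pack \<omega> S) \<le> K * (P (8 * R * \<theta>) * real (pack (c * \<omega>) Y))"
    using mult_right_mono[OF 2, of "real (pack \<omega> S)"] eqY by (simp add: mult_ac)
  also have "\<dots> \<le> K * (K * (K ^ (p1 + 1) * P (\<omega> * \<theta>)))" using 1 K_ge by (intro mult_left_mono) auto
  also have "\<dots> = K ^ q * P (\<omega> * \<theta>)" by (simp add: power_add eval_nat_numeral)
  also have "\<dots> \<le> K ^ q * (K3 * P \<omega> * P \<theta>)" using sub K_ge by (intro mult_left_mono) auto
  also have "\<dots> = P \<theta> * (K ^ q * K3 * P \<omega>)" by (simp only: mult_ac)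
  finally show ?thesis using P_ge1[OF \<theta>(1)] unfolding S_def by simp
qed

text \<open>Put \<open>\<theta> = \<sigma> ^ p\<close>. Splitting \<open>2 * p + 1\<close> as
  \<open>(p + 1) + p\<close>, the selected inequality and superadditivity give almost
  multiplicativity at the pairs \<open>(\<sigma> * \<theta>, \<theta>)\<close> and
  \<open>(\<sigma>, \<theta>)\<close>, so quotients with denominators at least
  \<open>\<theta>\<close> are cheap at both scales \<open>\<sigma> * \<theta>\<close> and
  \<open>\<sigma>\<close>. The first scale serves to show that these quotients are dense, the second
  to count energy. The condition \<open>2 \<le> p * \<kappa>\<close> makes \<open>P \<theta>\<close>
  at least \<open>\<sigma> powr (-2) / K\<close>, more than a gap in the quotients would
  permit.\<close>

lemma scale_bound:
  fixes p :: nat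
  assumes \<sigma>: "0 < \<sigma>" "\<sigma> \<le> 1/4" and p: "2 \<le> real p * \<kappa>" and \<delta>\<sigma>: "\<delta> \<le> \<sigma> ^ (2 * p + 2)"
    and c: "0 < c" "c \<le> \<kappa> / 4" and sel: "P (\<sigma> ^ (2 * p + 1)) \<le> \<sigma> powr (-c) * P \<sigma> ^ (2 * p + 1)"
    and Ks: "K ^ (q * (2 * p + 2) + 4) \<le> \<sigma> powr (-\<kappa> / 4)"
  defines "G \<equiv> K ^ (q * (2 * p + 2) + 4) * \<sigma> powr (-c)"
  shows "\<sigma> powr (-1) * G powr (-(1 / \<kappa> + 1)) \<le> P \<sigma>"
proof -
  define \<theta> where "\<theta> = \<sigma> ^ p"
  define K3 where "K3 = K ^ (q * (2 * p + 1)) * \<sigma> powr (-c)"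
  define K4 where "K4 = K ^ q * K3"
  have s1: "\<sigma> < 1" using \<sigma> by simp
  have \<theta>: "0 < \<theta>" "\<theta> \<le> 1" using \<sigma> s1 by (auto simp: \<theta>_def power_le_one)
  have sc1: "\<sigma> powr (-c) \<ge> 1" using \<sigma> c by (simp add: powr_minus_divide powr_le1)
  have Kpow: "K ^ i \<ge> 1" for i using K_ge by (intro one_le_power) auto
  have ge1: "1 \<le> a * b" if "1 \<le> a" "1 \<le> b" for a b :: real using mult_mono[of 1 a 1 b] that by simp
  have K3: "K3 \<ge> 1" unfolding K3_def by (intro ge1 Kpow sc1)
  have K4: "K4 \<ge> 1" unfolding K4_def by (intro ge1 Kpow K3)
  have GK4: "G = K ^ 4 * K4"
    unfolding G_def K4_def K3_def by (simp add: power_add[symmetric] algebra_simps)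
  have G1: "G \<ge> 1" unfolding GK4 by (intro ge1 Kpow K4)
  have Gle: "G \<le> \<sigma> powr (-\<kappa> / 2)"
  proof -
    have "G \<le> \<sigma> powr (-\<kappa> / 4) * \<sigma> powr (-\<kappa> / 4)"
      unfolding G_def
    proof (intro mult_mono Ks)
      show "\<sigma> powr (-c) \<le> \<sigma> powr (-\<kappa> / 4)" using c \<sigma> by (intro powr_mono') auto
    qed auto
    also have "\<dots> = \<sigma> powr (-\<kappa> / 2)" by (simp add: powr_add[symmetric])
    finally show ?thesis .
  qed
  have Ksig: "K ^ (q * (2 * p + 2) + 4) * \<sigma> \<le> 1"
  proof -
    have "\<sigma> powr (-\<kappa> / 4) \<le> \<sigma> powr (-1)" using \<kappa> \<sigma> by (intro powr_mono') auto
    then have "K ^ (q * (2 * p + 2) + 4) \<le> \<sigma> powr (-1)" using Ks by linarith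
    then show ?thesis using \<sigma> by (simp add: powr_minus_divide pos_le_divide_eq)
  qed
  have Klow: "K ^ i * \<sigma> \<le> 1" if "i \<le> q * (2 * p + 2) + 4" for i
  proof -
    have "K ^ i * \<sigma> \<le> K ^ (q * (2 * p + 2) + 4) * \<sigma>"
      using that K_ge \<sigma> by (intro mult_right_mono power_increasing) auto
    then show ?thesis using Ksig by linarith
  qed
  have dpow: "\<delta> \<le> \<sigma> ^ i" if "i \<le> 2 * p + 2" for i
    using power_decreasing[OF that, of \<sigma>] \<sigma> s1 \<delta>\<sigma> by simp
  have a1: "P \<sigma> ^ (2 * p + 1) = P \<sigma> * P \<sigma> ^ p * P \<sigma> ^ p" by (simp add: power_add mult_2)
  have Ppos: "P \<sigma> \<ge> 1" using \<sigma> by (intro P_ge1)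
  have Pp: "P \<sigma> ^ p \<le> K ^ (q * p) * P \<theta>"
    unfolding \<theta>_def by (rule superadditive_power) (use \<sigma> s1 dpow[of p] in auto)
  have Pp1: "P \<sigma> ^ Suc p \<le> K ^ (q * Suc p) * P (\<sigma> * \<theta>)"
    unfolding \<theta>_def using superadditive_power[of \<sigma> "Suc p"] \<sigma> s1 dpow[of "Suc p"] by simp
  have e2: "\<sigma> ^ (2 * p + 1) = (\<sigma> * \<theta>) * \<theta>" by (simp add: \<theta>_def power_add mult_2)
  have sel': "P ((\<sigma> * \<theta>) * \<theta>) \<le> \<sigma> powr (-c) * (P \<sigma> * P \<sigma> ^ p * P \<sigma> ^ p)"
    using sel unfolding a1 e2 .
  have sub1: "P ((\<sigma> * \<theta>) * \<theta>) \<le> K3 * P (\<sigma> * \<theta>) * P \<theta>"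
  proof -
    have "P ((\<sigma> * \<theta>) * \<theta>) \<le> \<sigma> powr (-c) * (P \<sigma> ^ Suc p * P \<sigma> ^ p)"
      using sel' by (simp add: mult.assoc)
    also have "\<dots> \<le> \<sigma> powr (-c) * ((K ^ (q * Suc p) * P (\<sigma> * \<theta>)) * (K ^ (q * p) * P \<theta>))"
      using Pp Pp1 K_ge by (intro mult_left_mono mult_mono) auto
    also have "\<dots> = K3 * P (\<sigma> * \<theta>) * P \<theta>"
    proof -
      have "K ^ (q * (2 * p + 1)) = K ^ (q * Suc p) * K ^ (q * p)"
        unfolding power_add[symmetric] by (rule arg_cong[of _ _ "\<lambda>i. K ^ i"]) (simp add: algebra_simps)
      then show ?thesis unfolding K3_def by (simp only: mult_ac)
    qed
    finally show ?thesis .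
  qed
  \<comment> \<open>Superadditivity bounds \<open>P (\<sigma> * \<theta> * \<theta>)\<close> from
    below by means of \<open>P (\<sigma> * \<theta>)\<close>, and \<open>sel'\<close> bounds it from
    above; a factor \<open>P \<sigma> ^ p\<close> cancels.\<close>
  have sub2: "P (\<sigma> * \<theta>) \<le> K3 * P \<sigma> * P \<theta>"
  proof -
    have st: "0 < \<sigma> * \<theta>" "\<sigma> * \<theta> \<le> 1" using \<sigma> \<theta> s1 by (auto simp: mult_le_one)
    have dd: "\<delta> \<le> \<sigma> * \<theta> * \<theta>" using dpow[of "2 * p + 1"] unfolding e2 by simp
    have "P (\<sigma> * \<theta>) * P \<sigma> ^ p \<le> P (\<sigma> * \<theta>) * (K ^ (q * p) * P \<theta>)" using Pp by (intro mult_left_mono) auto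
    also have "\<dots> = K ^ (q * p) * (P (\<sigma> * \<theta>) * P \<theta>)" by simp
    also have "\<dots> \<le> K ^ (q * p) * (K ^ q * P (\<sigma> * \<theta> * \<theta>))"
      using superadditive[OF st \<theta> dd] K_ge by (intro mult_left_mono) auto
    also have "\<dots> \<le> K ^ (q * p) * (K ^ q * (\<sigma> powr (-c) * (P \<sigma> * P \<sigma> ^ p * P \<sigma> ^ p)))"
      using sel' K_ge by (intro mult_left_mono) auto
    also have "\<dots> = (K ^ (q * p) * K ^ q * \<sigma> powr (-c) * P \<sigma> * P \<sigma> ^ p) * P \<sigma> ^ p" by (simp only: mult_ac)
    finally have "P (\<sigma> * \<theta>) \<le> K ^ (q * p) * K ^ q * \<sigma> powr (-c) * P \<sigma> * P \<sigma> ^ p" using Ppos by simp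
    also have "\<dots> \<le> K ^ (q * p) * K ^ q * \<sigma> powr (-c) * P \<sigma> * (K ^ (q * p) * P \<theta>)"
      using Pp K_ge by (intro mult_left_mono) auto
    also have "\<dots> = K3 * P \<sigma> * P \<theta>"
    proof -
      have "K ^ (q * (2 * p + 1)) = K ^ (q * p) * K ^ q * K ^ (q * p)"
        unfolding power_add[symmetric] by (rule arg_cong[of _ _ "\<lambda>i. K ^ i"]) (simp add: algebra_simps)
      then show ?thesis unfolding K3_def by (simp only: mult_ac)
    qed
    finally show ?thesis .
  qed
  have dK: "\<delta> * K ^ p1 \<le> \<sigma> ^ i" if "i \<le> 2 * p + 1" for i
  proof -
    have "\<delta> * K ^ p1 \<le> \<sigma> ^ (2 * p + 2) * K ^ p1" using \<delta>\<sigma> K_ge by (intro mult_right_mono) auto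
    also have "\<dots> = \<sigma> ^ (2 * p + 1) * (K ^ p1 * \<sigma>)" by simp
    also have "\<dots> \<le> \<sigma> ^ (2 * p + 1) * 1" using \<sigma> by (intro mult_left_mono Klow) auto
    also have "\<dots> \<le> \<sigma> ^ i" using power_decreasing[OF that, of \<sigma>] \<sigma> s1 by simp
    finally show ?thesis .
  qed
  have dR: "\<delta> * R \<le> \<theta>"
  proof -
    have "\<delta> * R \<le> \<delta> * K" using K R \<delta> by (intro mult_left_mono) auto
    also have "\<dots> \<le> \<sigma> ^ (2 * p + 2) * K" using \<delta>\<sigma> K_ge by (intro mult_right_mono) auto
    also have "\<dots> = \<sigma> ^ (2 * p + 1) * (K ^ 1 * \<sigma>)" by simp
    also have "\<dots> \<le> \<sigma> ^ (2 * p + 1) * 1" using \<sigma> by (intro mult_left_mono Klow) auto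
    also have "\<dots> \<le> \<theta>" unfolding \<theta>_def using power_decreasing[of p "2 * p + 1" \<sigma>] \<sigma> s1 by simp
    finally show ?thesis .
  qed
  have cost1: "real (pack (\<sigma> * \<theta>) (Z 0 + (*) (x / y) ` Z 0)) \<le> K4 * P (\<sigma> * \<theta>)"
    if "x \<in> Z 3" "y \<in> Z 3" "\<theta> \<le> \<bar>y\<bar>" "\<bar>x\<bar> \<le> \<bar>y\<bar>" for x y
    unfolding K4_def
    by (rule quotient_cost[OF \<theta> _ _ _ dR sub1 that]) (use \<sigma> \<theta> s1 dK[of "2*p+1", unfolded e2] in \<open>auto simp: mult_le_one\<close>)
  have cost2: "real (pack \<sigma> (Z 0 + (*) (x / y) ` Z 0)) \<le> K4 * P \<sigma>"
    if "x \<in> Z 3" "y \<in> Z 3" "\<theta> \<le> \<bar>y\<bar>" "\<bar>x\<bar> \<le> \<bar>y\<bar>" for x y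
    unfolding K4_def
    by (rule quotient_cost[OF \<theta> _ _ _ dR sub2 that]) (use \<sigma> s1 dK[of "Suc p"] in \<open>auto simp: \<theta>_def\<close>)
  define Q where "Q = {u. \<exists>x y. x \<in> Z 1 \<and> y \<in> Z 1 \<and> \<theta> \<le> \<bar>y\<bar> \<and> u = x / y \<and> 0 \<le> u \<and> u \<le> 1}"
  have Q01: "0 \<in> Q" "1 \<in> Q"
    unfolding Q_def mem_Collect_eq using zero_one_all[of 1] \<theta>
    by (intro exI[of _ 0] exI[of _ 1], simp, intro exI[of _ 1], simp)
  \<comment> \<open>If \<open>\<xi>\<close> misses \<open>Q\<close> by \<open>\<sigma>\<close>, then
    \<open>s + \<xi> * t\<close> keeps pairs from a \<open>\<theta>\<close>-separated set
    \<open>\<sigma> * \<theta>\<close> apart. This gives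
    \<open>P \<theta> * P \<theta> \<le> K4 * P (\<sigma> * \<theta>)\<close>, hence
    \<open>P \<theta> \<le> K4 * (3 / \<sigma>)\<close>, too small in view of
    \<open>2 \<le> p * \<kappa>\<close>.\<close>
  have nofar: False if \<xi>: "0 \<le> \<xi>" "\<xi> \<le> 1" "\<xi> = x / y" "x \<in> Z 3" "y \<in> Z 3" "\<theta> \<le> \<bar>y\<bar>"
    and far: "\<And>u. u \<in> Q \<Longrightarrow> \<sigma> < \<bar>\<xi> - u\<bar>" for \<xi> x y
  proof -
    have y0: "\<bar>y\<bar> > 0" using \<xi> \<theta> by linarith
    have "x = \<xi> * y" using \<xi>(3) y0 by auto
    then have "\<bar>x\<bar> = \<xi> * \<bar>y\<bar>" using \<xi>(1) by (metis abs_mult abs_of_nonneg)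
    also have "\<dots> \<le> 1 * \<bar>y\<bar>" using \<xi> by (intro mult_right_mono) auto
    finally have xy: "\<bar>x\<bar> \<le> \<bar>y\<bar>" by simp
    \<comment> \<open>Only quotients in the unit interval belong to \<open>Q\<close>. Since 0 and 1
      do, \<open>\<xi>\<close> is also more than \<open>\<sigma>\<close> away from everything
      outside that interval.\<close>
    have \<xi>01: "\<sigma> < \<xi>" "\<xi> < 1 - \<sigma>" using far[OF Q01(1)] far[OF Q01(2)] \<xi> by auto
    have b0: "bounded (Z 0)" by (rule bounded_Z) simp
    obtain D where D: "D \<subseteq> Z 0" "separated \<theta> D" "card D = pack \<theta> (Z 0)"
      using pack_ex[OF b0 \<theta>(1)] by blast
    have bS: "bounded (Z 0 + (*) \<xi> ` Z 0)"
      using b0 bounded_scaling[OF b0, of \<xi>] by (simp add: bounded_set_plus)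
    have st: "0 < \<sigma> * \<theta>" using \<sigma> \<theta> by simp
    have st2: "\<sigma> * \<theta> \<le> \<theta>" using s1 \<theta> by simp
    have "card (D \<times> D) \<le> pack (\<sigma> * \<theta>) (Z 0 + (*) \<xi> ` Z 0)"
    proof (rule card_le_pack_image[OF bS st, where h = "\<lambda>(s, t). s + \<xi> * t"])
      show "(\<lambda>(s, t). s + \<xi> * t) ` (D \<times> D) \<subseteq> Z 0 + (*) \<xi> ` Z 0" using D(1) by (auto simp: set_plus_def)
      fix g h assume gh: "g \<in> D \<times> D" "h \<in> D \<times> D" "g \<noteq> h"
      obtain s t s' t' where e: "g = (s, t)" "h = (s', t')" by fastforce
      have mem: "s \<in> Z 0" "t \<in> Z 0" "s' \<in> Z 0" "t' \<in> Z 0" using gh e D(1) by auto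
      show "\<sigma> * \<theta> < dist (case g of (s, t) \<Rightarrow> s + \<xi> * t) (case h of (s, t) \<Rightarrow> s + \<xi> * t)"
      proof (cases "t = t'")
        case True
        then have "\<theta> < dist s s'" using separatedD[OF D(2), of s s'] gh e by auto
        then show ?thesis using e True st2 by (simp add: dist_real_def)
      next
        case False
        have tt: "\<theta> < \<bar>t - t'\<bar>" using separatedD[OF D(2), of t t'] gh e False by (auto simp: dist_real_def)
        define u where "u = (s' - s) / (t - t')"
        have dz: "s' - s \<in> Z 1" "t - t' \<in> Z 1" using Z_diff[of _ 0] mem by auto
        have "\<sigma> < \<bar>\<xi> - u\<bar>"
        proof (cases "0 \<le> u \<and> u \<le> 1")
          case True
          then have "u \<in> Q" unfolding Q_def mem_Collect_eq using dz tt
            by (intro exI[of _ "s' - s"] exI[of _ "t - t'"]) (auto simp: u_def)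
          then show ?thesis by (rule far)
        next
          case False
          then show ?thesis using \<xi>01 by linarith
        qed
        then have "\<sigma> * \<theta> < \<bar>\<xi> - u\<bar> * \<bar>t - t'\<bar>" using tt \<sigma> \<theta> by (intro mult_strict_mono) auto
        also have "\<dots> = \<bar>(s + \<xi> * t) - (s' + \<xi> * t')\<bar>"
        proof -
          have "(\<xi> - u) * (t - t') = (s + \<xi> * t) - (s' + \<xi> * t')" using False unfolding u_def by (simp add: field_simps)
          then show ?thesis by (simp flip: abs_mult)
        qed
        finally show ?thesis using e by (simp add: dist_real_def)
      qed
    qed
    then have "P \<theta> * P \<theta> \<le> real (pack (\<sigma> * \<theta>) (Z 0 + (*) \<xi> ` Z 0))"
      using D by (simp add: card_cartesian_product flip: of_nat_mult)
    also have "\<dots> \<le> K4 * P (\<sigma> * \<theta>)" using cost1[OF \<xi>(4-6) xy] \<xi>(3) by simp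
    also have "P (\<sigma> * \<theta>) \<le> (2 * (1 / \<sigma>) + 1) * P (1 / \<sigma> * (\<sigma> * \<theta>))" using P_rescale[OF st, of "1 / \<sigma>"] \<sigma> by simp
    also have "1 / \<sigma> * (\<sigma> * \<theta>) = \<theta>" using \<sigma> by simp
    also have "(2 * (1 / \<sigma>) + 1) * P \<theta> \<le> (3 / \<sigma>) * P \<theta>"
    proof (rule mult_right_mono)
      have "1 \<le> 1 / \<sigma>" using \<sigma> s1 by simp
      then show "2 * (1 / \<sigma>) + 1 \<le> 3 / \<sigma>" by simp
    qed simp
    finally have "P \<theta> * P \<theta> \<le> (K4 * (3 / \<sigma>)) * P \<theta>" using K4 by (simp add: mult_left_mono)
    then have up: "P \<theta> \<le> K4 * (3 / \<sigma>)"
      by (rule mult_right_le_imp_le) (use P_ge1[OF \<theta>(1)] in linarith)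
    have "\<sigma> powr (-2) \<le> \<sigma> powr (real p * (-\<kappa>))" using p \<sigma> by (intro powr_mono') auto
    also have "\<dots> = \<theta> powr (-\<kappa>)" using \<sigma> by (simp add: \<theta>_def powr_realpow[symmetric] powr_powr)
    also have "\<dots> \<le> K * P \<theta>" by (rule nonconc) (use \<theta> dpow[of p] in \<open>auto simp: \<theta>_def\<close>)
    also have "\<dots> \<le> K * (K4 * (3 / \<sigma>))" using up K_ge by (intro mult_left_mono) auto
    finally have "\<sigma> powr (-2) \<le> K * (K4 * (3 / \<sigma>))" .
    moreover have "\<sigma> powr (-2) = 1 / \<sigma> * (1 / \<sigma>)" using \<sigma> by (simp add: powr_minus_divide power2_eq_square)
    moreover have "K * (K4 * (3 / \<sigma>)) = (3 * K * K4) * (1 / \<sigma>)" by simp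
    ultimately have "1 / \<sigma> * (1 / \<sigma>) \<le> (3 * K * K4) * (1 / \<sigma>)" by (simp only:)
    then have "1 / \<sigma> \<le> 3 * K * K4" by (rule mult_right_le_imp_le) (use \<sigma> in simp)
    also have "\<dots> < K ^ 4 * K4"
    proof (rule mult_strict_right_mono)
      have "3 * K < 6000 * K" using K_ge by linarith
      also have "\<dots> \<le> K * K" using K_ge by (intro mult_right_mono) auto
      also have "\<dots> \<le> K ^ 4" using power_increasing[of 2 4 K] K_ge by (simp add: power2_eq_square)
      finally show "3 * K < K ^ 4" .
    qed (use K4 in simp)
    also have "\<dots> = G" using GK4 by simp
    also have "\<dots> \<le> \<sigma> powr (-\<kappa> / 2)" by (rule Gle)
    also have "\<dots> \<le> \<sigma> powr (-1)" using \<kappa> \<sigma> by (intro powr_mono') auto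
    also have "\<dots> = 1 / \<sigma>" using \<sigma> by (simp add: powr_minus_divide)
    finally show False by simp
  qed
  have dense: "\<exists>u\<in>Q. \<bar>l - u\<bar> \<le> 3 * \<sigma>" if "0 \<le> l" "l \<le> 1" for l
  proof (rule dyadic_dense[OF _ _ \<sigma>(1) _ _ that])
    show "Q \<subseteq> {0..1}" by (auto simp: Q_def)
    show "Q \<noteq> {}" using Q01 by blast
    fix v assume "v \<in> Q"
    then obtain x y where xy: "x \<in> Z 1" "y \<in> Z 1" "\<theta> \<le> \<bar>y\<bar>" "v = x / y" "0 \<le> v" "v \<le> 1" unfolding Q_def by blast
    \<comment> \<open>The level 3 in \<open>nofar\<close> comes from here:
      \<open>v / 2 = x / (y + y)\<close> and \<open>(v + 1) / 2 = (x + y) / (y + y)\<close>.\<close>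
    have yy: "y + y \<in> Z 3" "x + y \<in> Z 3" "x \<in> Z 3"
      using Z_add[OF xy(2) xy(2)] Z_add[OF xy(1,2)] Z_mono[OF xy(1), of 3] by (simp_all add: eval_nat_numeral)
    have yb: "\<theta> \<le> \<bar>y + y\<bar>" using xy by linarith
    have y0: "y \<noteq> 0" using xy(3) \<theta> by auto
    show "\<exists>u\<in>Q. \<bar>v / 2 - u\<bar> \<le> \<sigma>"
    proof (rule ccontr)
      assume "\<not> ?thesis"
      then have "\<And>u. u \<in> Q \<Longrightarrow> \<sigma> < \<bar>v / 2 - u\<bar>" by (auto simp: not_le)
      then show False by (intro nofar[of "v / 2" x "y + y"]) (use xy yy yb in auto)
    qed
    show "\<exists>u\<in>Q. \<bar>(v + 1) / 2 - u\<bar> \<le> \<sigma>"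
    proof (rule ccontr)
      assume "\<not> ?thesis"
      then have far: "\<And>u. u \<in> Q \<Longrightarrow> \<sigma> < \<bar>(v + 1) / 2 - u\<bar>" by (auto simp: not_le)
      have e: "(v + 1) / 2 = (x + y) / (y + y)" using xy(4) y0 by (simp add: field_simps)
      show False by (rule nofar[OF _ _ e yy(2,1) yb far]) (use xy(5,6) in auto)
    qed
  qed
  define K5 where "K5 = K * K4"
  have b0: "bounded (Z 0)" by (rule bounded_Z) simp
  have cost: "real (pack \<sigma> (Z 0 + (*) l ` Z 0)) \<le> K5 * P \<sigma>" if l: "0 \<le> l" "l \<le> 1" for l
  proof -
    obtain u where u: "u \<in> Q" "\<bar>l - u\<bar> \<le> 3 * \<sigma>" using dense[OF l] by blast
    obtain x y where xy: "x \<in> Z 1" "y \<in> Z 1" "\<theta> \<le> \<bar>y\<bar>" "u = x / y" "0 \<le> u" "u \<le> 1" using u(1) unfolding Q_def by blast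
    have y0: "\<bar>y\<bar> > 0" using xy \<theta> by linarith
    have "x = u * y" using xy(4) y0 by auto
    then have "\<bar>x\<bar> = u * \<bar>y\<bar>" using xy(5) by (metis abs_mult abs_of_nonneg)
    also have "\<dots> \<le> 1 * \<bar>y\<bar>" using xy by (intro mult_right_mono) auto
    finally have xy': "\<bar>x\<bar> \<le> \<bar>y\<bar>" by simp
    have cu: "real (pack \<sigma> (Z 0 + (*) u ` Z 0)) \<le> K4 * P \<sigma>"
      unfolding xy(4) by (rule cost2) (use xy xy' Z_mono[of _ 1 3] in auto)
    have bS: "bounded (Z 0 + (*) t ` Z 0)" for t
      using b0 bounded_scaling[OF b0, of t] by (simp add: bounded_set_plus)
    have near: "\<exists>w\<in>Z 0 + (*) u ` Z 0. dist v w \<le> 3 * \<sigma> * R" if "v \<in> Z 0 + (*) l ` Z 0" for v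
    proof -
      obtain s t where st: "s \<in> Z 0" "t \<in> Z 0" "v = s + l * t" using \<open>v \<in> _\<close> by (auto simp: set_plus_def)
      have "\<bar>(l - u) * t\<bar> \<le> 3 * \<sigma> * R" unfolding abs_mult using u(2) Z_bound[OF st(2)] \<sigma> by (intro mult_mono) auto
      then show ?thesis using st by (intro bexI[of _ "s + u * t"]) (auto simp: dist_real_def set_plus_def left_diff_distrib)
    qed
    have "real (pack \<sigma> (Z 0 + (*) l ` Z 0)) \<le> real (pack 1 (cball (0::real) ((3 * \<sigma> * R + \<sigma>) / \<sigma>)) * pack \<sigma> (Z 0 + (*) u ` Z 0))"
      unfolding of_nat_le_iff by (rule pack_perturb[OF bS bS \<sigma>(1) \<sigma>(1) near])
    also have "(3 * \<sigma> * R + \<sigma>) / \<sigma> = 3 * R + 1" using \<sigma> by (simp add: field_simps)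
    also have "real (pack 1 (cball (0::real) (3 * R + 1)) * pack \<sigma> (Z 0 + (*) u ` Z 0)) \<le> K * (K4 * P \<sigma>)"
      unfolding of_nat_mult
    proof (rule mult_mono[OF _ cu])
      have "real (pack 1 (cball (0::real) (3 * R + 1))) \<le> 2 * (3 * R + 1) / 1 + 1"
        by (rule pack_interval[of _ "-(3 * R + 1)"]) (use R in \<open>auto simp: dist_real_def\<close>)
      then show "real (pack 1 (cball (0::real) (3 * R + 1))) \<le> K" using K R by simp
    qed (use K_ge in auto)
    finally show ?thesis by (simp add: K5_def mult.assoc)
  qed
  have K5: "K5 \<ge> 1" using K4 K_ge mult_mono[of 1 K 1 K4] by (simp add: K5_def)
  have GK5: "G = K ^ 3 * K5" using GK4 by (simp add: K5_def eval_nat_numeral)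
  obtain T where T: "finite T" "T \<subseteq> {0..1::real}" "separated \<sigma> T" "1 / (4 * \<sigma>) \<le> real (card T)"
    using separated_interval_ex[OF \<sigma>] by blast
  obtain D where D: "D \<subseteq> Z 0" "finite D" "separated \<sigma> D" "card D = pack \<sigma> (Z 0)"
    using pack_ex[OF b0 \<sigma>(1)] by blast
  \<comment> \<open>Chosen so that \<open>r0 powr \<kappa> = 1 / G\<close>. Non-concentration then
    leaves at most about the fraction \<open>K ^ 2 / G\<close> of \<open>D\<close> within
    \<open>r0\<close> of any point, and distant pairs lose a factor \<open>1 / r0\<close>, which is
    where the exponent \<open>1 / \<kappa>\<close> comes from.\<close>
  define r0 where "r0 = G powr (-(1 / \<kappa>))"
  define N where "N = P \<sigma>"
  define M where "M = real (card T)"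
  have N: "N \<ge> 1" using Ppos by (simp add: N_def)
  have M: "1 / (4 * \<sigma>) \<le> M" "M > 0"
  proof -
    show "1 / (4 * \<sigma>) \<le> M" using T by (simp add: M_def)
    moreover have "1 / (4 * \<sigma>) > 0" using \<sigma> by simp
    ultimately show "M > 0" by linarith
  qed
  have r0: "r0 > 0" "r0 \<le> 1" "\<sigma> \<le> r0"
  proof -
    show "r0 > 0" using G1 by (simp add: r0_def)
    have "G powr (-(1 / \<kappa>)) \<le> G powr 0" using G1 \<kappa> by (intro powr_mono) auto
    then show "r0 \<le> 1" using G1 by (simp add: r0_def)
    have "\<sigma> = (\<sigma> powr (-\<kappa>)) powr (-(1 / \<kappa>))" using \<sigma> \<kappa> by (simp add: powr_powr)
    also have "\<dots> \<le> G powr (-(1 / \<kappa>))"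
    proof (rule powr_mono2')
      show "G \<le> \<sigma> powr (-\<kappa>)" by (rule order_trans[OF Gle]) (use \<sigma> \<kappa> in \<open>auto intro!: powr_mono'\<close>)
    qed (use \<kappa> G1 in auto)
    finally show "\<sigma> \<le> r0" by (simp add: r0_def)
  qed
  have dr0: "\<delta> \<le> r0" using dpow[of 1] r0 by simp
  have r0k: "r0 powr \<kappa> = 1 / G" unfolding r0_def powr_powr using G1 \<kappa> by (simp add: powr_minus_divide)
  have Fb: "real (card {y' \<in> D. \<bar>y' - y\<bar> \<le> r0}) \<le> 9 * K ^ 2 * N / G" if "y \<in> D" for y
  proof -
    have "pack (4 * r0) ((\<lambda>x. x) ` Z 0) * card {x \<in> D. \<bar>x - y\<bar> \<le> r0} \<le> pack \<sigma> (Z 0 + Z 0)"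
      by (rule card_slab_le[OF _ _ b0 \<sigma>(1) _ D(1,3)]) (use r0 in \<open>auto simp: linear_ident\<close>)
    also have "\<dots> \<le> pack \<sigma> (Z m)"
    proof (rule pack_mono[OF bounded_Z[OF order_refl] \<sigma>(1)])
      show "Z 0 + Z 0 \<subseteq> Z m" using Z_add[of _ 0] Z_mono[of _ 2 m] m by (auto simp: set_plus_def eval_nat_numeral)
    qed
    finally have "real (pack (4 * r0) (Z 0) * card {x \<in> D. \<bar>x - y\<bar> \<le> r0}) \<le> real (pack \<sigma> (Z m))"
      unfolding of_nat_le_iff by simp
    also have "\<dots> \<le> K * N" unfolding N_def by (rule grow) (use \<sigma> dpow[of 1] in auto)
    finally have A: "P (4 * r0) * real (card {x \<in> D. \<bar>x - y\<bar> \<le> r0}) \<le> K * N" by simp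
    have "G = r0 powr (-\<kappa>)" using r0k r0 by (simp add: powr_minus_divide)
    also have "\<dots> \<le> K * P r0" by (rule nonconc[OF dr0 r0(2)])
    also have "\<dots> \<le> K * (9 * P (4 * r0))" using P_rescale[of r0 4] r0 K_ge by (intro mult_left_mono) auto
    finally have "G * real (card {x \<in> D. \<bar>x - y\<bar> \<le> r0}) \<le> K * (9 * P (4 * r0)) * real (card {x \<in> D. \<bar>x - y\<bar> \<le> r0})"
      by (intro mult_right_mono) auto
    also have "\<dots> = 9 * K * (P (4 * r0) * real (card {x \<in> D. \<bar>x - y\<bar> \<le> r0}))" by simp
    also have "\<dots> \<le> 9 * K * (K * N)" using A K_ge by (intro mult_left_mono) auto
    finally show ?thesis using G1 by (simp add: pos_le_divide_eq power2_eq_square mult_ac)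
  qed
  have en: "M * N \<le> K5 * (5 * M + 35 * 1 * (9 * K ^ 2 * N / G) / \<sigma> + 5 * N ^ 2 / r0)"
  proof -
    have "real (card T) * real (card D) \<le>
      K5 * (5 * real (card T) + 35 * 1 * (9 * K ^ 2 * N / G) / \<sigma> + 5 * (real (card D))\<^sup>2 / r0)"
    proof (rule energy_bound[OF b0 \<sigma>(1) r0(3,2) order_refl _ T(1) _ T(3) D(1-4) _ _ Fb])
      show "0 < K5" using K5 by simp
      show "T \<subseteq> {-1..1}" using T(2) by auto
      show "D \<noteq> {}" using D(4) N by (auto simp: N_def)
      fix t assume "t \<in> T"
      then show "real (pack \<sigma> (Z 0 + (*) t ` Z 0)) \<le> K5 * P \<sigma>" using T(2) by (intro cost) auto
    qed
    then show ?thesis using D(4) by (simp add: M_def N_def)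
  qed
  have K3big: "K ^ 3 \<ge> 6000 * K ^ 2" using K_ge by (simp add: eval_nat_numeral mult_right_mono)
  have K2big: "K ^ 2 \<ge> 1" using K_ge by (intro one_le_power) auto
  \<comment> \<open>The diagonal and the near pairs take up at most half of \<open>M * N\<close>, so
    distant pairs account for the other half and bound \<open>N\<close> from below.\<close>
  have t1: "K5 * (5 * M) \<le> M * N / 4"
  proof -
    have "20 * K5 * K \<le> G"
    proof -
      have "20 * K \<le> K ^ 3"
      proof -
        have "20 * K \<le> 6000 * (K * K)" using K_ge mult_mono[of 1 K K K] by simp
        then show ?thesis using K3big by (simp add: power2_eq_square)
      qed
      then have "(20 * K) * K5 \<le> K ^ 3 * K5" using K5 by (intro mult_right_mono) auto
      then show ?thesis using GK5 by (simp add: mult_ac)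
    qed
    also have "\<dots> \<le> \<sigma> powr (-\<kappa>)" by (rule order_trans[OF Gle]) (use \<sigma> \<kappa> in \<open>auto intro!: powr_mono'\<close>)
    also have "\<dots> \<le> K * N" unfolding N_def by (rule nonconc) (use \<sigma> dpow[of 1] in auto)
    finally have "K * (20 * K5) \<le> K * N" by (simp add: mult_ac)
    then have "20 * K5 \<le> N" using K_ge by simp
    then have "M * (20 * K5) \<le> M * N" using M by (intro mult_left_mono) auto
    then show ?thesis by (simp add: mult_ac)
  qed
  have t2: "K5 * (35 * 1 * (9 * K ^ 2 * N / G) / \<sigma>) \<le> M * N / 4"
  proof -
    have "K5 * (35 * 1 * (9 * K ^ 2 * N / G) / \<sigma>) = (315 * K ^ 2 / K ^ 3) * (N / \<sigma>)"
      unfolding GK5 using K5 K_ge \<sigma> by (simp add: field_simps)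
    also have "\<dots> \<le> (1 / 16) * (N / \<sigma>)"
    proof (rule mult_right_mono)
      have "5040 * K ^ 2 \<le> K ^ 3" using K3big K2big by linarith
      then show "315 * K ^ 2 / K ^ 3 \<le> 1 / 16" using K_ge by (simp add: divide_simps)
    qed (use N \<sigma> in simp)
    also have "\<dots> = (1 / (4 * \<sigma>)) * N / 4" by simp
    also have "\<dots> \<le> M * N / 4" using M N by (intro divide_right_mono mult_right_mono) auto
    finally show ?thesis .
  qed
  have "M * N / 2 \<le> K5 * (5 * N ^ 2 / r0)"
    using en t1 t2 by (simp add: distrib_left)
  then have "N * (M / 2) \<le> N * (K5 * (5 * N / r0))" by (simp add: power2_eq_square mult_ac)
  then have "M / 2 \<le> K5 * (5 * N / r0)" by (rule mult_left_le_imp_le) (use N in simp)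
  then have "M * r0 \<le> 10 * K5 * N" using r0 by (simp add: field_simps)
  moreover have "1 / (4 * \<sigma>) * r0 \<le> M * r0" using M r0 by (intro mult_right_mono) auto
  ultimately have "1 / \<sigma> * r0 \<le> 40 * K5 * N" by simp
  also have "\<dots> \<le> G * N"
  proof (rule mult_right_mono)
    have "40 \<le> K ^ 3" using K3big K2big by linarith
    then show "40 * K5 \<le> G" unfolding GK5 using K5 by (intro mult_right_mono) auto
  qed (use N in simp)
  finally have "1 / \<sigma> * r0 / G \<le> N" using G1 by (subst pos_divide_le_eq) (auto simp: mult.commute)
  moreover have "\<sigma> powr (-1) * G powr (-(1 / \<kappa> + 1)) = 1 / \<sigma> * r0 / G"
  proof -
    have "-(1 / \<kappa> + 1) = -(1 / \<kappa>) + (-1)" by simp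
    then have "G powr (-(1 / \<kappa> + 1)) = r0 * G powr (-1)" unfolding r0_def powr_add[symmetric] by (simp only:)
    then show ?thesis using \<sigma> G1 by (simp add: powr_minus_divide)
  qed
  ultimately show ?thesis by (simp add: N_def)
qed

end

context ring_chain
begin

text \<open>The bound holds at \<open>\<sigma>\<close>, the root of \<open>\<delta>\<close> of order
  \<open>n = a ^ i\<close>. Its \<open>n\<close>-th power returns to \<open>\<delta>\<close> by
  \<open>superadditive_power\<close>. The loss in \<open>\<sigma> powr c\<close> becomes the same
  power of \<open>\<delta>\<close>, while the power of \<open>K\<close> is multiplied by
  \<open>n\<close>; since \<open>i \<le> k + 1\<close>, it stays within \<open>E\<close>.\<close>

lemma chain_bound:
  fixes p k :: nat and c :: real
  defines "a \<equiv> 2 * p + 1" and "e \<equiv> q * (2 * p + 2) + 4"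
  defines "E \<equiv> real a ^ (k + 1) * (real q + real e * (1 / \<kappa> + 1))"
  assumes p: "2 \<le> real p * \<kappa>" and c: "0 < c" "c \<le> \<kappa> / 4" "2 * real a ^ 2 \<le> c * real k"
    and Ke: "K ^ e \<le> \<delta> powr (-(\<kappa> / (4 * real a ^ (k + 1))))"
    and \<delta>1: "\<delta> < 1" "K * \<delta> < 1" "\<delta> \<le> (1/4) ^ (a ^ (k + 1))"
  shows "\<delta> powr (-1 + c * (1 / \<kappa> + 1)) * K powr (-E) \<le> P \<delta>"
proof -
  have "1 \<le> p" using p by (cases p) auto
  then have a2: "a \<ge> 2" by (simp add: a_def)
  obtain i where i: "2 \<le> i" "i \<le> k + 1" and sel: "P ((\<delta> powr (1 / real a ^ i)) ^ a) \<le>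
     (\<delta> powr (1 / real a ^ i)) powr (-c) * P (\<delta> powr (1 / real a ^ i)) ^ a"
    using scale_selection[OF a2 c(1,3) \<delta>1(1,2)] by blast
  define \<sigma> where "\<sigma> = \<delta> powr (1 / real a ^ i)"
  define n where "n = a ^ i"
  have n0: "n > 0" using a2 by (simp add: n_def)
  have \<sigma>0: "\<sigma> > 0" using \<delta> by (simp add: \<sigma>_def)
  have \<sigma>pow: "\<sigma> powr (real n * x) = \<delta> powr x" for x
  proof -
    have "\<sigma> powr (real n * x) = \<delta> powr (1 / real a ^ i * (real n * x))" unfolding \<sigma>_def by (rule powr_powr)
    also have "1 / real a ^ i * (real n * x) = x" using a2 by (simp add: n_def)
    finally show ?thesis .
  qed
  have \<sigma>n: "\<sigma> ^ n = \<delta>"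
    using \<sigma>pow[of 1] \<sigma>0 \<delta> by (simp add: powr_realpow)
  have \<sigma>4: "\<sigma> \<le> 1/4"
  proof (rule power_le_imp_le_base)
    have "\<delta> \<le> (1/4::real) ^ n"
      unfolding n_def using i a2 by (intro order_trans[OF \<delta>1(3)] power_decreasing power_increasing) auto
    then show "\<sigma> ^ Suc (n - 1) \<le> (1/4) ^ Suc (n - 1)" using \<sigma>n n0 by simp
  qed simp
  \<comment> \<open>This is why the selection starts at index 2: for \<open>i = 1\<close> the order
    would be \<open>a = 2 * p + 1\<close>, one less than needed for
    \<open>\<delta> \<le> \<sigma> ^ (2 * p + 2)\<close>.\<close>
  have "2 * p + 2 \<le> a * a" using \<open>1 \<le> p\<close> by (simp add: a_def algebra_simps)
  also have "a * a = a ^ 2" by (simp add: power2_eq_square)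
  also have "a ^ 2 \<le> n" unfolding n_def using a2 i by (intro power_increasing) auto
  finally have pn: "2 * p + 2 \<le> n" .
  have \<delta>\<sigma>: "\<delta> \<le> \<sigma> ^ (2 * p + 2)"
    using power_decreasing[OF pn, of \<sigma>] \<sigma>0 \<sigma>4 \<sigma>n by simp
  have nk: "real n \<le> real a ^ (k + 1)"
  proof -
    have "real a ^ i \<le> real a ^ (k + 1)" by (rule power_increasing) (use i a2 in auto)
    then show ?thesis by (simp add: n_def)
  qed
  have Ks: "K ^ e \<le> \<sigma> powr (-\<kappa> / 4)"
  proof -
    have "\<delta> powr (-(\<kappa> / (4 * real a ^ (k + 1)))) \<le> \<delta> powr (-(\<kappa> / (4 * real n)))"
    proof (rule powr_mono')
      have "\<kappa> / (4 * real a ^ (k + 1)) \<le> \<kappa> / (4 * real n)"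
        using nk n0 \<kappa> a2 by (intro divide_left_mono mult_pos_pos mult_left_mono) auto
      then show "-(\<kappa> / (4 * real n)) \<le> -(\<kappa> / (4 * real a ^ (k + 1)))" by simp
    qed (use \<delta> \<delta>1 in auto)
    also have "\<dots> = \<sigma> powr (-\<kappa> / 4)" using \<sigma>pow[of "-(\<kappa> / (4 * real n))"] n0 by simp
    finally show ?thesis using Ke by linarith
  qed
  define G where "G = K ^ e * \<sigma> powr (-c)"
  have SB: "\<sigma> powr (-1) * G powr (-(1 / \<kappa> + 1)) \<le> P \<sigma>"
    unfolding G_def e_def
    by (rule scale_bound[OF \<sigma>0 \<sigma>4 p \<delta>\<sigma> c(1,2)]) (use sel Ks in \<open>simp_all only: \<sigma>_def a_def e_def\<close>)
  have K0: "K > 0" by (rule K_ge)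
  define u where "u = 1 / \<kappa> + 1"
  have u0: "u \<ge> 0" using \<kappa> by (simp add: u_def)
  have Gp: "\<sigma> powr (-1) * G powr (-u) = \<sigma> powr (-1 + c * u) * K powr (-(real e * u))"
  proof -
    have "G powr (-u) = (K ^ e) powr (-u) * (\<sigma> powr (-c)) powr (-u)"
      unfolding G_def by (rule powr_mult)
    also have "(K ^ e) powr (-u) = K powr (-(real e * u))" using K0 by (simp add: powr_realpow[symmetric] powr_powr)
    also have "(\<sigma> powr (-c)) powr (-u) = \<sigma> powr (c * u)" by (simp add: powr_powr)
    finally show ?thesis unfolding powr_add by (simp only: mult_ac)
  qed
  have "\<delta> powr (-1 + c * u) * K powr (-(real n * (real e * u))) = (\<sigma> powr (-1) * G powr (-u)) ^ n"
  proof -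
    have "(\<sigma> powr (-1 + c * u)) ^ n = \<sigma> powr (real n * (-1 + c * u))"
      using \<sigma>0 by (simp add: powr_realpow[symmetric] powr_powr mult.commute)
    moreover have "(K powr (-(real e * u))) ^ n = K powr (-(real n * (real e * u)))"
      using K0 by (simp add: powr_realpow[symmetric] powr_powr mult_ac)
    ultimately show ?thesis unfolding Gp power_mult_distrib using \<sigma>pow by simp
  qed
  also have "\<dots> \<le> P \<sigma> ^ n" using SB unfolding u_def by (intro power_mono) auto
  also have "\<dots> \<le> K ^ (q * n) * P (\<sigma> ^ n)"
    by (rule superadditive_power) (use \<sigma>0 \<sigma>4 \<sigma>n in auto)
  finally have main: "\<delta> powr (-1 + c * u) * K powr (-(real n * (real e * u))) \<le> K ^ (q * n) * P \<delta>" using \<sigma>n by simp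
  have "\<delta> powr (-1 + c * u) * K powr (-E) \<le> \<delta> powr (-1 + c * u) * K powr (-(real n * (real e * u)) - real (q * n))"
  proof (intro mult_left_mono powr_mono)
    have "real n * (real q + real e * u) \<le> real a ^ (k + 1) * (real q + real e * u)"
      using nk u0 by (intro mult_right_mono) auto
    then show "-E \<le> -(real n * (real e * u)) - real (q * n)" unfolding E_def u_def[symmetric] by (simp add: algebra_simps)
  qed (use K_ge in auto)
  also have "\<dots> = (\<delta> powr (-1 + c * u) * K powr (-(real n * (real e * u)))) / K ^ (q * n)"
    using K0 by (simp only: powr_diff powr_realpow) simp
  also have "\<dots> \<le> P \<delta>" using main K0 by (simp add: pos_divide_le_eq mult.commute)
  finally show ?thesis by (simp add: u_def)
qed

end

text \<open>The chain estimate with \<open>K = \<delta> powr (-\<eta>)\<close>. The level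
  \<open>m\<close> depends on \<open>\<eta>\<close> because about \<open>1 / \<eta>\<close>
  multiplications are needed to reach size \<open>\<delta>\<close>. It is fixed before
  \<open>R\<close>, since in the application \<open>R\<close> bounds the elements of that level;
  \<open>R\<close> affects only how small \<open>\<delta>\<close> has to be.\<close>

lemma discretized_ring:
  fixes \<kappa> \<tau> :: real
  assumes \<kappa>: "0 < \<kappa>" "\<kappa> \<le> 1" and \<tau>: "0 < \<tau>"
  shows "\<exists>\<eta>0>0. \<forall>\<eta>. 0 < \<eta> \<longrightarrow> \<eta> \<le> \<eta>0 \<longrightarrow> (\<exists>m. \<forall>R\<ge>1. \<exists>\<delta>0>0. \<forall>\<delta> (Z :: nat \<Rightarrow> real set).
    0 < \<delta> \<longrightarrow> \<delta> < \<delta>0 \<longrightarrow> 0 \<in> Z 0 \<longrightarrow> 1 \<in> Z 0 \<longrightarrow>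
    (\<forall>l x y z w. x \<in> Z l \<longrightarrow> y \<in> Z l \<longrightarrow> z \<in> Z l \<longrightarrow> w \<in> Z l \<longrightarrow> x * y - z * w \<in> Z (Suc l)) \<longrightarrow>
    Z m \<subseteq> {-R..R} \<longrightarrow>
    (\<forall>\<rho>. \<delta> \<le> \<rho> \<longrightarrow> \<rho> \<le> 1 \<longrightarrow> real (pack \<rho> (Z m)) \<le> \<delta> powr (-\<eta>) * real (pack \<rho> (Z 0))) \<longrightarrow>
    (\<forall>\<rho>. \<delta> \<le> \<rho> \<longrightarrow> \<rho> \<le> 1 \<longrightarrow> \<rho> powr (-\<kappa>) \<le> \<delta> powr (-\<eta>) * real (pack \<rho> (Z 0))) \<longrightarrow>
    \<delta> powr (-1 + \<tau>) \<le> real (pack \<delta> (Z 0)))"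
proof -
  define u where "u = 1 / \<kappa> + 1"
  have u: "u > 0" using \<kappa> by (simp add: u_def add_pos_pos)
  define p1 where "p1 = nat \<lceil>6 / \<kappa>\<rceil>"
  define p where "p = nat \<lceil>2 / \<kappa>\<rceil>"
  define a where "a = 2 * p + 1"
  \<comment> \<open>Half of \<open>\<tau>\<close> pays for the imperfect multiplicativity of the
    selected scale, through \<open>c * u \<le> \<tau> / 2\<close>; the other half is left for powers
    of \<open>K\<close>.\<close>
  define c where "c = min (\<kappa> / 4) (\<tau> / (2 * u))"
  define k where "k = nat \<lceil>2 * real a ^ 2 / c\<rceil>"
  define e where "e = (p1 + 3) * (2 * p + 2) + 4"
  define E where "E = real a ^ (k + 1) * (real (p1 + 3) + real e * u)"
  have p1: "6 \<le> real p1 * \<kappa>"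
  proof -
    have "6 / \<kappa> \<le> real p1" unfolding p1_def by linarith
    then show ?thesis using \<kappa> by (simp add: pos_divide_le_eq)
  qed
  have p: "2 \<le> real p * \<kappa>"
  proof -
    have "2 / \<kappa> \<le> real p" unfolding p_def by linarith
    then show ?thesis using \<kappa> by (simp add: pos_divide_le_eq)
  qed
  have c: "0 < c" "c \<le> \<kappa> / 4" using \<kappa> \<tau> u by (auto simp: c_def)
  have k: "2 * real a ^ 2 \<le> c * real k"
  proof -
    have "2 * real a ^ 2 / c \<le> real k" unfolding k_def by linarith
    then show ?thesis using c by (simp add: pos_divide_le_eq mult.commute)
  qed
  have cu: "c * u \<le> \<tau> / 2"
  proof -
    have "c * u \<le> (\<tau> / (2 * u)) * u" using u by (intro mult_right_mono) (auto simp: c_def)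
    then show ?thesis using u by simp
  qed
  have a0: "real a > 0" by (simp add: a_def)
  have "e > 0" by (simp add: e_def)
  then have e0: "real e > 0" by simp
  have E0: "E > 0" unfolding E_def using a0 e0 u by (intro mult_pos_pos add_nonneg_pos zero_less_power) auto
  \<comment> \<open>The four bounds ensure in turn \<open>K * \<delta> < 1\<close>,
    \<open>\<delta> * K ^ p1 \<le> 1\<close>, the bound on \<open>K ^ e\<close> assumed by
    \<open>chain_bound\<close>, and that \<open>K powr E\<close> costs at most
    \<open>\<delta> powr (-(\<tau> / 2))\<close>.\<close>
  define \<eta>0 where "\<eta>0 = min (1/2) (min (1 / real (p1 + 1)) (min (\<kappa> / (4 * real a ^ (k + 1)) / real e) (\<tau> / 2 / E)))"
  have "\<eta>0 > 0" unfolding \<eta>0_def using \<kappa> \<tau> a0 e0 E0 by simp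
  moreover have "\<exists>m. \<forall>R\<ge>1. \<exists>\<delta>0>0. \<forall>\<delta> (Z :: nat \<Rightarrow> real set).
    0 < \<delta> \<longrightarrow> \<delta> < \<delta>0 \<longrightarrow> 0 \<in> Z 0 \<longrightarrow> 1 \<in> Z 0 \<longrightarrow>
    (\<forall>l x y z w. x \<in> Z l \<longrightarrow> y \<in> Z l \<longrightarrow> z \<in> Z l \<longrightarrow> w \<in> Z l \<longrightarrow> x * y - z * w \<in> Z (Suc l)) \<longrightarrow>
    Z m \<subseteq> {-R..R} \<longrightarrow>
    (\<forall>\<rho>. \<delta> \<le> \<rho> \<longrightarrow> \<rho> \<le> 1 \<longrightarrow> real (pack \<rho> (Z m)) \<le> \<delta> powr (-\<eta>) * real (pack \<rho> (Z 0))) \<longrightarrow>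
    (\<forall>\<rho>. \<delta> \<le> \<rho> \<longrightarrow> \<rho> \<le> 1 \<longrightarrow> \<rho> powr (-\<kappa>) \<le> \<delta> powr (-\<eta>) * real (pack \<rho> (Z 0))) \<longrightarrow>
    \<delta> powr (-1 + \<tau>) \<le> real (pack \<delta> (Z 0))"
    if \<eta>: "0 < \<eta>" "\<eta> \<le> \<eta>0" for \<eta>
  proof -
    have \<eta>1: "\<eta> \<le> 1/2" "\<eta> * real p1 \<le> 1" "\<eta> * real e \<le> \<kappa> / (4 * real a ^ (k + 1))" "\<eta> * E \<le> \<tau> / 2"
    proof -
      show "\<eta> \<le> 1/2" using \<eta> by (simp add: \<eta>0_def)
      have "\<eta> \<le> 1 / real (p1 + 1)" using \<eta> by (simp add: \<eta>0_def)
      then have "\<eta> * real (p1 + 1) \<le> 1" by (simp add: pos_le_divide_eq)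
      then show "\<eta> * real p1 \<le> 1" using \<eta> by (simp add: distrib_left)
      have "\<eta> \<le> \<kappa> / (4 * real a ^ (k + 1)) / real e" using \<eta> by (simp add: \<eta>0_def)
      then show "\<eta> * real e \<le> \<kappa> / (4 * real a ^ (k + 1))" using e0 by (subst (asm) pos_le_divide_eq) auto
      have "\<eta> \<le> \<tau> / 2 / E" using \<eta> by (simp add: \<eta>0_def)
      then show "\<eta> * E \<le> \<tau> / 2" using E0 by (subst (asm) pos_le_divide_eq) auto
    qed
    define n1 where "n1 = nat \<lceil>1 / \<eta>\<rceil>"
    have n1: "1 \<le> \<eta> * real n1"
    proof -
      have "1 / \<eta> \<le> real n1" unfolding n1_def by linarith
      then show ?thesis using \<eta> by (simp add: pos_divide_le_eq mult.commute)
    qed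
    show ?thesis
    proof (intro exI[of _ "n1 + 10"] allI impI)
      fix R :: real assume R: "1 \<le> R"
      define \<delta>0 where "\<delta>0 = min (min 1 ((1/4) ^ (a ^ (k + 1)))) ((6000 * R) powr (-(1 / \<eta>)))"
      have "\<delta>0 > 0" using R by (simp add: \<delta>0_def)
      moreover have "\<delta> powr (-1 + \<tau>) \<le> real (pack \<delta> (Z 0))"
        if \<delta>: "0 < \<delta>" "\<delta> < \<delta>0" and Z: "0 \<in> Z 0" "1 \<in> Z 0"
          "\<forall>l x y z w. x \<in> Z l \<longrightarrow> y \<in> Z l \<longrightarrow> z \<in> Z l \<longrightarrow> w \<in> Z l \<longrightarrow> x * y - z * w \<in> Z (Suc l)"
          "Z (n1 + 10) \<subseteq> {-R..R}"
          "\<forall>\<rho>. \<delta> \<le> \<rho> \<longrightarrow> \<rho> \<le> 1 \<longrightarrow> real (pack \<rho> (Z (n1 + 10))) \<le> \<delta> powr (-\<eta>) * real (pack \<rho> (Z 0))"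
          "\<forall>\<rho>. \<delta> \<le> \<rho> \<longrightarrow> \<rho> \<le> 1 \<longrightarrow> \<rho> powr (-\<kappa>) \<le> \<delta> powr (-\<eta>) * real (pack \<rho> (Z 0))"
        for \<delta> and Z :: "nat \<Rightarrow> real set"
      proof -
        define K where "K = \<delta> powr (-\<eta>)"
        have \<delta>1: "\<delta> < 1" "\<delta> \<le> (1/4) ^ (a ^ (k + 1))" "\<delta> \<le> (6000 * R) powr (-(1 / \<eta>))" using \<delta> by (auto simp: \<delta>0_def)
        have KR: "6000 * R \<le> K"
        proof -
          have "6000 * R = ((6000 * R) powr (-(1 / \<eta>))) powr (-\<eta>)" using R \<eta> by (simp add: powr_powr)
          also have "\<dots> \<le> K" unfolding K_def using \<delta>1 \<delta> \<eta> by (intro powr_mono2') auto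
          finally show ?thesis .
        qed
        have Kpow: "K ^ i = \<delta> powr (-(\<eta> * real i))" for i
          using \<delta> by (simp add: K_def powr_realpow[symmetric] powr_powr)
        have d1: "\<delta> * \<delta> powr x = \<delta> powr (1 + x)" for x using \<delta> by (simp add: powr_add)
        interpret ring_chain Z "n1 + 10" p1 n1 K R \<delta> \<kappa>
        proof
          show "1 \<le> \<delta> * K ^ n1"
          proof -
            have "\<delta> * K ^ n1 = \<delta> powr (1 + -(\<eta> * real n1))" unfolding Kpow d1 ..
            moreover have "\<delta> powr 0 \<le> \<delta> powr (1 + -(\<eta> * real n1))" using n1 \<delta> \<delta>1 by (intro powr_mono') auto
            ultimately show ?thesis using \<delta> by simp
          qed
          show "\<delta> * K ^ p1 \<le> 1"
          proof -
            have "\<delta> * K ^ p1 = \<delta> powr (1 + -(\<eta> * real p1))" unfolding Kpow d1 ..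
            moreover have "\<delta> powr (1 + -(\<eta> * real p1)) \<le> \<delta> powr 0" using \<eta>1 \<delta> \<delta>1 by (intro powr_mono') auto
            ultimately show ?thesis using \<delta> by simp
          qed
        qed (use Z KR R \<delta> \<kappa> p1 in \<open>auto simp: K_def\<close>)
        have "\<delta> powr (-1 + c * (1 / \<kappa> + 1)) * K powr (-E) \<le> P \<delta>"
          unfolding E_def a_def e_def u_def
        proof (rule chain_bound[OF p c])
          show "2 * real (2 * p + 1) ^ 2 \<le> c * real k" using k by (simp add: a_def)
          show "K ^ ((p1 + 3) * (2 * p + 2) + 4) \<le> \<delta> powr (-(\<kappa> / (4 * real (2 * p + 1) ^ (k + 1))))"
            using \<eta>1(3) \<delta> \<delta>1 unfolding Kpow e_def a_def by (intro powr_mono') auto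
          show "\<delta> < 1" "\<delta> \<le> (1/4) ^ ((2 * p + 1) ^ (k + 1))" using \<delta>1 by (simp_all add: a_def)
          have "K * \<delta> = \<delta> powr (1 + -\<eta>)" unfolding K_def using d1 by (simp only: mult.commute)
          also have "\<dots> < \<delta> powr 0" using \<eta>1 \<delta> \<delta>1 by (intro powr_less_mono') auto
          finally show "K * \<delta> < 1" using \<delta> by simp
        qed
        moreover have "\<delta> powr (-1 + \<tau>) \<le> \<delta> powr (-1 + c * (1 / \<kappa> + 1)) * K powr (-E)"
        proof -
          have "\<delta> powr (-1 + c * (1 / \<kappa> + 1)) * K powr (-E) = \<delta> powr (-1 + c * u + \<eta> * E)"
            by (simp add: K_def u_def powr_powr powr_add)
          moreover have "\<delta> powr (-1 + \<tau>) \<le> \<delta> powr (-1 + c * u + \<eta> * E)"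
            using cu \<eta>1(4) \<delta> \<delta>1 by (intro powr_mono') auto
          ultimately show ?thesis by simp
        qed
        ultimately show ?thesis by linarith
      qed
      ultimately show "\<exists>\<delta>0>0. \<forall>\<delta> (Z :: nat \<Rightarrow> real set).
        0 < \<delta> \<longrightarrow> \<delta> < \<delta>0 \<longrightarrow> 0 \<in> Z 0 \<longrightarrow> 1 \<in> Z 0 \<longrightarrow>
        (\<forall>l x y z w. x \<in> Z l \<longrightarrow> y \<in> Z l \<longrightarrow> z \<in> Z l \<longrightarrow> w \<in> Z l \<longrightarrow> x * y - z * w \<in> Z (Suc l)) \<longrightarrow>
        Z (n1 + 10) \<subseteq> {-R..R} \<longrightarrow>
        (\<forall>\<rho>. \<delta> \<le> \<rho> \<longrightarrow> \<rho> \<le> 1 \<longrightarrow> real (pack \<rho> (Z (n1 + 10))) \<le> \<delta> powr (-\<eta>) * real (pack \<rho> (Z 0))) \<longrightarrow>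
        (\<forall>\<rho>. \<delta> \<le> \<rho> \<longrightarrow> \<rho> \<le> 1 \<longrightarrow> \<rho> powr (-\<kappa>) \<le> \<delta> powr (-\<eta>) * real (pack \<rho> (Z 0))) \<longrightarrow>
        \<delta> powr (-1 + \<tau>) \<le> real (pack \<delta> (Z 0))" by (intro exI[of _ \<delta>0] conjI allI impI) simp_all
    qed
  qed
  ultimately show ?thesis by (intro exI[of _ \<eta>0]) blast
qed

section \<open>Separating coordinates\<close>

text \<open>Let \<open>\<psi>\<close> be \<open>\<phi>\<close> minus the linear function with the
  same value at 1, and \<open>M\<close> the supremum of its modulus. Doubling bounds it by
  \<open>(M + e) / 2\<close> on the left half of the interval, and reflection at 1/2 with
  \<open>\<psi> 1 = 0\<close> adds \<open>e\<close> on the right half, so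
  \<open>M \<le> (M + 3 * e) / 2\<close>. The bound \<open>B\<close> makes \<open>M\<close> finite
  and leaves no trace in the result.\<close>

lemma almost_additive_linear:
  fixes \<phi> :: "real \<Rightarrow> real"
  assumes bd: "\<And>x. 0 \<le> x \<Longrightarrow> x \<le> 1 \<Longrightarrow> \<bar>\<phi> x\<bar> \<le> B"
    and add: "\<And>x y. 0 \<le> x \<Longrightarrow> 0 \<le> y \<Longrightarrow> x + y \<le> 1 \<Longrightarrow> \<bar>\<phi> (x + y) - \<phi> x - \<phi> y\<bar> \<le> e"
    and x: "0 \<le> x" "x \<le> 1"
  shows "\<bar>\<phi> x - x * \<phi> 1\<bar> \<le> 3 * e"
proof -
  define \<psi> where "\<psi> = (\<lambda>x. \<phi> x - x * \<phi> 1)"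
  have padd: "\<bar>\<psi> (x + y) - \<psi> x - \<psi> y\<bar> \<le> e" if "0 \<le> x" "0 \<le> y" "x + y \<le> 1" for x y
    using add[OF that] by (simp add: \<psi>_def algebra_simps)
  have pbd: "\<bar>\<psi> x\<bar> \<le> B + \<bar>\<phi> 1\<bar>" if "0 \<le> x" "x \<le> 1" for x
  proof -
    have "\<bar>x * \<phi> 1\<bar> \<le> 1 * \<bar>\<phi> 1\<bar>" unfolding abs_mult using that by (intro mult_right_mono) auto
    then show ?thesis using bd[OF that] unfolding \<psi>_def by linarith
  qed
  define M where "M = (SUP x\<in>{0..1}. \<bar>\<psi> x\<bar>)"
  have bdd: "bdd_above ((\<lambda>x. \<bar>\<psi> x\<bar>) ` {0..1})" using pbd by (intro bdd_aboveI2) auto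
  have le_M: "\<bar>\<psi> x\<bar> \<le> M" if "0 \<le> x" "x \<le> 1" for x
    unfolding M_def by (rule cSUP_upper[OF _ bdd]) (use that in auto)
  have ar: "\<bar>s\<bar> \<le> (M + e) / 2" if "\<bar>t - s - s\<bar> \<le> e" "\<bar>t\<bar> \<le> M" for s t :: real
  proof (rule abs_leI)
    have "2 * s \<le> M + e" using that by linarith
    then show "s \<le> (M + e) / 2" by simp
    have "2 * (- s) \<le> M + e" using that by linarith
    then show "- s \<le> (M + e) / 2" by simp
  qed
  have small: "\<bar>\<psi> x\<bar> \<le> (M + e) / 2" if "0 \<le> x" "x \<le> 1/2" for x
  proof -
    have "\<bar>\<psi> (x + x) - \<psi> x - \<psi> x\<bar> \<le> e" using padd[of x x] that by simp
    moreover have "\<bar>\<psi> (x + x)\<bar> \<le> M" using le_M[of "x + x"] that by simp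
    ultimately show ?thesis by (rule ar)
  qed
  have "\<bar>\<psi> x\<bar> \<le> (M + 3 * e) / 2" if "0 \<le> x" "x \<le> 1" for x
  proof (cases "x \<le> 1/2")
    case True
    have "0 \<le> e" using padd[of 0 0] by simp
    then show ?thesis using small[OF that(1) True] by simp
  next
    case False
    have "\<psi> 1 = 0" by (simp add: \<psi>_def)
    then have "\<bar>0 - \<psi> x - \<psi> (1 - x)\<bar> \<le> e" using padd[of x "1 - x"] that by simp
    moreover have "2 * \<bar>\<psi> (1 - x)\<bar> \<le> M + e" using small[of "1 - x"] False that by simp
    ultimately have "2 * \<bar>\<psi> x\<bar> \<le> M + 3 * e" by linarith
    then show ?thesis by simp
  qed
  then have "M \<le> (M + 3 * e) / 2" unfolding M_def by (intro cSUP_least) auto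
  then have "M \<le> 3 * e" by simp
  then show ?thesis using le_M[OF x] by (simp add: \<psi>_def)
qed

lemma linear_vec_nth: "linear (\<lambda>x::real^'n. x $ i)"
  by (simp add: linear_iff)

abbreviation (input) proj :: "'n \<Rightarrow> (real^'n) set \<Rightarrow> real set" where
  "proj j E \<equiv> (\<lambda>x. x $ j) ` E"

lemma vec_nth_le_norm: "\<bar>x $ i\<bar> \<le> norm (x::real^'n)"
  by (rule component_le_norm_cart)

text \<open>Sort the pairs \<open>(x, y)\<close> by \<open>x $ j - l * y $ j\<close> into cells of
  length \<open>\<delta>\<close>. There are at most \<open>6 * R / \<delta>\<close> cells, hence at
  least \<open>N ^ 4 * \<delta> / (6 * R)\<close> collisions. If all of them had \<open>y\<close>
  and \<open>y'\<close> within \<open>r\<close> in coordinate \<open>i\<close>, slab counting would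
  allow only \<open>N ^ 4 * G ^ 2\<close> divided by the two packing numbers in
  \<open>big\<close>.\<close>

lemma quotient_fill:
  fixes W :: "(real^'n) set"
  assumes bW: "bounded W" "W \<noteq> {}" and R: "1 \<le> R" "\<And>x i. x \<in> W \<Longrightarrow> \<bar>x $ i\<bar> \<le> R"
    and \<delta>: "0 < \<delta>" "\<delta> \<le> 1" "\<delta> \<le> r" and l: "0 \<le> l" "l \<le> 1"
    and G: "real (pack \<delta> (W + W)) \<le> G * real (pack \<delta> W)" "G > 0"
    and big: "6 * R * G\<^sup>2 < \<delta> * real (pack (4 * r) (proj i W)) * real (pack (4 * \<delta>) (proj j W))"
  shows "\<exists>x\<in>W. \<exists>x'\<in>W. \<exists>y\<in>W. \<exists>y'\<in>W. \<bar>(x - x') $ j - l * (y - y') $ j\<bar> \<le> \<delta> \<and> r < \<bar>(y - y') $ i\<bar>"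
proof (rule ccontr)
  assume con: "\<not> ?thesis"
  obtain D where D: "D \<subseteq> W" "finite D" "separated \<delta> D" "card D = pack \<delta> W"
    using pack_ex[OF bW(1) \<delta>(1)] by blast
  define N where "N = real (card D)"
  have N: "N \<ge> 1" using pack_pos[OF bW(1) \<delta>(1) bW(2)] D by (simp add: N_def)
  define pi where "pi = real (pack (4 * r) (proj i W))"
  define pj where "pj = real (pack (4 * \<delta>) (proj j W))"
  have "0 < 6 * R * G\<^sup>2" using R G by simp
  then have pp: "0 < \<delta> * pi * pj" using big unfolding pi_def pj_def by linarith
  have p0: "pi > 0" "pj > 0"
    using pp \<delta> by (auto simp: pi_def pj_def zero_less_mult_iff)
  have Fi: "real (card {x \<in> D. \<bar>x $ i - c\<bar> \<le> r}) \<le> G * N / pi" for c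
  proof -
    have "real (pack (4 * r) (proj i W) * card {x \<in> D. \<bar>x $ i - c\<bar> \<le> r}) \<le> real (pack \<delta> (W + W))"
      unfolding of_nat_le_iff
      by (rule card_slab_le[OF linear_vec_nth vec_nth_le_norm bW(1) \<delta>(1) _ D(1,3)]) (use \<delta> in simp)
    also have "\<dots> \<le> G * N" using G D by (simp add: N_def)
    finally show ?thesis using p0 by (simp add: pos_le_divide_eq pi_def mult.commute)
  qed
  have Fj: "real (card {x \<in> D. \<bar>x $ j - c\<bar> \<le> \<delta>}) \<le> G * N / pj" for c
  proof -
    have "real (pack (4 * \<delta>) (proj j W) * card {x \<in> D. \<bar>x $ j - c\<bar> \<le> \<delta>}) \<le> real (pack \<delta> (W + W))"
      unfolding of_nat_le_iff
      by (rule card_slab_le[OF linear_vec_nth vec_nth_le_norm bW(1) \<delta>(1) _ D(1,3)]) (use \<delta> in simp)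
    also have "\<dots> \<le> G * N" using G D by (simp add: N_def)
    finally show ?thesis using p0 by (simp add: pos_le_divide_eq pj_def mult.commute)
  qed
  define h where "h = (\<lambda>p::(real^'n) \<times> (real^'n). \<lfloor>(fst p $ j - l * snd p $ j) / \<delta>\<rfloor>)"
  define Q where "Q = {(p, q). p \<in> D \<times> D \<and> q \<in> D \<times> D \<and> h p = h q}"
  define E where "E = {\<lfloor>- (2 * R / \<delta>)\<rfloor>..\<lfloor>2 * R / \<delta>\<rfloor>}"
  have hE: "h ` (D \<times> D) \<subseteq> E"
  proof
    fix k assume "k \<in> h ` (D \<times> D)"
    then obtain x y where xy: "x \<in> D" "y \<in> D" "k = \<lfloor>(x $ j - l * y $ j) / \<delta>\<rfloor>" by (auto simp: h_def)
    have "\<bar>l * y $ j\<bar> \<le> 1 * R" unfolding abs_mult using l R xy D(1) by (intro mult_mono) auto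
    moreover have "\<bar>x $ j\<bar> \<le> R" using R xy D(1) by auto
    ultimately have "\<bar>x $ j - l * y $ j\<bar> \<le> 2 * R" by linarith
    then have "- (2 * R) \<le> x $ j - l * y $ j" "x $ j - l * y $ j \<le> 2 * R" by linarith+
    then have "- (2 * R) / \<delta> \<le> (x $ j - l * y $ j) / \<delta>" "(x $ j - l * y $ j) / \<delta> \<le> 2 * R / \<delta>"
      using divide_right_mono[of _ _ \<delta>] \<delta>(1) less_imp_le by blast+
    then show "k \<in> E" unfolding E_def xy(3) by (auto intro!: floor_mono)
  qed
  have cE: "real (card E) \<le> 6 * R / \<delta>"
  proof -
    have "real (card E) = real_of_int (\<lfloor>2 * R / \<delta>\<rfloor> - \<lfloor>- (2 * R / \<delta>)\<rfloor> + 1)"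
    proof -
      have "\<lfloor>- (2 * R / \<delta>)\<rfloor> \<le> \<lfloor>2 * R / \<delta>\<rfloor>" using R \<delta> by (intro floor_mono) (auto intro: order_trans[of _ 0])
      then show ?thesis by (simp add: E_def)
    qed
    also have "\<dots> \<le> 2 * R / \<delta> + 2 * R / \<delta> + 2" by linarith
    also have "\<dots> \<le> 6 * R / \<delta>"
    proof -
      have "1 * \<delta> \<le> R" using R \<delta> by linarith
      then have "1 \<le> R / \<delta>" using \<delta> by (simp add: pos_le_divide_eq)
      then show ?thesis by simp
    qed
    finally show ?thesis .
  qed
  \<comment> \<open>Choose \<open>y\<close>, \<open>y'\<close>, \<open>x\<close>, \<open>x'\<close>
    in this order: \<open>y\<close> and \<open>x\<close> are free, \<open>y'\<close> lies in a slab
    of half-width \<open>r\<close> around \<open>y\<close>, and \<open>x'\<close> in one of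
    half-width \<open>\<delta>\<close> determined by the other three.\<close>
  have QS: "real (card Q) \<le> N * (G * N / pi) * (N * (G * N / pj))"
  proof -
    let ?Di = "\<lambda>y. {y' \<in> D. \<bar>y' $ i - y $ i\<bar> \<le> r}"
    let ?Dj = "\<lambda>x y y'. {x' \<in> D. \<bar>x' $ j - (x $ j - l * (y $ j - y' $ j))\<bar> \<le> \<delta>}"
    let ?S = "SIGMA y:D. SIGMA y':?Di y. SIGMA x:D. ?Dj x y y'"
    let ?g = "\<lambda>((x, y), (x', y')). (y, y', x, x')"
    have inj: "inj_on ?g Q" by (auto simp: inj_on_def)
    have sub: "?g ` Q \<subseteq> ?S"
    proof
      fix s assume "s \<in> ?g ` Q"
      then obtain x y x' y' where q: "x \<in> D" "y \<in> D" "x' \<in> D" "y' \<in> D" "h (x, y) = h (x', y')" "s = (y, y', x, x')"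
        by (auto simp: Q_def)
      have "\<bar>(x $ j - l * y $ j) / \<delta> - (x' $ j - l * y' $ j) / \<delta>\<bar> < 1" using q(5) unfolding h_def by simp linarith
      then have "\<bar>(x $ j - l * y $ j) - (x' $ j - l * y' $ j)\<bar> / \<delta> < 1" using \<delta> by (simp flip: diff_divide_distrib)
      then have near: "\<bar>(x $ j - l * y $ j) - (x' $ j - l * y' $ j)\<bar> \<le> \<delta>" using \<delta> by simp
      then have "\<bar>(x - x') $ j - l * (y - y') $ j\<bar> \<le> \<delta>" by (simp add: algebra_simps)
      then have "\<not> r < \<bar>(y - y') $ i\<bar>" using con q D(1) by blast
      then have "\<bar>y' $ i - y $ i\<bar> \<le> r" by (simp add: abs_minus_commute)
      moreover have "\<bar>x' $ j - (x $ j - l * (y $ j - y' $ j))\<bar> \<le> \<delta>" using near by (simp add: algebra_simps abs_minus_commute)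
      ultimately show "s \<in> ?S" using q by simp
    qed
    have finS: "finite ?S" using D(2) by (intro finite_SigmaI) auto
    have "card Q \<le> card ?S" by (rule card_inj_on_le[OF inj sub finS])
    also have "card ?S = (\<Sum>y\<in>D. \<Sum>y'\<in>?Di y. \<Sum>x\<in>D. card (?Dj x y y'))"
      using D(2) by (subst card_SigmaI) (auto intro!: sum.cong card_SigmaI finite_SigmaI)
    finally have "real (card Q) \<le> (\<Sum>y\<in>D. \<Sum>y'\<in>?Di y. \<Sum>x\<in>D. real (card (?Dj x y y')))" 
      by (simp flip: of_nat_sum)
    also have "\<dots> \<le> (\<Sum>y\<in>D. \<Sum>y'\<in>?Di y. \<Sum>x\<in>D. G * N / pj)" by (intro sum_mono Fj)
    also have "\<dots> = (\<Sum>y\<in>D. real (card (?Di y)) * (N * (G * N / pj)))" by (simp add: N_def)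
    also have "\<dots> \<le> (\<Sum>y\<in>D. (G * N / pi) * (N * (G * N / pj)))"
      using N G p0 by (intro sum_mono mult_right_mono Fi) auto
    also have "\<dots> = N * (G * N / pi) * (N * (G * N / pj))" by (simp add: N_def)
    finally show ?thesis .
  qed
  have "(real (card (D \<times> D)))\<^sup>2 \<le> real (card E) * real (card Q)"
    unfolding Q_def by (rule collision_count[OF _ _ hE]) (use D in \<open>auto simp: E_def\<close>)
  then have "N ^ 4 \<le> real (card E) * real (card Q)"
    by (simp add: N_def card_cartesian_product power2_eq_square eval_nat_numeral mult_ac)
  also have "\<dots> \<le> (6 * R / \<delta>) * (N * (G * N / pi) * (N * (G * N / pj)))"
    using cE QS R \<delta> by (intro mult_mono) auto
  also have "\<dots> = N ^ 4 * (6 * R * G\<^sup>2 / (\<delta> * pi * pj))" by (simp add: power2_eq_square eval_nat_numeral mult_ac)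
  finally have "N ^ 4 * 1 \<le> N ^ 4 * (6 * R * G\<^sup>2 / (\<delta> * pi * pj))" by simp
  then have "1 \<le> 6 * R * G\<^sup>2 / (\<delta> * pi * pj)" by (rule mult_left_le_imp_le) (use N in simp)
  then have "\<delta> * pi * pj \<le> 6 * R * G\<^sup>2" using pp by (simp add: pos_le_divide_eq)
  then show False using big unfolding pi_def pj_def by linarith
qed

text \<open>If small \<open>j\<close>-th coordinate forced small \<open>i\<close>-th coordinate, the \<open>i\<close>-th coordinate would be an
  almost additive bounded function of the \<open>j\<close>-th one fixing 1, hence almost the identity.\<close>

lemma separating_element:
  fixes A :: "(real^'n) set"
  assumes bdd: "1 \<le> R" "\<And>x i. x \<in> ringgen A (k + 1) \<Longrightarrow> \<bar>x $ i\<bar> \<le> R"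
    and \<delta>: "0 < \<delta>" and r: "0 < r" "r \<le> 1"
    and fill: "\<And>l. 0 \<le> l \<Longrightarrow> l \<le> 1 \<Longrightarrow> \<exists>x\<in>ringgen A k. \<exists>x'\<in>ringgen A k. \<exists>y\<in>ringgen A k. \<exists>y'\<in>ringgen A k.
        \<bar>(x - x') $ j - l * (y - y') $ j\<bar> \<le> \<delta> \<and> r < \<bar>(y - y') $ i\<bar>"
    and a: "a \<in> A" "0 \<le> a $ j" "a $ j \<le> 2" "\<xi> \<le> \<bar>a $ i - a $ j\<bar>"
    and \<gamma>: "0 < \<gamma>" "9 * \<gamma> < r ^ 3 * \<xi>"
  shows "\<exists>e\<in>ringgen A (k + 6). \<bar>e $ j\<bar> \<le> 3 * R\<^sup>2 * \<delta> \<and> \<gamma> < \<bar>e $ i\<bar>"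
proof (rule ccontr)
  assume "\<not> ?thesis"
  then have con: "\<bar>e $ i\<bar> \<le> \<gamma>" if "e \<in> ringgen A (k + 6)" "\<bar>e $ j\<bar> \<le> 3 * R\<^sup>2 * \<delta>" for e
    using that by (meson not_less)
  have "\<exists>p q. p \<in> ringgen A (k + 1) \<and> q \<in> ringgen A (k + 1) \<and> \<bar>p $ j - l * q $ j\<bar> \<le> \<delta> \<and> r < \<bar>q $ i\<bar>"
    if l: "0 \<le> l" "l \<le> 1" for l
  proof -
    obtain x x' y y' where w: "x \<in> ringgen A k" "x' \<in> ringgen A k" "y \<in> ringgen A k" "y' \<in> ringgen A k"
      "\<bar>(x - x') $ j - l * (y - y') $ j\<bar> \<le> \<delta>" "r < \<bar>(y - y') $ i\<bar>" using fill[OF l] by blast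
    then show ?thesis using ringgen_diff[OF w(1,2)] ringgen_diff[OF w(3,4)]
      by (intro exI[of _ "x - x'"] exI[of _ "y - y'"]) auto
  qed
  then have "\<forall>l\<in>{0..1}. \<exists>z. fst z \<in> ringgen A (k + 1) \<and> snd z \<in> ringgen A (k + 1) \<and>
      \<bar>fst z $ j - l * snd z $ j\<bar> \<le> \<delta> \<and> r < \<bar>snd z $ i\<bar>" by simp
  from bchoice[OF this] obtain z where z: "\<forall>l\<in>{0..1}. fst (z l) \<in> ringgen A (k + 1) \<and> snd (z l) \<in> ringgen A (k + 1) \<and>
      \<bar>fst (z l) $ j - l * snd (z l) $ j\<bar> \<le> \<delta> \<and> r < \<bar>snd (z l) $ i\<bar>" by blast
  define p where "p = (\<lambda>l. fst (z l))"
  define q where "q = (\<lambda>l. snd (z l))"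
  have pq: "\<And>l. 0 \<le> l \<Longrightarrow> l \<le> 1 \<Longrightarrow> p l \<in> ringgen A (k + 1)"
    "\<And>l. 0 \<le> l \<Longrightarrow> l \<le> 1 \<Longrightarrow> q l \<in> ringgen A (k + 1)"
    "\<And>l. 0 \<le> l \<Longrightarrow> l \<le> 1 \<Longrightarrow> \<bar>p l $ j - l * q l $ j\<bar> \<le> \<delta>"
    "\<And>l. 0 \<le> l \<Longrightarrow> l \<le> 1 \<Longrightarrow> r < \<bar>q l $ i\<bar>" using z by (simp_all add: p_def q_def)
  \<comment> \<open>The pair \<open>p l\<close>, \<open>q l\<close> has quotient about
    \<open>l\<close> in coordinate \<open>j\<close>, and \<open>\<phi> l\<close> is its quotient in
    coordinate \<open>i\<close>. The pairs are arbitrary choices; near additivity comes from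
    \<open>con\<close>.\<close>
  define \<phi> where "\<phi> = (\<lambda>l. p l $ i / q l $ i)"
  have R2: "R * R \<ge> 1" using mult_mono[of 1 R 1 R] bdd(1) by simp
  have q0: "q l $ i \<noteq> 0" if "0 \<le> l" "l \<le> 1" for l using pq(4)[OF that] r by auto
  have bd: "\<bar>\<phi> l\<bar> \<le> R / r" if l: "0 \<le> l" "l \<le> 1" for l
    unfolding \<phi>_def abs_divide using bdd(2)[OF pq(1)[OF l], of i] pq(4)[OF l] r bdd(1) by (intro frac_le) auto
  have r3: "r ^ 3 > 0" "r ^ 3 \<le> r" using r power_decreasing[of 1 3 r] by auto
  have add: "\<bar>\<phi> (l + l') - \<phi> l - \<phi> l'\<bar> \<le> \<gamma> / r ^ 3" if ll: "0 \<le> l" "0 \<le> l'" "l + l' \<le> 1" for l l'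
  proof -
    define u where "u = l + l'"
    have L: "l \<le> 1" "l' \<le> 1" "0 \<le> u" "u \<le> 1" using ll by (auto simp: u_def)
    note m = pq(1)[OF ll(1) L(1)] pq(1)[OF ll(2) L(2)] pq(1)[OF L(3,4)] pq(2)[OF ll(1) L(1)] pq(2)[OF ll(2) L(2)] pq(2)[OF L(3,4)]
    \<comment> \<open>This is \<open>\<phi> l + \<phi> l' - \<phi> u\<close> with denominators
      cleared. In coordinate \<open>j\<close> only three errors of size \<open>\<delta>\<close>
      remain, so \<open>con\<close> applies. From level \<open>k + 1\<close>, triple products take
      two levels, the sum two more and the difference one, which gives \<open>k + 6\<close>.\<close>
    define e where "e = p l * q l' * q u + p l' * q l * q u - p u * q l * q l'"
    have tri: "x * y * z \<in> ringgen A (k + 3)"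
      if "x \<in> ringgen A (k + 1)" "y \<in> ringgen A (k + 1)" "z \<in> ringgen A (k + 1)" for x y z
      using ringgen_mult[OF ringgen_mult[OF that(1,2)] ringgen_Suc[OF that(3)]] by (simp add: eval_nat_numeral)
    have "p l * q l' * q u + p l' * q l * q u \<in> ringgen A (k + 5)"
      using ringgen_add[OF tri[OF m(1,5,6)] tri[OF m(2,4,6)]] by (simp add: eval_nat_numeral)
    then have e_in: "e \<in> ringgen A (k + 6)" unfolding e_def
      using ringgen_diff[of _ A "k + 5"] ringgen_mono[OF tri[OF m(3,4,5)], of "k + 5"] by (simp add: eval_nat_numeral)
    have t: "\<bar>\<alpha> * x * y\<bar> \<le> R\<^sup>2 * \<delta>" if "\<bar>\<alpha>\<bar> \<le> \<delta>" "\<bar>x\<bar> \<le> R" "\<bar>y\<bar> \<le> R" for \<alpha> x y :: real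
    proof -
      have "\<bar>\<alpha> * x * y\<bar> \<le> \<delta> * R * R" unfolding abs_mult using that \<delta> bdd(1) by (intro mult_mono) auto
      then show ?thesis by (simp add: power2_eq_square mult_ac)
    qed
    have "e $ j = (p l $ j - l * q l $ j) * q l' $ j * q u $ j + (p l' $ j - l' * q l' $ j) * q l $ j * q u $ j
        - (p u $ j - u * q u $ j) * q l $ j * q l' $ j"
      by (simp add: e_def u_def algebra_simps)
    moreover have "\<bar>(p l $ j - l * q l $ j) * q l' $ j * q u $ j\<bar> \<le> R\<^sup>2 * \<delta>"
      by (intro t pq(3) ll L bdd(2) m)
    moreover have "\<bar>(p l' $ j - l' * q l' $ j) * q l $ j * q u $ j\<bar> \<le> R\<^sup>2 * \<delta>"
      by (intro t pq(3) ll L bdd(2) m)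
    moreover have "\<bar>(p u $ j - u * q u $ j) * q l $ j * q l' $ j\<bar> \<le> R\<^sup>2 * \<delta>"
      by (intro t pq(3) ll L bdd(2) m)
    ultimately have "\<bar>e $ j\<bar> \<le> 3 * R\<^sup>2 * \<delta>" by linarith
    then have ei: "\<bar>e $ i\<bar> \<le> \<gamma>" by (rule con[OF e_in])
    define Qp where "Qp = q l $ i * q l' $ i * q u $ i"
    have "r * r * r \<le> \<bar>q l $ i\<bar> * \<bar>q l' $ i\<bar> * \<bar>q u $ i\<bar>"
      using pq(4)[OF ll(1) L(1)] pq(4)[OF ll(2) L(2)] pq(4)[OF L(3,4)] r by (intro mult_mono) auto
    then have Qr: "r ^ 3 \<le> \<bar>Qp\<bar>" by (simp add: Qp_def abs_mult eval_nat_numeral)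
    have "\<phi> u - \<phi> l - \<phi> l' = - (e $ i) / Qp"
      using q0[OF ll(1) L(1)] q0[OF ll(2) L(2)] q0[OF L(3,4)] by (simp add: \<phi>_def e_def Qp_def field_simps)
    then have "\<bar>\<phi> u - \<phi> l - \<phi> l'\<bar> = \<bar>e $ i\<bar> / \<bar>Qp\<bar>" by (simp add: abs_divide)
    also have "\<dots> \<le> \<gamma> / r ^ 3" using ei Qr r3 \<gamma> by (intro frac_le) auto
    finally show ?thesis by (simp add: u_def)
  qed
  have lin: "\<bar>\<phi> l - l * \<phi> 1\<bar> \<le> 3 * (\<gamma> / r ^ 3)" if "0 \<le> l" "l \<le> 1" for l
    by (rule almost_additive_linear[OF bd add that])
  have \<phi>1: "\<bar>\<phi> 1 - 1\<bar> \<le> \<gamma> / r ^ 3"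
  proof -
    have m: "p 1 \<in> ringgen A (k + 1)" "q 1 \<in> ringgen A (k + 1)"
      using pq(1)[of 1] pq(2)[of 1] by simp_all
    have "p 1 - q 1 \<in> ringgen A (k + 6)" using ringgen_mono[OF ringgen_diff[OF m], of "k + 6"] by simp
    moreover have "\<bar>(p 1 - q 1) $ j\<bar> \<le> 3 * R\<^sup>2 * \<delta>"
    proof -
      have "\<bar>(p 1 - q 1) $ j\<bar> \<le> 1 * \<delta>" using pq(3)[of 1] by simp
      also have "\<dots> \<le> 3 * R\<^sup>2 * \<delta>" using R2 \<delta> by (intro mult_right_mono) (auto simp: power2_eq_square)
      finally show ?thesis .
    qed
    ultimately have "\<bar>(p 1 - q 1) $ i\<bar> \<le> \<gamma>" by (rule con)
    moreover have "\<phi> 1 - 1 = (p 1 - q 1) $ i / q 1 $ i" using q0[of 1] by (simp add: \<phi>_def field_simps)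
    moreover have "r ^ 3 \<le> \<bar>q 1 $ i\<bar>" using pq(4)[of 1] r3 by simp
    ultimately show ?thesis using r3 \<gamma> by (simp add: abs_divide frac_le)
  qed
  \<comment> \<open>Halved because \<open>a $ j\<close> may be as large as 2 while
    \<open>\<phi>\<close> is controlled on the unit interval; \<open>p l + p l\<close> is compared
    with \<open>a * q l\<close> instead.\<close>
  define l where "l = a $ j / 2"
  have l: "0 \<le> l" "l \<le> 1" using a by (auto simp: l_def)
  have \<phi>l: "\<bar>2 * \<phi> l - a $ i\<bar> \<le> \<gamma> / r ^ 3"
  proof -
    note m = pq(1)[OF l] pq(2)[OF l]
    have "a \<in> ringgen A (k + 1)" by (rule ringgen_mono[of _ _ 0]) (use a in auto)
    then have "a * q l \<in> ringgen A (k + 3)" using ringgen_mult[of a A "k + 1" "q l"] m ringgen_Suc by (simp add: eval_nat_numeral)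
    moreover have "p l + p l \<in> ringgen A (k + 3)" using ringgen_add[OF m(1) m(1)] by (simp add: eval_nat_numeral)
    ultimately have "(p l + p l) - a * q l \<in> ringgen A (k + 4)" using ringgen_diff[of "p l + p l" A "k + 3" "a * q l"] by (simp add: eval_nat_numeral)
    then have "(p l + p l) - a * q l \<in> ringgen A (k + 6)" by (rule ringgen_mono) simp
    moreover have "\<bar>((p l + p l) - a * q l) $ j\<bar> \<le> 3 * R\<^sup>2 * \<delta>"
    proof -
      have al: "a $ j = 2 * l" by (simp add: l_def)
      have "((p l + p l) - a * q l) $ j = 2 * (p l $ j - l * q l $ j)"
        by (simp only: vector_minus_component vector_add_component vector_component al) (simp add: algebra_simps)
      then have "\<bar>((p l + p l) - a * q l) $ j\<bar> = 2 * \<bar>p l $ j - l * q l $ j\<bar>" by (simp only: abs_mult abs_numeral)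
      also have "\<dots> \<le> 2 * \<delta>" using pq(3)[OF l] by (intro mult_left_mono) auto
      also have "\<dots> \<le> 3 * R\<^sup>2 * \<delta>" using R2 \<delta> by (intro mult_right_mono) (auto simp: power2_eq_square)
      finally show ?thesis .
    qed
    ultimately have "\<bar>((p l + p l) - a * q l) $ i\<bar> \<le> \<gamma>" by (rule con)
    moreover have "2 * \<phi> l - a $ i = ((p l + p l) - a * q l) $ i / q l $ i" using q0[OF l] by (simp add: \<phi>_def field_simps)
    moreover have "r ^ 3 \<le> \<bar>q l $ i\<bar>" using pq(4)[OF l] r3 by simp
    ultimately show ?thesis using r3 \<gamma> by (simp add: abs_divide frac_le)
  qed
  define g where "g = \<gamma> / r ^ 3"
  have "\<bar>l * \<phi> 1 - l\<bar> \<le> 1 * g"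
  proof -
    have "\<bar>l * (\<phi> 1 - 1)\<bar> \<le> 1 * g" unfolding abs_mult using l \<phi>1 by (intro mult_mono) (auto simp: g_def)
    then show ?thesis by (simp add: algebra_simps)
  qed
  \<comment> \<open>The 9 is 1 for replacing \<open>a $ i\<close> by \<open>2 * \<phi> l\<close>, 6
    for twice the deviation from linearity, and 2 for twice the deviation of \<open>\<phi> 1\<close>
    from 1.\<close>
  then have "\<bar>a $ i - a $ j\<bar> \<le> 9 * g"
    using lin[OF l] \<phi>l unfolding g_def[symmetric] by (simp add: l_def)
  also have "\<dots> < \<xi>" using \<gamma> r3 by (simp add: g_def pos_divide_less_eq mult.commute)
  finally show False using a by simp
qed

text \<open>The exponent \<open>d\<close> is quantified before \<open>R\<close>. It determines how
  many growth steps are possible, and only then is the radius \<open>R\<close> of the ring elements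
  known; it may enter the constant \<open>C\<close> but not the exponent.\<close>

lemma pack_polynomial_bound:
  "\<exists>d\<ge>0. \<forall>R. \<exists>C>0. \<forall>E r. E \<subseteq> cball (0::'a::euclidean_space) R \<longrightarrow> 0 < r \<longrightarrow> r \<le> 1 \<longrightarrow> real (pack r E) \<le> C * r powr (-d)"
proof -
  define c where "c = real (pack 1 (cball (0::'a) 2))"
  have c: "c \<ge> 1" unfolding c_def using pack_pos[of "cball (0::'a) 2" 1] by simp
  define d where "d = log 2 c"
  have d: "d \<ge> 0" "2 powr d = c" using c by (auto simp: d_def)
  have it: "real (pack r E) \<le> c ^ k * real (pack (2 ^ k * r) E)" if "bounded E" "0 < r" for k r and E :: "'a set"
  proof (induction k)
    case (Suc k)
    have "real (pack (2 ^ k * r) E) \<le> c * real (pack (2 * (2 ^ k * r)) E)"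
      using pack_rescale[of E "2 ^ k * r" 2] that unfolding c_def of_nat_mult[symmetric] of_nat_le_iff by simp
    then have "c ^ k * real (pack (2 ^ k * r) E) \<le> c ^ k * (c * real (pack (2 * (2 ^ k * r)) E))" using c by (intro mult_left_mono) auto
    then show ?case using Suc by (simp add: mult_ac)
  qed simp
  define S where "S = (\<lambda>R::real. 2 * \<bar>R\<bar> + 1)"
  have main: "\<forall>E r. E \<subseteq> cball (0::'a) R \<longrightarrow> 0 < r \<longrightarrow> r \<le> 1 \<longrightarrow> real (pack r E) \<le> c * S R powr d * r powr (-d)" for R
  proof (intro allI impI)
    fix E :: "'a set" and r :: real
    assume E: "E \<subseteq> cball 0 R" and r: "0 < r" "r \<le> 1"
    have bE: "bounded E" using E bounded_cball bounded_subset by blast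
    define k where "k = nat \<lceil>log 2 (S R / r)\<rceil>"
    have S: "S R / r \<ge> 1" using r by (simp add: S_def pos_le_divide_eq)
    then have lg: "0 \<le> log 2 (S R / r)" by simp
    have k: "log 2 (S R / r) \<le> real k" "real k \<le> log 2 (S R / r) + 1" unfolding k_def using lg by linarith+
    have "S R / r = 2 powr (log 2 (S R / r))" using S by simp
    also have "\<dots> \<le> 2 powr (real k)" using k by simp
    also have "\<dots> = 2 ^ k" by (simp add: powr_realpow)
    finally have "S R \<le> 2 ^ k * r" using r by (simp add: pos_divide_le_eq)
    have "pack (2 ^ k * r) E \<le> 1"
    proof -
      obtain D where D: "D \<subseteq> E" "finite D" "separated (2 ^ k * r) D" "card D = pack (2 ^ k * r) E"
        using pack_ex[OF bE, of "2 ^ k * r"] r by auto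
      have "x = y" if "x \<in> D" "y \<in> D" for x y
      proof (rule ccontr)
        assume "x \<noteq> y"
        then have "2 ^ k * r < dist x y" using separatedD[OF D(3) that] by simp
        moreover have "norm x \<le> R" "norm y \<le> R" using that D(1) E by auto
        then have "dist x y \<le> 2 * R" using norm_triangle_ineq4[of x y] by (simp add: dist_norm)
        ultimately show False using \<open>S R \<le> 2 ^ k * r\<close> by (simp add: S_def)
      qed
      then have "card D \<le> 1" using D(2) by (metis card_le_Suc0_iff_eq One_nat_def)
      then show ?thesis using D by simp
    qed
    then have "c ^ k * real (pack (2 ^ k * r) E) \<le> c ^ k * 1" using c by (intro mult_left_mono) auto
    then have "real (pack r E) \<le> c ^ k" using it[OF bE r(1), of k] by simp
    also have "c ^ k = c powr (real k)" using c by (simp add: powr_realpow)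
    also have "\<dots> \<le> c powr (log 2 (S R / r) + 1)" using k c by (intro powr_mono) auto
    also have "\<dots> = c * (2 powr d) powr (log 2 (S R / r))" using c d by (simp add: powr_add)
    also have "(2 powr d) powr (log 2 (S R / r)) = (2 powr (log 2 (S R / r))) powr d" by (simp add: powr_powr mult.commute)
    also have "2 powr (log 2 (S R / r)) = S R / r" using S by simp
    also have "(S R / r) powr d = S R powr d * r powr (-d)" using r by (simp add: S_def powr_divide powr_minus_divide)
    finally show "real (pack r E) \<le> c * S R powr d * r powr (-d)" by simp
  qed
  have pos: "c * S R powr d > 0" for R using c by (simp add: S_def add_nonneg_pos)
  show ?thesis
    by (rule exI[of _ d], rule conjI[OF d(1)], rule allI, rule exI, rule conjI[OF pos main])
qed

section \<open>Growth of the generated ring\<close>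

lemma powr_small:
  assumes "0 < \<alpha>" shows "\<forall>\<^sub>F \<delta> in at_right (0::real). C * \<delta> powr \<alpha> < 1"
proof -
  have "((\<lambda>\<delta>. C * \<delta> powr \<alpha>) \<longlongrightarrow> C * 0) (at_right (0::real))"
  proof (intro tendsto_mult tendsto_const)
    have "((\<lambda>x::real. x powr \<alpha>) \<longlongrightarrow> 0 powr \<alpha>) (at_right 0)"
    proof (rule tendsto_powr')
      have "\<forall>\<^sub>F x in at_right 0. (0::real) \<le> x"
        by (rule eventually_mono[OF eventually_at_right_less]) simp
      then show "(0::real) \<noteq> 0 \<or> 0 < \<alpha> \<and> (\<forall>\<^sub>F x in at_right 0. (0::real) \<le> x)" using assms by simp
    qed (auto intro: tendsto_intros)
    then show "((\<lambda>x::real. x powr \<alpha>) \<longlongrightarrow> 0) (at_right 0)" by simp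
  qed
  then show ?thesis by (rule order_tendstoD) simp
qed

lemma ringgen_subset_cball:
  fixes A :: "(real^'n) set"
  assumes "\<And>b i. b \<in> ringgen A k \<Longrightarrow> \<bar>b $ i\<bar> \<le> R"
  shows "ringgen A k \<subseteq> cball 0 (real CARD('n) * R)" "bounded (ringgen A k)"
proof -
  show "ringgen A k \<subseteq> cball 0 (real CARD('n) * R)" using norm_le_card_mult[OF assms] by auto
  then show "bounded (ringgen A k)" using bounded_cball bounded_subset by blast
qed

text \<open>Along levels spaced by \<open>M\<close>, some step multiplies the packing number by at
  most \<open>\<delta> powr (-(\<eta> / 2))\<close>, since otherwise the polynomial bound would be
  exceeded. Because this is arranged for the whole set, one level \<open>k\<close> serves all
  coordinates: \<open>pack_fibre\<close> makes every projection a chain to which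
  \<open>discretized_ring\<close> applies.\<close>

lemma ring_full:
  fixes \<kappa> \<tau> \<nu> :: real
  assumes \<kappa>: "0 < \<kappa>" "\<kappa> \<le> 1" and \<tau>: "0 < \<tau>" and \<nu>: "0 < \<nu>"
  shows "\<exists>kmax. \<exists>\<epsilon>0>0. \<exists>\<delta>0>0. \<forall>\<delta> (A :: (real^'n) set). 0 < \<delta> \<longrightarrow> \<delta> < \<delta>0 \<longrightarrow>
    (\<forall>a\<in>A. \<forall>i. \<bar>a $ i\<bar> \<le> 2) \<longrightarrow>
    (\<forall>j \<rho>. \<delta> \<le> \<rho> \<longrightarrow> \<rho> \<le> 1 \<longrightarrow> \<rho> powr (-\<kappa>) \<le> \<delta> powr (-\<epsilon>0) * real (pack \<rho> (proj j A))) \<longrightarrow>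
    (\<exists>k\<le>kmax. (\<forall>j. \<delta> powr (-1 + \<tau>) \<le> real (pack \<delta> (proj j (ringgen A k)))) \<and>
       real (pack \<delta> (ringgen A (k + 3))) \<le> \<delta> powr (-\<nu>) * real (pack \<delta> (ringgen A k)))"
proof -
  obtain \<eta>0 where \<eta>0: "\<eta>0 > 0" and DR: "\<forall>\<eta>. 0 < \<eta> \<longrightarrow> \<eta> \<le> \<eta>0 \<longrightarrow> (\<exists>m. \<forall>R\<ge>1. \<exists>\<delta>0>0. \<forall>\<delta> (Z :: nat \<Rightarrow> real set).
    0 < \<delta> \<longrightarrow> \<delta> < \<delta>0 \<longrightarrow> 0 \<in> Z 0 \<longrightarrow> 1 \<in> Z 0 \<longrightarrow>
    (\<forall>l x y z w. x \<in> Z l \<longrightarrow> y \<in> Z l \<longrightarrow> z \<in> Z l \<longrightarrow> w \<in> Z l \<longrightarrow> x * y - z * w \<in> Z (Suc l)) \<longrightarrow>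
    Z m \<subseteq> {-R..R} \<longrightarrow>
    (\<forall>\<rho>. \<delta> \<le> \<rho> \<longrightarrow> \<rho> \<le> 1 \<longrightarrow> real (pack \<rho> (Z m)) \<le> \<delta> powr (-\<eta>) * real (pack \<rho> (Z 0))) \<longrightarrow>
    (\<forall>\<rho>. \<delta> \<le> \<rho> \<longrightarrow> \<rho> \<le> 1 \<longrightarrow> \<rho> powr (-\<kappa>) \<le> \<delta> powr (-\<eta>) * real (pack \<rho> (Z 0))) \<longrightarrow>
    \<delta> powr (-1 + \<tau>) \<le> real (pack \<delta> (Z 0)))"
    using discretized_ring[OF \<kappa> \<tau>] by (elim exE conjE)
  define \<eta> where "\<eta> = min \<eta>0 \<nu>"
  have \<eta>: "0 < \<eta>" "\<eta> \<le> \<eta>0" "\<eta> \<le> \<nu>" using \<eta>0 \<nu> by (auto simp: \<eta>_def)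
  obtain m where m: "\<forall>R\<ge>1. \<exists>\<delta>0>0. \<forall>\<delta> (Z :: nat \<Rightarrow> real set).
    0 < \<delta> \<longrightarrow> \<delta> < \<delta>0 \<longrightarrow> 0 \<in> Z 0 \<longrightarrow> 1 \<in> Z 0 \<longrightarrow>
    (\<forall>l x y z w. x \<in> Z l \<longrightarrow> y \<in> Z l \<longrightarrow> z \<in> Z l \<longrightarrow> w \<in> Z l \<longrightarrow> x * y - z * w \<in> Z (Suc l)) \<longrightarrow>
    Z m \<subseteq> {-R..R} \<longrightarrow>
    (\<forall>\<rho>. \<delta> \<le> \<rho> \<longrightarrow> \<rho> \<le> 1 \<longrightarrow> real (pack \<rho> (Z m)) \<le> \<delta> powr (-\<eta>) * real (pack \<rho> (Z 0))) \<longrightarrow>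
    (\<forall>\<rho>. \<delta> \<le> \<rho> \<longrightarrow> \<rho> \<le> 1 \<longrightarrow> \<rho> powr (-\<kappa>) \<le> \<delta> powr (-\<eta>) * real (pack \<rho> (Z 0))) \<longrightarrow>
    \<delta> powr (-1 + \<tau>) \<le> real (pack \<delta> (Z 0))"
    using DR[rule_format, OF \<eta>(1,2)] by (elim exE)
  \<comment> \<open>The chain uses \<open>m\<close> levels; adding an element of level
    \<open>k\<close> takes two more, and three are needed for the level \<open>k + 3\<close> in the
    conclusion.\<close>
  define M where "M = m + 3"
  obtain d where d: "d \<ge> 0" and PB: "\<forall>R. \<exists>C>0. \<forall>E r. E \<subseteq> cball (0::real^'n) R \<longrightarrow> 0 < r \<longrightarrow> r \<le> 1 \<longrightarrow> real (pack r E) \<le> C * r powr (-d)"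
    using pack_polynomial_bound[where 'a = "real^'n"] by (elim exE conjE)
  define I where "I = nat \<lceil>2 * (d + 1) / \<eta>\<rceil>"
  have I: "d + 1 \<le> real I * (\<eta> / 2)"
  proof -
    have "2 * (d + 1) / \<eta> \<le> real I" unfolding I_def by linarith
    then show ?thesis using \<eta> by (simp add: pos_divide_le_eq)
  qed
  define kmax where "kmax = I * M"
  obtain R where R: "R \<ge> 1" and
    RB: "\<forall>A::(real^'n) set. (\<forall>a\<in>A. \<forall>i. \<bar>a $ i\<bar> \<le> 2) \<longrightarrow> (\<forall>b\<in>ringgen A (kmax + M). \<forall>i. \<bar>b $ i\<bar> \<le> R)"
    using ringgen_bounded[of "kmax + M", where 'n = 'n] by (elim exE conjE)
  obtain C where C: "C > 0" "\<forall>E r. E \<subseteq> cball (0::real^'n) (real CARD('n) * R) \<longrightarrow> 0 < r \<longrightarrow> r \<le> 1 \<longrightarrow> real (pack r E) \<le> C * r powr (-d)"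
    using spec[OF PB, of "real CARD('n) * R"] by (elim exE conjE)
  obtain \<delta>1 where \<delta>1: "\<delta>1 > 0" "\<forall>\<delta> (Z :: nat \<Rightarrow> real set).
    0 < \<delta> \<longrightarrow> \<delta> < \<delta>1 \<longrightarrow> 0 \<in> Z 0 \<longrightarrow> 1 \<in> Z 0 \<longrightarrow>
    (\<forall>l x y z w. x \<in> Z l \<longrightarrow> y \<in> Z l \<longrightarrow> z \<in> Z l \<longrightarrow> w \<in> Z l \<longrightarrow> x * y - z * w \<in> Z (Suc l)) \<longrightarrow>
    Z m \<subseteq> {-R..R} \<longrightarrow>
    (\<forall>\<rho>. \<delta> \<le> \<rho> \<longrightarrow> \<rho> \<le> 1 \<longrightarrow> real (pack \<rho> (Z m)) \<le> \<delta> powr (-\<eta>) * real (pack \<rho> (Z 0))) \<longrightarrow>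
    (\<forall>\<rho>. \<delta> \<le> \<rho> \<longrightarrow> \<rho> \<le> 1 \<longrightarrow> \<rho> powr (-\<kappa>) \<le> \<delta> powr (-\<eta>) * real (pack \<rho> (Z 0))) \<longrightarrow>
    \<delta> powr (-1 + \<tau>) \<le> real (pack \<delta> (Z 0))"
    using m[rule_format, OF R] by (elim exE conjE)
  have "\<forall>\<^sub>F \<delta> in at_right (0::real). 9 * \<delta> powr (\<eta> / 2) < 1 \<and> C * \<delta> powr 1 < 1 \<and> 1 * \<delta> powr 1 < 1"
    by (intro eventually_conj powr_small) (use \<eta> in auto)
  then obtain \<delta>2 where \<delta>2: "\<delta>2 > 0" "\<And>\<delta>. 0 < \<delta> \<Longrightarrow> \<delta> < \<delta>2 \<Longrightarrow> 9 * \<delta> powr (\<eta> / 2) < 1 \<and> C * \<delta> powr 1 < 1 \<and> 1 * \<delta> powr 1 < 1"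
    unfolding eventually_at_right_field by auto
  have main: "\<exists>k\<le>kmax. (\<forall>j. \<delta> powr (-1 + \<tau>) \<le> real (pack \<delta> (proj j (ringgen A k)))) \<and>
       real (pack \<delta> (ringgen A (k + 3))) \<le> \<delta> powr (-\<nu>) * real (pack \<delta> (ringgen A k))"
    if \<delta>: "0 < \<delta>" "\<delta> < min \<delta>1 \<delta>2" and A: "\<forall>a\<in>A. \<forall>i. \<bar>a $ i\<bar> \<le> 2"
      and nc: "\<forall>j \<rho>. \<delta> \<le> \<rho> \<longrightarrow> \<rho> \<le> 1 \<longrightarrow> \<rho> powr (-\<kappa>) \<le> \<delta> powr (-\<eta>) * real (pack \<rho> (proj j A))"
    for \<delta> and A :: "(real^'n) set"
  proof -
    have small: "9 * \<delta> powr (\<eta> / 2) < 1" "C * \<delta> < 1" "\<delta> < 1" using \<delta>2(2)[of \<delta>] \<delta> by auto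
    have bR: "\<bar>b $ i\<bar> \<le> R" if "b \<in> ringgen A k" "k \<le> kmax + M" for b i k
      using RB A ringgen_mono[OF that] by blast
    have bdd: "bounded (ringgen A k)" if "k \<le> kmax + M" for k
      by (rule ringgen_subset_cball(2)[of A k R]) (rule bR[OF _ that])
    let ?V = "\<lambda>i. real (pack \<delta> (ringgen A (i * M)))"
    have "\<exists>i<I. ?V (Suc i) \<le> \<delta> powr (-(\<eta> / 2)) * ?V i"
    proof (rule ccontr)
      assume "\<not> ?thesis"
      then have big: "\<delta> powr (-(\<eta> / 2)) * ?V i \<le> ?V (Suc i)" if "i < I" for i
        using that by (meson less_imp_le not_le)
      have it: "\<delta> powr (-(real i * (\<eta> / 2))) \<le> ?V i" if "i \<le> I" for i
        using that
      proof (induction i)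
        case 0
        have "pack \<delta> (ringgen A 0) \<ge> 1" by (rule pack_pos[OF bdd \<delta>(1)]) auto
        then show ?case using \<delta> by simp
      next
        case (Suc i)
        have "\<delta> powr (-(real (Suc i) * (\<eta> / 2))) = \<delta> powr (-(\<eta> / 2)) * \<delta> powr (-(real i * (\<eta> / 2)))"
        proof -
          have "-(real (Suc i) * (\<eta> / 2)) = -(\<eta> / 2) + -(real i * (\<eta> / 2))"
            by (simp add: distrib_right add_divide_distrib)
          then show ?thesis by (simp only: powr_add)
        qed
        also have "\<dots> \<le> \<delta> powr (-(\<eta> / 2)) * ?V i" using Suc by (intro mult_left_mono) auto
        also have "\<dots> \<le> ?V (Suc i)" using Suc.prems by (intro big) auto
        finally show ?case .
      qed
      have "\<delta> powr (-(d + 1)) \<le> \<delta> powr (-(real I * (\<eta> / 2)))" using I \<delta> small by (intro powr_mono') auto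
      also have "\<dots> \<le> ?V I" by (rule it) simp
      also have "\<dots> \<le> C * \<delta> powr (-d)"
      proof (rule C(2)[rule_format])
        show "ringgen A (I * M) \<subseteq> cball 0 (real CARD('n) * R)"
          by (rule ringgen_subset_cball(1)) (rule bR, auto simp: kmax_def)
      qed (use \<delta> small in auto)
      finally have "\<delta> powr (-(d + 1)) * \<delta> powr (d + 1) \<le> C * \<delta> powr (-d) * \<delta> powr (d + 1)"
        by (intro mult_right_mono) auto
      moreover have "C * \<delta> powr (-d) * \<delta> powr (d + 1) = C * \<delta> powr 1" by (simp add: powr_add[symmetric])
      moreover have "\<delta> powr (-(d + 1)) * \<delta> powr (d + 1) = 1" using \<delta> by (simp add: powr_add[symmetric])
      ultimately show False using small \<delta> by simp
    qed
    then obtain i where i: "i < I" "?V (Suc i) \<le> \<delta> powr (-(\<eta> / 2)) * ?V i" by blast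
    define k where "k = i * M"
    have kM: "k + M \<le> kmax" using mult_le_mono1[of "Suc i" I M] i(1) by (simp add: k_def kmax_def)
    have grow: "real (pack \<delta> (ringgen A (k + M))) \<le> \<delta> powr (-(\<eta> / 2)) * real (pack \<delta> (ringgen A k))"
      using i(2) by (simp add: k_def add.commute)
    have sub: "ringgen A (k + l) \<subseteq> ringgen A (k + l')" if "l \<le> l'" for l l' using ringgen_mono that by (meson add_le_mono le_refl subsetI)
    have N0: "real (pack \<delta> (ringgen A k)) \<ge> 1"
      using pack_pos[OF bdd \<delta>(1), of k] ringgen_0_1[of A k] kM by fastforce
    have full: "\<delta> powr (-1 + \<tau>) \<le> real (pack \<delta> (proj j (ringgen A k)))" for j
    proof -
      define Z where "Z = (\<lambda>l. (\<lambda>x. x $ j) ` ringgen A (k + l))"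
      have "\<delta> powr (-1 + \<tau>) \<le> real (pack \<delta> (Z 0))"
      proof (rule \<delta>1(2)[rule_format])
        show "0 < \<delta>" "\<delta> < \<delta>1" using \<delta> by auto
        show "0 \<in> Z 0" "1 \<in> Z 0"
          unfolding Z_def using ringgen_0_1[of A "k + 0"] by (force intro: image_eqI[of _ _ 0], force intro: image_eqI[of _ _ 1])
        show "x * y - z * w \<in> Z (Suc l)" if "x \<in> Z l" "y \<in> Z l" "z \<in> Z l" "w \<in> Z l" for l x y z w
        proof -
          obtain x' y' z' w' where v: "x' \<in> ringgen A (k + l)" "y' \<in> ringgen A (k + l)" "z' \<in> ringgen A (k + l)" "w' \<in> ringgen A (k + l)"
            "x = x' $ j" "y = y' $ j" "z = z' $ j" "w = w' $ j" using \<open>x \<in> Z l\<close> \<open>y \<in> Z l\<close> \<open>z \<in> Z l\<close> \<open>w \<in> Z l\<close> unfolding Z_def by blast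
          have "x' * y' - z' * w' \<in> ringgen A (k + Suc l)" using ringgen_step[OF v(1-4)] by simp
          then show ?thesis unfolding Z_def using v(5-8) by (intro image_eqI[of _ _ "x' * y' - z' * w'"]) auto
        qed
        show "Z m \<subseteq> {-R..R}"
        proof
          fix t assume "t \<in> Z m"
          then obtain x where "x \<in> ringgen A (k + m)" "t = x $ j" unfolding Z_def by blast
          then have "\<bar>t\<bar> \<le> R" using bR[of x "k + m" j] kM by (simp add: M_def)
          then show "t \<in> {-R..R}" by (auto simp: abs_le_iff)
        qed
        fix \<rho> assume \<rho>: "\<delta> \<le> \<rho>" "\<rho> \<le> 1"
        have A0: "A \<subseteq> ringgen A k" using ringgen_mono[of _ A 0 k] by auto
        have bZ: "bounded (Z l)" if "l \<le> M" for l
          unfolding Z_def by (rule bounded_linear_image[OF vec_nth_le_norm bdd]) (use kM that in simp)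
        have "real (pack \<rho> (proj j A)) \<le> real (pack \<rho> (Z 0))"
          unfolding of_nat_le_iff by (rule pack_mono[OF bZ]) (use \<rho> \<delta> A0 in \<open>auto simp: Z_def\<close>)
        then have "\<delta> powr (-\<eta>) * real (pack \<rho> (proj j A)) \<le> \<delta> powr (-\<eta>) * real (pack \<rho> (Z 0))"
          by (intro mult_left_mono) auto
        then show "\<rho> powr (-\<kappa>) \<le> \<delta> powr (-\<eta>) * real (pack \<rho> (Z 0))" using nc \<rho> by (meson order_trans)
        have plus: "ringgen A (k + m) + ringgen A k \<subseteq> ringgen A (k + M)"
        proof
          fix v assume "v \<in> ringgen A (k + m) + ringgen A k"
          then obtain x y where xy: "x \<in> ringgen A (k + m)" "y \<in> ringgen A k" "v = x + y" by (auto simp: set_plus_def)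
          have "x + y \<in> ringgen A (Suc (Suc (k + m)))" by (rule ringgen_add[OF xy(1) ringgen_mono[OF xy(2)]]) simp
          then show "v \<in> ringgen A (k + M)" unfolding xy(3) by (rule ringgen_mono) (simp add: M_def)
        qed
        \<comment> \<open>The growth bound is known only at scale \<open>\<delta>\<close> and for
          the full set; the fibre inequality turns it into a bound on the projection at scale
          \<open>\<rho>\<close>.\<close>
        have "real (pack (4 * \<rho>) (Z m) * pack \<delta> (ringgen A k)) \<le> real (pack \<rho> (Z 0) * pack \<delta> (ringgen A (k + m) + ringgen A k))"
          unfolding of_nat_le_iff Z_def add_0_right
          by (rule pack_fibre[OF linear_vec_nth vec_nth_le_norm bdd bdd \<delta>(1)]) (use kM \<rho> \<delta> in \<open>auto simp: M_def\<close>)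
        also have "\<dots> \<le> real (pack \<rho> (Z 0)) * (\<delta> powr (-(\<eta> / 2)) * real (pack \<delta> (ringgen A k)))"
        proof -
          have "real (pack \<delta> (ringgen A (k + m) + ringgen A k)) \<le> real (pack \<delta> (ringgen A (k + M)))"
            unfolding of_nat_le_iff by (rule pack_mono[OF bdd \<delta>(1) plus]) (use kM in simp)
          then show ?thesis using grow by (simp add: mult_left_mono)
        qed
        finally have "real (pack (4 * \<rho>) (Z m)) * real (pack \<delta> (ringgen A k)) \<le> (\<delta> powr (-(\<eta> / 2)) * real (pack \<rho> (Z 0))) * real (pack \<delta> (ringgen A k))"
          by (simp add: mult_ac)
        then have f: "real (pack (4 * \<rho>) (Z m)) \<le> \<delta> powr (-(\<eta> / 2)) * real (pack \<rho> (Z 0))"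
          by (rule mult_right_le_imp_le) (use N0 in linarith)
        have "real (pack \<rho> (Z m)) \<le> 9 * real (pack (4 * \<rho>) (Z m))"
          using pack_rescale_real[OF bZ, of m \<rho> 4] \<rho> \<delta> by (simp add: M_def)
        also have "\<dots> \<le> 9 * (\<delta> powr (-(\<eta> / 2)) * real (pack \<rho> (Z 0)))" using f by simp
        also have "\<dots> = (9 * \<delta> powr (-(\<eta> / 2))) * real (pack \<rho> (Z 0))" by simp
        also have "\<dots> \<le> \<delta> powr (-\<eta>) * real (pack \<rho> (Z 0))"
        proof (rule mult_right_mono)
          have "\<delta> powr (-\<eta>) = \<delta> powr (-(\<eta> / 2)) * \<delta> powr (-(\<eta> / 2))" by (simp add: powr_add[symmetric])
          moreover have "9 \<le> \<delta> powr (-(\<eta> / 2))" using small(1) \<delta> by (simp add: powr_minus_divide pos_le_divide_eq)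
          ultimately show "9 * \<delta> powr (-(\<eta> / 2)) \<le> \<delta> powr (-\<eta>)" by (simp add: mult_right_mono)
        qed simp
        finally show "real (pack \<rho> (Z m)) \<le> \<delta> powr (-\<eta>) * real (pack \<rho> (Z 0))" .
      qed
      then show ?thesis by (simp add: Z_def)
    qed
    have "real (pack \<delta> (ringgen A (k + 3))) \<le> real (pack \<delta> (ringgen A (k + M)))"
      unfolding of_nat_le_iff by (rule pack_mono[OF bdd \<delta>(1) sub]) (use kM in \<open>auto simp: M_def\<close>)
    also have "\<dots> \<le> \<delta> powr (-\<nu>) * real (pack \<delta> (ringgen A k))"
    proof -
      have "\<delta> powr (-(\<eta> / 2)) \<le> \<delta> powr (-\<nu>)" using \<eta> \<delta> small by (intro powr_mono') auto
      then have "\<delta> powr (-(\<eta> / 2)) * real (pack \<delta> (ringgen A k)) \<le> \<delta> powr (-\<nu>) * real (pack \<delta> (ringgen A k))" by (intro mult_right_mono) auto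
      then show ?thesis using grow by linarith
    qed
    finally show ?thesis using full kM by (intro exI[of _ k]) auto
  qed
  show ?thesis
    by (rule exI[of _ kmax], rule exI[of _ \<eta>], rule conjI[OF \<eta>(1)], rule exI[of _ "min \<delta>1 \<delta>2"], rule conjI)
      (use \<delta>1(1) \<delta>2(1) main in auto)
qed

section \<open>Almost full projections of \<open>X\<close> under the action of the ring\<close>

text \<open>The energy count with multipliers from the \<open>j\<close>-th projection of
  \<open>W\<close>, acting on that of \<open>X\<close>. The cost in the projection is read off from
  \<open>grow\<close> by \<open>pack_fibre\<close>, whose extra summand is the reason for the second
  \<open>X\<close> there. The two conditions \<open>big\<close> make the near pairs and the diagonal
  negligible, so distant pairs dominate.\<close>

lemma module_projection_large:
  fixes X W :: "(real^'n) set"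
  assumes bd: "bounded X" "X \<noteq> {}" "bounded W" and W: "1 \<in> W" "\<And>t. t \<in> W \<Longrightarrow> \<bar>t $ j\<bar> \<le> R" "1 \<le> R"
    and \<delta>: "0 < \<delta>" "\<delta> \<le> r0" "r0 \<le> 1" and H: "1 \<le> H"
    and grow: "\<And>t. t \<in> W \<Longrightarrow> real (pack \<delta> ((X + (*) t ` X) + X)) \<le> H * real (pack \<delta> X)"
    and big: "12000 * R * H\<^sup>2 \<le> \<delta> * real (pack \<delta> (proj j W)) * real (pack (4 * r0) (proj j X))"
      "180 * H \<le> real (pack \<delta> (proj j X))"
  shows "real (pack \<delta> (proj j W)) * r0 \<le> 90 * H * real (pack \<delta> (proj j X))"
proof -
  define Z where "Z = (\<lambda>x. x $ j) ` X"
  define Y where "Y = (\<lambda>x. x $ j) ` W"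
  have bZ: "bounded Z" unfolding Z_def by (rule bounded_linear_image[OF vec_nth_le_norm bd(1)])
  have bY: "bounded Y" unfolding Y_def by (rule bounded_linear_image[OF vec_nth_le_norm bd(3)])
  have NX: "real (pack \<delta> X) \<ge> 1" using pack_pos[OF bd(1) \<delta>(1) bd(2)] by simp
  obtain T where T: "T \<subseteq> Y" "finite T" "separated \<delta> T" "card T = pack \<delta> Y" using pack_ex[OF bY \<delta>(1)] by blast
  obtain D where D: "D \<subseteq> Z" "finite D" "separated \<delta> D" "card D = pack \<delta> Z" using pack_ex[OF bZ \<delta>(1)] by blast
  define N where "N = real (pack \<delta> Z)"
  define M where "M = real (pack \<delta> Y)"
  define B where "B = real (pack (4 * r0) Z)"
  have N: "180 * H \<le> N" "N > 0" using big(2) H by (simp_all add: N_def Z_def)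
  have MB: "12000 * R * H\<^sup>2 \<le> \<delta> * M * B" using big(1) by (simp add: M_def B_def Y_def Z_def)
  have "0 < 12000 * R * H\<^sup>2" using W H by simp
  then have "0 < \<delta> * M * B" using MB by linarith
  then have MB0: "M > 0" "B > 0" using \<delta> by (auto simp: M_def B_def zero_less_mult_iff)
  have bXt: "bounded (X + (*) t ` X)" if "t \<in> W" for t
  proof -
    obtain S where S: "\<forall>x\<in>W. norm x \<le> S" using bd(3) bounded_iff by blast
    obtain S' where S': "\<forall>x\<in>X. norm x \<le> S'" using bd(1) bounded_iff by blast
    have "norm (t * x) \<le> S * S'" if "x \<in> X" for x
    proof -
      have "\<bar>t $ i\<bar> \<le> S" for i using S \<open>t \<in> W\<close> vec_nth_le_norm[of t i] by force
      then have "norm (t * x) \<le> S * norm x" by (rule norm_mult_vec_le)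
      also have "\<dots> \<le> S * S'"
      proof (rule mult_left_mono)
        show "norm x \<le> S'" using S' that by blast
        show "0 \<le> S" using S W(1) norm_ge_zero order_trans by blast
      qed
      finally show ?thesis .
    qed
    then have "bounded ((*) t ` X)" by (auto simp: bounded_iff)
    then show ?thesis by (rule bounded_set_plus[OF bd(1)])
  qed
  have cost: "real (pack \<delta> (Z + (*) s ` Z)) \<le> 9 * H * N" if s: "s \<in> Y" for s
  proof -
    obtain t where t: "t \<in> W" "s = t $ j" using s by (auto simp: Y_def)
    have im: "Z + (*) s ` Z = (\<lambda>x. x $ j) ` (X + (*) t ` X)"
    proof (intro equalityI subsetI)
      fix v assume "v \<in> Z + (*) s ` Z"
      then obtain x y where "x \<in> X" "y \<in> X" "v = x $ j + s * y $ j" by (auto simp: Z_def set_plus_def)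
      then show "v \<in> (\<lambda>x. x $ j) ` (X + (*) t ` X)" using t by (intro image_eqI[of _ _ "x + t * y"]) (auto simp: set_plus_def)
    next
      fix v assume "v \<in> (\<lambda>x. x $ j) ` (X + (*) t ` X)"
      then obtain w where w: "w \<in> X + (*) t ` X" "v = w $ j" by blast
      then obtain x y where "x \<in> X" "y \<in> X" "w = x + t * y" by (auto simp: set_plus_def)
      then show "v \<in> Z + (*) s ` Z" using t w by (auto simp: Z_def set_plus_def)
    qed
    have bS: "bounded (Z + (*) s ` Z)" unfolding im by (rule bounded_linear_image[OF vec_nth_le_norm bXt[OF t(1)]])
    have "pack (4 * \<delta>) ((\<lambda>x. x $ j) ` (X + (*) t ` X)) * pack \<delta> X \<le> pack \<delta> (proj j X) * pack \<delta> ((X + (*) t ` X) + X)"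
      by (rule pack_fibre[OF linear_vec_nth vec_nth_le_norm bd(1) bXt[OF t(1)] \<delta>(1)]) (use \<delta> in simp)
    then have "real (pack (4 * \<delta>) (Z + (*) s ` Z) * pack \<delta> X) \<le> real (pack \<delta> Z * pack \<delta> ((X + (*) t ` X) + X))"
      unfolding of_nat_le_iff im by (simp only: Z_def)
    also have "\<dots> \<le> N * (H * real (pack \<delta> X))" unfolding of_nat_mult N_def using grow[OF t(1)] by (intro mult_left_mono) auto
    finally have "real (pack (4 * \<delta>) (Z + (*) s ` Z)) * real (pack \<delta> X) \<le> (H * N) * real (pack \<delta> X)" by (simp add: mult_ac)
    then have "real (pack (4 * \<delta>) (Z + (*) s ` Z)) \<le> H * N" by (rule mult_right_le_imp_le) (use NX in linarith)
    then show ?thesis using pack_rescale_real[OF bS \<delta>(1), of 4] by simp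
  qed
  have F: "real (card {y' \<in> D. \<bar>y' - y\<bar> \<le> r0}) \<le> 9 * H * N / B" for y
  proof -
    have "real (pack (4 * r0) ((\<lambda>x. x) ` Z) * card {x \<in> D. \<bar>x - y\<bar> \<le> r0}) \<le> real (pack \<delta> (Z + Z))"
      unfolding of_nat_le_iff
      by (rule card_slab_le[OF _ _ bZ \<delta>(1) _ D(1,3)]) (use \<delta> in \<open>auto simp: linear_ident\<close>)
    also have "\<dots> \<le> 9 * H * N"
    proof -
      have "1 \<in> Y" using W(1) unfolding Y_def by (intro image_eqI[of _ _ 1]) auto
      from cost[OF this] show ?thesis by simp
    qed
    finally show ?thesis using MB0 by (simp add: B_def pos_le_divide_eq mult.commute)
  qed
  have "real (card T) * real (card D) \<le>
      (9 * H) * (5 * real (card T) + 35 * R * (9 * H * N / B) / \<delta> + 5 * (real (card D))\<^sup>2 / r0)"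
  proof (rule energy_bound[OF bZ \<delta>(1,2,3) W(3) _ T(2) _ T(3) D(1-4) _ _ F])
    show "0 < 9 * H" using H by simp
    show "T \<subseteq> {-R..R}"
    proof
      fix s assume "s \<in> T"
      then obtain t where "t \<in> W" "s = t $ j" using T(1) by (auto simp: Y_def)
      then have "\<bar>s\<bar> \<le> R" using W(2) by simp
      then show "s \<in> {-R..R}" by (auto simp: abs_le_iff)
    qed
    show "D \<noteq> {}" using D(4) N by (auto simp: N_def)
    show "real (pack \<delta> (Z + (*) t ` Z)) \<le> 9 * H * real (pack \<delta> Z)" if "t \<in> T" for t
      using cost[of t] that T(1) by (auto simp: N_def)
  qed
  then have en: "M * N \<le> (9 * H) * (5 * M) + (9 * H) * (35 * R * (9 * H * N / B) / \<delta>) + (9 * H) * (5 * N\<^sup>2 / r0)"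
    using T(4) D(4) by (simp add: M_def N_def distrib_left)
  have t1: "(9 * H) * (5 * M) \<le> M * N / 4"
    using mult_left_mono[OF N(1), of M] MB0 by (simp add: mult_ac)
  have t2: "(9 * H) * (35 * R * (9 * H * N / B) / \<delta>) \<le> M * N / 4"
  proof -
    have "(9 * H) * (35 * R * (9 * H * N / B) / \<delta>) = (2835 * R * H\<^sup>2) * N / (\<delta> * B)" by (simp add: power2_eq_square mult_ac)
    also have "\<dots> \<le> (\<delta> * M * B / 4) * N / (\<delta> * B)"
    proof -
      have "2835 * R * H\<^sup>2 \<le> 3000 * R * H\<^sup>2" using W(3) by (intro mult_right_mono) auto
      also have "\<dots> \<le> \<delta> * M * B / 4" using MB by simp
      finally show ?thesis using N MB0 \<delta> by (intro divide_right_mono mult_right_mono) auto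
    qed
    also have "\<dots> = M * N / 4" using MB0 \<delta> by simp
    finally show ?thesis .
  qed
  have "M * N \<le> 2 * ((9 * H) * (5 * N\<^sup>2 / r0))" using en t1 t2 by linarith
  then have "M * N \<le> (90 * H * N / r0) * N" by (simp add: power2_eq_square mult_ac)
  then have "M \<le> 90 * H * N / r0" by (rule mult_right_le_imp_le) (rule N)
  then show ?thesis using \<delta> by (simp add: pos_le_divide_eq M_def N_def Y_def Z_def)
qed

section \<open>Sums of dilates: upper bound from Pluennecke, lower bound from diagonal
  dominance\<close>

definition lsum :: "(real^'n) set \<Rightarrow> (real^'n) list \<Rightarrow> (real^'n) set" where
  "lsum X bs = foldr (\<lambda>b S. (*) b ` X + S) bs {0}"

lemma acov_lsum:
  assumes "\<And>b. b \<in> set bs \<Longrightarrow> acov X \<delta> h L e ((*) b ` X)"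
  shows "acov X \<delta> (length bs * h) (L ^ length bs) (real (length bs) * e) (lsum X bs)"
  using assms
proof (induction bs)
  case Nil then show ?case using acov_zero[of X \<delta>] by (simp add: lsum_def)
next
  case (Cons b bs)
  have "acov X \<delta> (h + length bs * h) (L * L ^ length bs) (e + real (length bs) * e) ((*) b ` X + lsum X bs)"
    using Cons by (intro acov_plus) auto
  then show ?case by (simp add: lsum_def algebra_simps)
qed

lemma sum_list_in_lsum:
  assumes "\<And>i. i \<in> set xs \<Longrightarrow> x i \<in> X"
  shows "sum_list (map (\<lambda>i. u i * x i) xs) \<in> lsum X (map u xs)"
  using assms by (induction xs) (auto simp: lsum_def intro!: set_plus_intro)

lemma bounded_mult_image:
  fixes X :: "(real^'n) set"
  assumes "bounded X" shows "bounded ((*) b ` X)"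
proof -
  obtain B where B: "\<forall>x\<in>X. norm x \<le> B" using assms bounded_iff by blast
  have "norm (b * x) \<le> norm b * B" if "x \<in> X" for x
    using norm_mult_vec_le[of b "norm b" x] vec_nth_le_norm[of b] B that
    by (meson mult_left_mono norm_ge_zero order_trans)
  then show ?thesis by (auto simp: bounded_iff)
qed

lemma bounded_lsum: "bounded X \<Longrightarrow> bounded (lsum X bs)"
  by (induction bs) (auto simp: lsum_def intro!: bounded_set_plus bounded_mult_image)

text \<open>Covering each dilate by translates of \<open>ddiff h X\<close> covers the whole sum by
  translates of \<open>ddiff (n * h) X\<close>, which \<open>pack_ddiff_le\<close> bounds.
  \<open>C\<close> and \<open>q\<close> depend on the number of dilates and the ring level, not on
  the sets.\<close>

lemma pack_lsum_le:
  "\<exists>C\<ge>0. \<exists>q. \<forall>(X::(real^'n) set) A \<delta> K bs. bounded X \<longrightarrow> X \<noteq> {} \<longrightarrow> \<delta> > 0 \<longrightarrow> K \<ge> 1 \<longrightarrow>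
     (\<forall>a\<in>A. \<forall>i. \<bar>a $ i\<bar> \<le> 2) \<longrightarrow>
     (\<forall>a\<in>A. real (pack \<delta> ((*) a ` X + X)) \<le> K * real (pack \<delta> X)) \<longrightarrow>
     real (pack \<delta> (X + X)) \<le> K * real (pack \<delta> X) \<longrightarrow> length bs = n \<longrightarrow> set bs \<subseteq> ringgen A k \<longrightarrow>
     real (pack \<delta> (lsum X bs)) \<le> C * K ^ q * real (pack \<delta> X)"
proof -
  obtain h p e where e: "e \<ge> 0" and AC: "\<forall>(X::(real^'n) set) A \<delta> K. bounded X \<longrightarrow> X \<noteq> {} \<longrightarrow> \<delta> > 0 \<longrightarrow> K \<ge> 1 \<longrightarrow>
     (\<forall>a\<in>A. \<forall>i. \<bar>a $ i\<bar> \<le> 2) \<longrightarrow>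
     (\<forall>a\<in>A. real (pack \<delta> ((*) a ` X + X)) \<le> K * real (pack \<delta> X)) \<longrightarrow>
     (\<forall>b\<in>ringgen A k. acov X \<delta> h (K ^ p) e ((*) b ` X))"
    using acov_ringgen[of k, where 'n = 'n] by (elim exE conjE)
  obtain C where C: "C \<ge> 0" and PD: "\<forall>(X::(real^'n) set) \<delta> K. bounded X \<longrightarrow> X \<noteq> {} \<longrightarrow> \<delta> > 0 \<longrightarrow> 0 \<le> K \<longrightarrow>
     real (pack \<delta> (X + X)) \<le> K * real (pack \<delta> X) \<longrightarrow>
     real (pack \<delta> (ddiff (n * h) X)) \<le> C * K ^ (2 * (n * h)) * real (pack \<delta> X)"
    using pack_ddiff_le[of "n * h", where 'a = "real^'n"] by (elim exE conjE)
  define c where "c = real (pack 1 (cball (0::real^'n) (real n * e + 1)))"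
  have main: "real (pack \<delta> (lsum X bs)) \<le> c * C * K ^ (p * n + 2 * (n * h)) * real (pack \<delta> X)"
    if hyp: "bounded X" "X \<noteq> {}" "\<delta> > 0" "K \<ge> 1" "\<forall>a\<in>A. \<forall>i. \<bar>a $ i\<bar> \<le> 2"
      "\<forall>a\<in>A. real (pack \<delta> ((*) a ` X + X)) \<le> K * real (pack \<delta> X)"
      "real (pack \<delta> (X + X)) \<le> K * real (pack \<delta> X)" "length bs = n" "set bs \<subseteq> ringgen A k"
    for X :: "(real^'n) set" and A \<delta> K bs
  proof -
    have AC': "\<forall>b\<in>ringgen A k. acov X \<delta> h (K ^ p) e ((*) b ` X)" using AC hyp(1-6) by simp
    have "0 \<le> K" using hyp(4) by simp
    then have PD': "real (pack \<delta> (ddiff (n * h) X)) \<le> C * K ^ (2 * (n * h)) * real (pack \<delta> X)"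
      using PD hyp(1-3,7) by simp
    have "acov X \<delta> (length bs * h) ((K ^ p) ^ length bs) (real (length bs) * e) (lsum X bs)"
      by (rule acov_lsum) (use AC' hyp(9) in auto)
    then have "acov X \<delta> (n * h) (K ^ (p * n)) (real n * e) (lsum X bs)" using hyp(8) by (simp add: power_mult)
    from pack_acov_le[OF this hyp(1) bounded_lsum[OF hyp(1)] hyp(3)]
    have "real (pack \<delta> (lsum X bs)) \<le> c * K ^ (p * n) * real (pack \<delta> (ddiff (n * h) X))" using e by (simp add: c_def)
    also have "\<dots> \<le> c * K ^ (p * n) * (C * K ^ (2 * (n * h)) * real (pack \<delta> X))"
      using hyp(4) by (intro mult_left_mono PD') (auto simp: c_def)
    also have "\<dots> = c * C * K ^ (p * n + 2 * (n * h)) * real (pack \<delta> X)" by (simp add: power_add)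
    finally show ?thesis .
  qed
  have c0: "0 \<le> c * C" using C by (simp add: c_def)
  show ?thesis
    by (rule exI[of _ "c * C"], rule conjI[OF c0], rule exI[of _ "p * n + 2 * (n * h)"], intro allI impI, rule main)
qed

text \<open>Choose for each \<open>i\<close> points of \<open>X\<close> with
  \<open>r\<close>-separated \<open>i\<close>-th coordinates and let all choices vary independently.
  Two choices differing at \<open>i\<close> give sums that differ in coordinate \<open>i\<close> by
  more than \<open>g * r\<close> minus the contribution of the small off-diagonal entries, and
  \<open>big\<close> keeps this above \<open>\<delta>\<close>.\<close>

lemma prod_pack_le:
  fixes X :: "(real^'n) set" and u :: "'n \<Rightarrow> real^'n"
  assumes X: "X \<subseteq> cball 0 B" and bS: "bounded S" and sub: "\<And>x. (\<And>i. x i \<in> X) \<Longrightarrow> (\<Sum>i\<in>UNIV. u i * x i) \<in> S"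
    and u: "\<And>i. g \<le> \<bar>u i $ i\<bar>" "\<And>i j. i \<noteq> j \<Longrightarrow> \<bar>u i $ j\<bar> \<le> b"
    and pos: "0 < r" "0 < \<delta>" "0 \<le> g" "0 \<le> b" "0 \<le> B" and big: "\<delta> + real CARD('n) * b * (2 * B) \<le> g * r"
  shows "(\<Prod>i\<in>UNIV. pack r (proj i X)) \<le> pack \<delta> S"
proof -
  have bX: "bounded X" using X bounded_cball bounded_subset by blast
  have "\<exists>D. D \<subseteq> (\<lambda>x. x $ i) ` X \<and> separated r D \<and> card D = pack r (proj i X)" for i
    using pack_ex[OF bounded_linear_image[where f = "\<lambda>x. x $ i", OF vec_nth_le_norm bX] pos(1)] by blast
  then obtain D where D: "\<And>i. D i \<subseteq> (\<lambda>x. x $ i) ` X" "\<And>i. separated r (D i)" "\<And>i. card (D i) = pack r (proj i X)"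
    by metis
  have "\<forall>i. \<forall>d\<in>D i. \<exists>x\<in>X. x $ i = d" using D(1) by blast
  then obtain s where s: "\<And>i d. d \<in> D i \<Longrightarrow> s i d \<in> X \<and> s i d $ i = d" by metis
  have "card (Pi\<^sub>E UNIV D) \<le> pack \<delta> S"
  proof (rule card_le_pack_image[OF bS pos(2), where h = "\<lambda>f. \<Sum>i\<in>UNIV. u i * s i (f i)"])
    show "(\<lambda>f. \<Sum>i\<in>UNIV. u i * s i (f i)) ` Pi\<^sub>E UNIV D \<subseteq> S"
      using s by (auto intro!: sub simp: PiE_def Pi_def)
    fix f f' assume f: "f \<in> Pi\<^sub>E UNIV D" "f' \<in> Pi\<^sub>E UNIV D" "f \<noteq> f'"
    then obtain i where i: "f i \<noteq> f' i" by (meson ext)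
    have fD: "f l \<in> D l" "f' l \<in> D l" for l using f by auto
    have nb: "norm (s l (f l)) \<le> B" "norm (s l (f' l)) \<le> B" for l
      using s[OF fD(1)[of l]] s[OF fD(2)[of l]] X by auto
    define w where "w = (\<lambda>l. u l * (s l (f l) - s l (f' l)))"
    have diff: "(\<Sum>i\<in>UNIV. u i * s i (f i)) - (\<Sum>i\<in>UNIV. u i * s i (f' i)) = (\<Sum>l\<in>UNIV. w l)"
      by (simp add: w_def sum_subtractf right_diff_distrib)
    have split: "(\<Sum>l\<in>UNIV. w l) $ i = w i $ i + (\<Sum>l\<in>UNIV - {i}. w l $ i)"
      by (simp add: sum.remove[of UNIV i])
    have main: "g * \<bar>f i - f' i\<bar> \<le> \<bar>w i $ i\<bar>"
      using u(1)[of i] s[OF fD(1)] s[OF fD(2)] by (simp add: w_def abs_mult mult_right_mono)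
    have rest: "\<bar>\<Sum>l\<in>UNIV - {i}. w l $ i\<bar> \<le> real CARD('n) * b * (2 * B)"
    proof -
      have "\<bar>\<Sum>l\<in>UNIV - {i}. w l $ i\<bar> \<le> (\<Sum>l\<in>UNIV - {i}. \<bar>w l $ i\<bar>)" by (rule sum_abs)
      also have "\<dots> \<le> (\<Sum>l\<in>UNIV - {i}. b * (2 * B))"
      proof (rule sum_mono)
        fix l assume l: "l \<in> UNIV - {i}"
        have "\<bar>(s l (f l) - s l (f' l)) $ i\<bar> \<le> 2 * B"
          using vec_nth_le_norm[of "s l (f l)" i] vec_nth_le_norm[of "s l (f' l)" i] nb[of l]
          by (simp only: vector_minus_component)
        then show "\<bar>w l $ i\<bar> \<le> b * (2 * B)"
          unfolding w_def vector_mult_component abs_mult using u(2)[of l i] l pos by (intro mult_mono) auto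
      qed
      also have "\<dots> = real (card (UNIV - {i} :: 'n set)) * (b * (2 * B))" by simp
      also have "\<dots> \<le> real CARD('n) * (b * (2 * B))" using pos by (intro mult_right_mono) (auto intro: card_mono)
      finally show ?thesis by (simp add: mult.assoc)
    qed
    have fr: "r < \<bar>f i - f' i\<bar>" using separatedD[OF D(2) fD(1) fD(2) i] by (simp add: dist_real_def)
    have g0: "g > 0"
    proof -
      have "0 \<le> real CARD('n) * b * (2 * B)" using pos by simp
      then have "0 < g * r" using big pos by linarith
      then show ?thesis using pos by (simp add: zero_less_mult_iff)
    qed
    have "g * r < g * \<bar>f i - f' i\<bar>" using fr g0 by simp
    then have "\<delta> < \<bar>(\<Sum>l\<in>UNIV. w l) $ i\<bar>" using main rest big unfolding split by linarith
    also have "\<dots> \<le> norm (\<Sum>l\<in>UNIV. w l)" by (rule vec_nth_le_norm)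
    finally show "\<delta> < dist (\<Sum>i\<in>UNIV. u i * s i (f i)) (\<Sum>i\<in>UNIV. u i * s i (f' i))"
      unfolding dist_norm diff .
  qed
  then show ?thesis by (simp add: card_PiE D(3))
qed

lemma ringgen_prod:
  fixes A :: "'a::comm_ring_1 set"
  assumes "finite F" "\<And>l. l \<in> F \<Longrightarrow> f l \<in> ringgen A k"
  shows "prod f F \<in> ringgen A (k + card F)"
  using assms
proof (induction F rule: finite_induct)
  case empty then show ?case using ringgen_0_1[of A k] by simp
next
  case (insert x F)
  have "f x * prod f F \<in> ringgen A (Suc (k + card F))"
  proof (rule ringgen_mult)
    show "f x \<in> ringgen A (k + card F)" by (rule ringgen_mono[of _ _ k]) (use insert.prems in auto)
    show "prod f F \<in> ringgen A (k + card F)" using insert by blast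
  qed
  then show ?case using insert by simp
qed

lemma prod_component: "finite F \<Longrightarrow> (\<Prod>l\<in>F. f l) $ i = (\<Prod>l\<in>F. f l $ i)"
  for f :: "'a \<Rightarrow> real^'n"
  by (induction F rule: finite_induct) auto

section \<open>Choice of exponents and the contradiction in terms of packing numbers\<close>

lemma sum_product_core:
  fixes \<kappa> \<sigma> :: real
  assumes \<kappa>: "0 < \<kappa>" "\<kappa> \<le> 1" and \<sigma>: "0 < \<sigma>"
  shows "\<exists>\<epsilon>>0. \<exists>\<delta>0>0. \<forall>\<delta> (A :: (real^'n) set) X. 0 < \<delta> \<longrightarrow> \<delta> < \<delta>0 \<longrightarrow>
    (\<forall>a\<in>A. \<forall>i. 0 \<le> a $ i \<and> a $ i \<le> 2) \<longrightarrow> X \<subseteq> cball 0 (\<delta> powr (-\<epsilon>)) \<longrightarrow> X \<noteq> {} \<longrightarrow>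
    (\<forall>j \<rho>. \<delta> \<le> \<rho> \<longrightarrow> \<rho> \<le> 1 \<longrightarrow> \<rho> powr (-\<kappa>) \<le> \<delta> powr (-\<epsilon>) * real (pack \<rho> (proj j A))) \<longrightarrow>
    (\<forall>i j. i \<noteq> j \<longrightarrow> (\<exists>a\<in>A. \<delta> powr \<epsilon> \<le> \<bar>a $ i - a $ j\<bar>)) \<longrightarrow>
    (\<forall>j \<rho>. \<delta> \<le> \<rho> \<longrightarrow> \<rho> \<le> 1 \<longrightarrow> \<rho> powr (-\<kappa>) \<le> \<delta> powr (-\<epsilon>) * real (pack \<rho> (proj j X))) \<longrightarrow>
    real (pack (2 * \<delta>) X) \<le> \<delta> powr (-(real CARD('n) - \<sigma>) - \<epsilon>) \<longrightarrow>
    real (pack (2 * \<delta>) (X + X)) \<le> \<delta> powr (-\<epsilon>) * real (pack \<delta> X) \<longrightarrow>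
    (\<forall>a\<in>A. real (pack (2 * \<delta>) ((*) a ` X + X)) \<le> \<delta> powr (-\<epsilon>) * real (pack \<delta> X)) \<longrightarrow> False"
proof -
  define n where "n = real CARD('n)"
  have n: "n \<ge> 1" unfolding n_def by (simp add: Suc_leI)
  have n2: "n \<le> n * n" using n by simp
  \<comment> \<open>With \<open>b = 2 * \<tau> / \<kappa>\<close>, non-concentration at scale
    \<open>\<delta> powr b\<close> gives about \<open>\<delta> powr (-(2 * \<tau>))\<close> points,
    outweighing the defect \<open>\<tau>\<close> of the ring projections. The final loss is at most
    \<open>6 * (b * n)\<close> per coordinate, where the factor \<open>n\<close> comes from products
    of separating elements; over \<open>n\<close> coordinates this must stay below
    \<open>\<sigma>\<close>, hence \<open>n * n\<close>.\<close>
  define \<tau> where "\<tau> = \<kappa> * min \<sigma> (1/2) / (32 * (n * n))"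
  define \<nu> where "\<nu> = \<tau> / 20"
  define b where "b = 2 * \<tau> / \<kappa>"
  have nn: "n * n \<ge> 1" using n n2 by linarith
  have \<tau>: "\<tau> > 0" using \<kappa> \<sigma> nn by (simp add: \<tau>_def)
  have \<nu>: "\<nu> > 0" using \<tau> by (simp add: \<nu>_def)
  have bn: "b * (n * n) = min \<sigma> (1/2) / 16" using \<kappa> n by (simp add: b_def \<tau>_def)
  have b0: "b > 0" using \<tau> \<kappa> by (simp add: b_def)
  have \<tau>b: "2 * \<tau> \<le> b" using \<tau> \<kappa> by (simp add: b_def pos_le_divide_eq mult_left_le)
  have bnn: "b * n \<le> b * (n * n)" using b0 n2 by (intro mult_left_mono) auto
  have b1n: "b \<le> b * n" using b0 n by simp
  have bsmall: "b * n \<le> 1 / 32" "b * (n * n) \<le> \<sigma> / 16" using bn bnn by auto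
  have \<tau>\<kappa>: "\<tau> \<le> \<kappa> / 64"
  proof -
    have "b \<le> 1 / 32" using bsmall(1) b1n by linarith
    then have "2 * \<tau> \<le> 1 / 32 * \<kappa>" using \<kappa> unfolding b_def by (simp add: pos_divide_le_eq)
    then show ?thesis by simp
  qed
  obtain kmax \<epsilon>0 \<delta>r where \<epsilon>0: "\<epsilon>0 > 0" and \<delta>r: "\<delta>r > 0" and RF: "\<forall>\<delta> (A :: (real^'n) set). 0 < \<delta> \<longrightarrow> \<delta> < \<delta>r \<longrightarrow>
    (\<forall>a\<in>A. \<forall>i. \<bar>a $ i\<bar> \<le> 2) \<longrightarrow>
    (\<forall>j \<rho>. \<delta> \<le> \<rho> \<longrightarrow> \<rho> \<le> 1 \<longrightarrow> \<rho> powr (-\<kappa>) \<le> \<delta> powr (-\<epsilon>0) * real (pack \<rho> (proj j A))) \<longrightarrow>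
    (\<exists>k\<le>kmax. (\<forall>j. \<delta> powr (-1 + \<tau>) \<le> real (pack \<delta> (proj j (ringgen A k)))) \<and>
       real (pack \<delta> (ringgen A (k + 3))) \<le> \<delta> powr (-\<nu>) * real (pack \<delta> (ringgen A k)))"
    using ring_full[OF \<kappa> \<tau> \<nu>, where 'n = 'n] by (elim exE conjE)
  \<comment> \<open>Six levels beyond \<open>k\<close> hold the separating elements, and
    \<open>CARD('n)\<close> more their products.\<close>
  define k2 where "k2 = kmax + 6 + CARD('n)"
  obtain R where R: "R \<ge> 1" and
    RB: "\<forall>A::(real^'n) set. (\<forall>a\<in>A. \<forall>i. \<bar>a $ i\<bar> \<le> 2) \<longrightarrow> (\<forall>b\<in>ringgen A k2. \<forall>i. \<bar>b $ i\<bar> \<le> R)"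
    using ringgen_bounded[of k2, where 'n = 'n] by (elim exE conjE)
  obtain C3 q3 where C3: "C3 \<ge> 0" and L3: "\<forall>(X::(real^'n) set) A \<delta> K bs. bounded X \<longrightarrow> X \<noteq> {} \<longrightarrow> \<delta> > 0 \<longrightarrow> K \<ge> 1 \<longrightarrow>
     (\<forall>a\<in>A. \<forall>i. \<bar>a $ i\<bar> \<le> 2) \<longrightarrow>
     (\<forall>a\<in>A. real (pack \<delta> ((*) a ` X + X)) \<le> K * real (pack \<delta> X)) \<longrightarrow>
     real (pack \<delta> (X + X)) \<le> K * real (pack \<delta> X) \<longrightarrow> length bs = 3 \<longrightarrow> set bs \<subseteq> ringgen A k2 \<longrightarrow>
     real (pack \<delta> (lsum X bs)) \<le> C3 * K ^ q3 * real (pack \<delta> X)"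
    using pack_lsum_le[of 3 k2, where 'n = 'n] by (elim exE conjE)
  obtain Cn qn where Cn: "Cn \<ge> 0" and Ln: "\<forall>(X::(real^'n) set) A \<delta> K bs. bounded X \<longrightarrow> X \<noteq> {} \<longrightarrow> \<delta> > 0 \<longrightarrow> K \<ge> 1 \<longrightarrow>
     (\<forall>a\<in>A. \<forall>i. \<bar>a $ i\<bar> \<le> 2) \<longrightarrow>
     (\<forall>a\<in>A. real (pack \<delta> ((*) a ` X + X)) \<le> K * real (pack \<delta> X)) \<longrightarrow>
     real (pack \<delta> (X + X)) \<le> K * real (pack \<delta> X) \<longrightarrow> length bs = CARD('n) \<longrightarrow> set bs \<subseteq> ringgen A k2 \<longrightarrow>
     real (pack \<delta> (lsum X bs)) \<le> Cn * K ^ qn * real (pack \<delta> X)"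
    using pack_lsum_le[of "CARD('n)" k2, where 'n = 'n] by (elim exE conjE)
  define c0 where "c0 = real (pack 1 (cball (0::real^'n) 2))"
  have c0: "c0 \<ge> 1" unfolding c0_def using pack_pos[of "cball (0::real^'n) 2" 1] by simp
  \<comment> \<open>A \<open>q\<close>-th power of the doubling constant has to cost at most
    \<open>\<delta> powr (-\<nu>)\<close>; half of \<open>\<nu>\<close> is for the power of
    \<open>\<delta>\<close>, half absorbs the numerical constants.\<close>
  define \<epsilon> where "\<epsilon> = min (min \<epsilon>0 \<nu>) (min (\<nu> / (2 * (real q3 + 1))) (\<nu> / (2 * (real qn + 1))))"
  have \<epsilon>: "\<epsilon> > 0" "\<epsilon> \<le> \<epsilon>0" "\<epsilon> \<le> \<nu>" using \<epsilon>0 \<nu> by (auto simp: \<epsilon>_def)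
  have \<epsilon>q: "\<epsilon> * real q \<le> \<nu> / 2" if "\<epsilon> \<le> \<nu> / (2 * (real q + 1))" for q :: nat
  proof -
    have "\<epsilon> * (2 * (real q + 1)) \<le> \<nu>" using that by (simp add: pos_le_divide_eq)
    then show ?thesis using \<epsilon>(1) by (simp add: algebra_simps)
  qed
  have \<epsilon>3: "\<epsilon> * real q3 \<le> \<nu> / 2" by (rule \<epsilon>q) (simp add: \<epsilon>_def)
  have \<epsilon>n: "\<epsilon> * real qn \<le> \<nu> / 2" by (rule \<epsilon>q) (simp add: \<epsilon>_def)
  define N where "N = CARD('n)"
  have "\<forall>\<^sub>F \<delta> in at_right (0::real). (C3 * c0 ^ q3) * \<delta> powr (\<nu> / 2) < 1 \<and> (Cn * c0 ^ qn) * \<delta> powr (\<nu> / 2) < 1 \<and> 1 * \<delta> powr 1 < 1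
     \<and> (108000 * R) * \<delta> powr (\<tau> / 2) < 1 \<and> 180 * \<delta> powr (\<kappa> / 2) < 1 \<and> 90 * \<delta> powr \<nu> < 1 \<and> 9 * \<delta> powr (b / 2) < 1
     \<and> (1 + 6 * n * R ^ (N + 2)) * \<delta> powr (2 * \<nu>) < 1 \<and> c0 * \<delta> powr \<nu> < 1"
    by (intro eventually_conj powr_small) (use \<nu> \<tau> \<kappa> b0 in auto)
  then obtain \<delta>2 where \<delta>2: "\<delta>2 > 0" "\<And>\<delta>. 0 < \<delta> \<Longrightarrow> \<delta> < \<delta>2 \<Longrightarrow> (C3 * c0 ^ q3) * \<delta> powr (\<nu> / 2) < 1 \<and> (Cn * c0 ^ qn) * \<delta> powr (\<nu> / 2) < 1 \<and> 1 * \<delta> powr 1 < 1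
     \<and> (108000 * R) * \<delta> powr (\<tau> / 2) < 1 \<and> 180 * \<delta> powr (\<kappa> / 2) < 1 \<and> 90 * \<delta> powr \<nu> < 1 \<and> 9 * \<delta> powr (b / 2) < 1
     \<and> (1 + 6 * n * R ^ (N + 2)) * \<delta> powr (2 * \<nu>) < 1 \<and> c0 * \<delta> powr \<nu> < 1"
    unfolding eventually_at_right_field by auto
  have main: False
    if \<delta>: "0 < \<delta>" "\<delta> < min \<delta>r \<delta>2" and A01: "\<forall>a\<in>A. \<forall>i. 0 \<le> a $ i \<and> a $ i \<le> 2"
      and XB: "X \<subseteq> cball 0 (\<delta> powr (-\<epsilon>))" and Xne: "X \<noteq> {}"
      and ncA: "\<forall>j \<rho>. \<delta> \<le> \<rho> \<longrightarrow> \<rho> \<le> 1 \<longrightarrow> \<rho> powr (-\<kappa>) \<le> \<delta> powr (-\<epsilon>) * real (pack \<rho> (proj j A))"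
      and away: "\<forall>i j. i \<noteq> j \<longrightarrow> (\<exists>a\<in>A. \<delta> powr \<epsilon> \<le> \<bar>a $ i - a $ j\<bar>)"
      and ncX: "\<forall>j \<rho>. \<delta> \<le> \<rho> \<longrightarrow> \<rho> \<le> 1 \<longrightarrow> \<rho> powr (-\<kappa>) \<le> \<delta> powr (-\<epsilon>) * real (pack \<rho> (proj j X))"
      and Xup: "real (pack (2 * \<delta>) X) \<le> \<delta> powr (-(real CARD('n) - \<sigma>) - \<epsilon>)"
      and XX: "real (pack (2 * \<delta>) (X + X)) \<le> \<delta> powr (-\<epsilon>) * real (pack \<delta> X)"
      and aXX: "\<forall>a\<in>A. real (pack (2 * \<delta>) ((*) a ` X + X)) \<le> \<delta> powr (-\<epsilon>) * real (pack \<delta> X)"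
    for \<delta> and A X :: "(real^'n) set"
  proof -
    note sm = \<delta>2(2)[of \<delta>]
    have small: "(C3 * c0 ^ q3) * \<delta> powr (\<nu> / 2) < 1" "(Cn * c0 ^ qn) * \<delta> powr (\<nu> / 2) < 1" "\<delta> < 1"
       "(108000 * R) * \<delta> powr (\<tau> / 2) < 1" "180 * \<delta> powr (\<kappa> / 2) < 1" "90 * \<delta> powr \<nu> < 1" "9 * \<delta> powr (b / 2) < 1"
       "(1 + 6 * n * R ^ (N + 2)) * \<delta> powr (2 * \<nu>) < 1" "c0 * \<delta> powr \<nu> < 1"
      using sm \<delta> by auto
    have mono: "\<delta> powr x \<le> \<delta> powr y" if "y \<le> x" for x y using that \<delta> small(3) by (intro powr_mono') auto
    have padd: "\<delta> powr x * \<delta> powr y = \<delta> powr (x + y)" for x y by (simp add: powr_add)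
    have ppos: "\<delta> powr x > 0" for x using \<delta> by simp
    have d1: "\<delta> * \<delta> powr x = \<delta> powr (1 + x)" for x using \<delta> by (simp add: powr_add)
    have absorb: "c * \<delta> powr x \<le> \<delta> powr y" if "c * \<delta> powr z < 1" "y + z \<le> x" for c x y z
    proof (cases "c \<ge> 0")
      case True
      have "c * \<delta> powr x \<le> c * \<delta> powr (y + z)" using True that(2) by (intro mult_left_mono mono)
      also have "\<dots> = (c * \<delta> powr z) * \<delta> powr y" by (simp add: powr_add)
      also have "\<dots> \<le> 1 * \<delta> powr y" using that(1) by (intro mult_right_mono) auto
      finally show ?thesis by simp
    next
      case False
      then have "c * \<delta> powr x \<le> 0" using ppos[of x] by (simp add: mult_nonpos_nonneg)
      then show ?thesis using ppos[of y] by linarith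
    qed
    have bX: "bounded X" using XB bounded_cball bounded_subset by blast
    have A2: "\<forall>a\<in>A. \<forall>i. \<bar>a $ i\<bar> \<le> 2" using A01 by (auto simp: abs_le_iff intro: order_trans[of _ 0])
    define K where "K = c0 * \<delta> powr (-\<epsilon>)"
    have K1: "K \<ge> 1"
    proof -
      have "\<delta> powr 0 \<le> \<delta> powr (-\<epsilon>)" using \<epsilon> by (intro mono) auto
      then have "1 * 1 \<le> c0 * \<delta> powr (-\<epsilon>)" using c0 \<delta> by (intro mult_mono) auto
      then show ?thesis by (simp add: K_def)
    qed
    have resc: "real (pack \<delta> E) \<le> c0 * real (pack (2 * \<delta>) E)" if "bounded E" for E :: "(real^'n) set"
      using pack_rescale[OF that \<delta>(1), of 2] unfolding c0_def of_nat_mult[symmetric] of_nat_le_iff by simp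
    have KXX: "real (pack \<delta> (X + X)) \<le> K * real (pack \<delta> X)"
    proof -
      have "real (pack \<delta> (X + X)) \<le> c0 * real (pack (2 * \<delta>) (X + X))" by (rule resc) (intro bounded_set_plus bX)
      also have "\<dots> \<le> c0 * (\<delta> powr (-\<epsilon>) * real (pack \<delta> X))" using XX c0 by (intro mult_left_mono) auto
      finally show ?thesis by (simp add: K_def mult.assoc)
    qed
    have KaX: "\<forall>a\<in>A. real (pack \<delta> ((*) a ` X + X)) \<le> K * real (pack \<delta> X)"
    proof
      fix a assume a: "a \<in> A"
      have "real (pack \<delta> ((*) a ` X + X)) \<le> c0 * real (pack (2 * \<delta>) ((*) a ` X + X))"
        by (rule resc) (intro bounded_set_plus bounded_mult_image bX)
      also have "\<dots> \<le> c0 * (\<delta> powr (-\<epsilon>) * real (pack \<delta> X))" using aXX a c0 by (intro mult_left_mono) auto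
      finally show "real (pack \<delta> ((*) a ` X + X)) \<le> K * real (pack \<delta> X)" by (simp add: K_def mult.assoc)
    qed
    have Kq: "C * K ^ q \<le> \<delta> powr (-\<nu>)" if "C * c0 ^ q * \<delta> powr (\<nu> / 2) < 1" "\<epsilon> * real q \<le> \<nu> / 2" for C and q :: nat
    proof -
      have "C * K ^ q = C * c0 ^ q * \<delta> powr (-(\<epsilon> * real q))"
        using \<delta> by (simp add: K_def power_mult_distrib powr_realpow[symmetric] powr_powr)
      also have "\<dots> \<le> \<delta> powr (-\<nu>)" by (rule absorb[OF that(1)]) (use that(2) in simp)
      finally show ?thesis .
    qed
    have L3': "real (pack \<delta> (lsum X bs)) \<le> \<delta> powr (-\<nu>) * real (pack \<delta> X)" if "length bs = 3" "set bs \<subseteq> ringgen A k2" for bs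
    proof -
      have "real (pack \<delta> (lsum X bs)) \<le> C3 * K ^ q3 * real (pack \<delta> X)"
        using L3 bX Xne \<delta>(1) K1 A2 KaX KXX that by blast
      also have "\<dots> \<le> \<delta> powr (-\<nu>) * real (pack \<delta> X)" using Kq[OF small(1) \<epsilon>3] by (intro mult_right_mono) auto
      finally show ?thesis .
    qed
    have Ln': "real (pack \<delta> (lsum X bs)) \<le> \<delta> powr (-\<nu>) * real (pack \<delta> X)" if "length bs = CARD('n)" "set bs \<subseteq> ringgen A k2" for bs
    proof -
      have "real (pack \<delta> (lsum X bs)) \<le> Cn * K ^ qn * real (pack \<delta> X)"
        using Ln bX Xne \<delta>(1) K1 A2 KaX KXX that by blast
      also have "\<dots> \<le> \<delta> powr (-\<nu>) * real (pack \<delta> X)" using Kq[OF small(2) \<epsilon>n] by (intro mult_right_mono) auto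
      finally show ?thesis .
    qed
    have ncA0: "\<forall>j \<rho>. \<delta> \<le> \<rho> \<longrightarrow> \<rho> \<le> 1 \<longrightarrow> \<rho> powr (-\<kappa>) \<le> \<delta> powr (-\<epsilon>0) * real (pack \<rho> (proj j A))"
    proof (intro allI impI)
      fix j \<rho> assume "\<delta> \<le> \<rho>" "\<rho> \<le> 1"
      then have "\<rho> powr (-\<kappa>) \<le> \<delta> powr (-\<epsilon>) * real (pack \<rho> (proj j A))" using ncA by blast
      also have "\<dots> \<le> \<delta> powr (-\<epsilon>0) * real (pack \<rho> (proj j A))" using \<epsilon> by (intro mult_right_mono mono) auto
      finally show "\<rho> powr (-\<kappa>) \<le> \<delta> powr (-\<epsilon>0) * real (pack \<rho> (proj j A))" .
    qed
    obtain k where k: "k \<le> kmax" "\<And>j. \<delta> powr (-1 + \<tau>) \<le> real (pack \<delta> (proj j (ringgen A k)))"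
       "real (pack \<delta> (ringgen A (k + 3))) \<le> \<delta> powr (-\<nu>) * real (pack \<delta> (ringgen A k))"
      using RF[rule_format, of \<delta> A] \<delta> A2 ncA0 by auto
    have bR: "\<bar>v $ i\<bar> \<le> R" if "v \<in> ringgen A l" "l \<le> k2" for v i l
      using RB A2 ringgen_mono[OF that] by blast
    have bW: "bounded (ringgen A l)" if "l \<le> k2" for l
      by (rule ringgen_subset_cball(2)[of A l R]) (rule bR[OF _ that])
    define W where "W = ringgen A k"
    have kk2: "k + 6 + CARD('n) \<le> k2" using k(1) by (simp add: k2_def)
    have bWk: "bounded W" unfolding W_def by (rule bW) (use kk2 in simp)
    have WR: "\<bar>v $ i\<bar> \<le> R" if "v \<in> W" for v i using bR[of v k i] that kk2 by (simp add: W_def)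
    have W01: "0 \<in> W" "1 \<in> W" using ringgen_0_1 by (auto simp: W_def)
    have AW: "A \<subseteq> W" using ringgen_mono[of _ A 0 k] by (auto simp: W_def)
    have WW: "real (pack \<delta> (W + W)) \<le> \<delta> powr (-\<nu>) * real (pack \<delta> W)"
    proof -
      have "W + W \<subseteq> ringgen A (k + 3)"
      proof
        fix v assume "v \<in> W + W"
        then obtain x y where xy: "x \<in> W" "y \<in> W" "v = x + y" by (auto simp: set_plus_def)
        then have "v \<in> ringgen A (Suc (Suc k))" unfolding W_def xy(3) by (intro ringgen_add) auto
        then show "v \<in> ringgen A (k + 3)" by (rule ringgen_mono) simp
      qed
      then have "real (pack \<delta> (W + W)) \<le> real (pack \<delta> (ringgen A (k + 3)))"
        unfolding of_nat_le_iff by (intro pack_mono bW \<delta>) (use kk2 in auto)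
      then show ?thesis using k(3) by (simp add: W_def)
    qed
    \<comment> \<open>At this scale \<open>\<delta>\<close> times a full projection at
      \<open>\<delta>\<close> times a projection at \<open>r\<close> is about
      \<open>\<delta> powr (\<epsilon> - \<tau>)\<close>. This beats the squared cost
      \<open>\<delta> powr (-(2 * \<nu>))\<close> in the conditions \<open>big\<close>, as
      \<open>\<nu>\<close> is a small fraction of \<open>\<tau>\<close>.\<close>
    define r where "r = \<delta> powr b"
    have r: "0 < r" "r \<le> 1" "\<delta> \<le> r"
    proof -
      show "0 < r" unfolding r_def by (rule ppos)
      show "r \<le> 1" using mono[of 0 b] b0 \<delta> by (simp add: r_def)
      have "b \<le> 1" using bsmall b1n by linarith
      then show "\<delta> \<le> r" using mono[of b 1] \<delta> by (simp add: r_def)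
    qed
    have rk: "r powr (-\<kappa>) = \<delta> powr (-(2 * \<tau>))"
      using \<kappa> by (simp add: r_def powr_powr b_def)
    have low4: "\<delta> powr (\<epsilon> - 2 * \<tau>) \<le> 9 * real (pack (4 * r) (proj j E))"
      if nc: "r powr (-\<kappa>) \<le> \<delta> powr (-\<epsilon>) * real (pack r (proj j E))" and bE: "bounded E" for j and E :: "(real^'n) set"
    proof -
      have "\<delta> powr \<epsilon> * \<delta> powr (-(2 * \<tau>)) \<le> \<delta> powr \<epsilon> * (\<delta> powr (-\<epsilon>) * real (pack r (proj j E)))"
        using nc unfolding rk by (intro mult_left_mono) auto
      also have "\<dots> = real (pack r (proj j E))" using \<delta> by (simp add: mult.assoc[symmetric] padd)
      also have "\<dots> \<le> 9 * real (pack (4 * r) (proj j E))"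
        using pack_rescale_real[OF bounded_linear_image[where f = "\<lambda>x. x $ j", OF vec_nth_le_norm bE] r(1), of 4] by simp
      finally show ?thesis by (simp add: padd)
    qed
    have lowW: "\<delta> powr (\<epsilon> - 2 * \<tau>) \<le> 9 * real (pack (4 * r) (proj j W))" for j
    proof (rule low4[OF _ bWk])
      have "r powr (-\<kappa>) \<le> \<delta> powr (-\<epsilon>) * real (pack r (proj j A))" using ncA r by blast
      also have "\<dots> \<le> \<delta> powr (-\<epsilon>) * real (pack r (proj j W))"
      proof (intro mult_left_mono)
        show "real (pack r (proj j A)) \<le> real (pack r (proj j W))"
          unfolding of_nat_le_iff
          by (rule pack_mono[OF bounded_linear_image[where f = "\<lambda>x. x $ j", OF vec_nth_le_norm bWk] r(1)]) (use AW in auto)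
      qed simp
      finally show "r powr (-\<kappa>) \<le> \<delta> powr (-\<epsilon>) * real (pack r (proj j W))" .
    qed
    have lowX: "\<delta> powr (\<epsilon> - 2 * \<tau>) \<le> 9 * real (pack (4 * r) (proj j X))" for j
      by (rule low4[OF _ bX]) (use ncX r in blast)
    have \<nu>\<tau>: "20 * \<nu> = \<tau>" by (simp add: \<nu>_def)
    \<comment> \<open>The loss is \<open>\<tau>\<close> from the ring projections, \<open>b\<close>
      from the factor \<open>r0\<close> in \<open>module_projection_large\<close>, and
      \<open>2 * \<nu>\<close> for the cost of the action and the constant 90.\<close>
    have projX: "\<delta> powr (-1 + \<tau> + b + 2 * \<nu>) \<le> real (pack \<delta> (proj j X))" for j
    proof -
      have H1: "1 \<le> \<delta> powr (-\<nu>)" using mono[of "-\<nu>" 0] \<nu> \<delta> by simp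
      have "real (pack \<delta> (proj j W)) * r \<le> 90 * \<delta> powr (-\<nu>) * real (pack \<delta> (proj j X))"
      proof (rule module_projection_large[OF bX Xne bWk W01(2) WR R \<delta>(1) r(3,2) H1])
        fix t assume t: "t \<in> W"
        have "(X + (*) t ` X) + X \<subseteq> lsum X [1, t, 1]"
        proof
          fix v assume "v \<in> (X + (*) t ` X) + X"
          then obtain x y z where v: "x \<in> X" "y \<in> X" "z \<in> X" "v = x + t * y + z" by (auto simp: set_plus_def)
          then have "v = 1 * x + (t * y + (1 * z + 0))" by simp
          also have "\<dots> \<in> (*) 1 ` X + ((*) t ` X + ((*) 1 ` X + {0}))"
            by (intro set_plus_intro imageI v singletonI)
          finally show "v \<in> lsum X [1, t, 1]" unfolding lsum_def foldr.simps o_apply id_apply .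
        qed
        then have "real (pack \<delta> ((X + (*) t ` X) + X)) \<le> real (pack \<delta> (lsum X [1, t, 1]))"
          unfolding of_nat_le_iff by (intro pack_mono bounded_lsum bX \<delta>)
        also have "\<dots> \<le> \<delta> powr (-\<nu>) * real (pack \<delta> X)"
        proof (rule L3')
          have "t \<in> ringgen A k2" using t kk2 unfolding W_def by (auto intro: ringgen_mono)
          then show "set [1, t, 1] \<subseteq> ringgen A k2" using ringgen_0_1[of A k2] by simp
        qed simp
        finally show "real (pack \<delta> ((X + (*) t ` X) + X)) \<le> \<delta> powr (-\<nu>) * real (pack \<delta> X)" .
      next
        have "12000 * R * (\<delta> powr (-\<nu>))\<^sup>2 = (12000 * R) * \<delta> powr (-(2 * \<nu>))"
          using padd[of "-\<nu>" "-\<nu>"] by (simp add: power2_eq_square)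
        also have "\<dots> = ((108000 * R) * \<delta> powr (-(2 * \<nu>))) / 9" by simp
        also have "\<dots> \<le> \<delta> powr (\<epsilon> - \<tau>) / 9"
          by (intro divide_right_mono absorb[OF small(4)]) (use \<nu>\<tau> \<epsilon> \<nu> in auto)
        also have "\<dots> = \<delta> * \<delta> powr (-1 + \<tau>) * (\<delta> powr (\<epsilon> - 2 * \<tau>) / 9)"
          unfolding times_divide_eq_right d1 padd by simp
        also have "\<dots> \<le> \<delta> * real (pack \<delta> (proj j W)) * real (pack (4 * r) (proj j X))"
          using k(2)[of j] lowX[of j] \<delta> by (intro mult_mono) (auto simp: W_def)
        finally show "12000 * R * (\<delta> powr (-\<nu>))\<^sup>2 \<le> \<delta> * real (pack \<delta> (proj j W)) * real (pack (4 * r) (proj j X))" .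
        have "\<delta> powr (-\<kappa>) \<le> \<delta> powr (-\<epsilon>) * real (pack \<delta> (proj j X))" using ncX small(3) by simp
        then have "\<delta> powr \<epsilon> * \<delta> powr (-\<kappa>) \<le> \<delta> powr \<epsilon> * (\<delta> powr (-\<epsilon>) * real (pack \<delta> (proj j X)))"
          by (intro mult_left_mono) auto
        also have "\<dots> = real (pack \<delta> (proj j X))" using \<delta> by (simp add: mult.assoc[symmetric] padd)
        finally have "\<delta> powr (\<epsilon> - \<kappa>) \<le> real (pack \<delta> (proj j X))" by (simp add: padd)
        moreover have "180 * \<delta> powr (-\<nu>) \<le> \<delta> powr (\<epsilon> - \<kappa>)"
          by (rule absorb[OF small(5)]) (use \<nu>\<tau> \<tau>\<kappa> \<epsilon> \<tau> in linarith)
        ultimately show "180 * \<delta> powr (-\<nu>) \<le> real (pack \<delta> (proj j X))" by linarith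
      qed
      moreover have "\<delta> powr (-1 + \<tau>) * r \<le> real (pack \<delta> (proj j W)) * r"
        using k(2)[of j] r by (intro mult_right_mono) (auto simp: W_def)
      ultimately have e1: "\<delta> powr (-1 + \<tau> + b) \<le> 90 * \<delta> powr (-\<nu>) * real (pack \<delta> (proj j X))"
        unfolding r_def padd by linarith
      have "90 * \<delta> powr (-\<nu>) \<le> \<delta> powr (-(2 * \<nu>))" by (rule absorb[OF small(6)]) simp
      then have "90 * \<delta> powr (-\<nu>) * real (pack \<delta> (proj j X)) \<le> \<delta> powr (-(2 * \<nu>)) * real (pack \<delta> (proj j X))"
        by (intro mult_right_mono) auto
      with e1 have "\<delta> powr (-1 + \<tau> + b) \<le> \<delta> powr (-(2 * \<nu>)) * real (pack \<delta> (proj j X))" by linarith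
      then have "\<delta> powr (2 * \<nu>) * \<delta> powr (-1 + \<tau> + b) \<le> \<delta> powr (2 * \<nu>) * (\<delta> powr (-(2 * \<nu>)) * real (pack \<delta> (proj j X)))"
        by (intro mult_left_mono) auto
      also have "\<dots> = real (pack \<delta> (proj j X))" using \<delta> by (simp add: mult.assoc[symmetric] padd)
      finally show ?thesis by (simp add: padd algebra_simps)
    qed

    \<comment> \<open>The exponent \<open>4 * b\<close> leaves room below \<open>r ^ 3 * \<delta>
      powr \<epsilon> = \<delta> powr (3 * b + \<epsilon>)\<close> for the factor 9.\<close>
    define \<gamma> where "\<gamma> = \<delta> powr (4 * b)"
    have \<gamma>: "0 < \<gamma>" "\<gamma> \<le> 1" using ppos mono[of 0 "4 * b"] b0 \<delta> by (auto simp: \<gamma>_def)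
    have sep: "\<exists>e\<in>ringgen A (k + 6). \<bar>e $ j\<bar> \<le> 3 * R\<^sup>2 * \<delta> \<and> \<gamma> < \<bar>e $ i\<bar>" if ij: "i \<noteq> j" for i j
    proof -
      obtain a where a: "a \<in> A" "\<delta> powr \<epsilon> \<le> \<bar>a $ i - a $ j\<bar>" using away ij by blast
      show ?thesis
      proof (rule separating_element[OF R _ \<delta>(1) r(1,2) _ a(1) _ _ a(2) \<gamma>(1)])
        show "\<bar>x $ l\<bar> \<le> R" if "x \<in> ringgen A (k + 1)" for x l by (rule bR[OF that]) (use kk2 in simp)
        show "0 \<le> a $ j" "a $ j \<le> 2" using A01 a by auto
        have "9 * \<delta> powr (4 * b) \<le> \<delta> powr (3 * b + b / 2)" by (rule absorb[OF small(7)]) simp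
        also have "\<dots> < \<delta> powr (3 * b + \<epsilon>)"
          by (rule powr_less_mono') (use \<delta> small \<epsilon> \<nu>\<tau> \<nu> \<tau>b b0 in auto)
        also have "\<dots> = r ^ 3 * \<delta> powr \<epsilon>"
        proof -
          have "r ^ 3 = \<delta> powr (b + b + b)" by (simp add: r_def eval_nat_numeral padd add.assoc)
          then show ?thesis by (simp add: padd)
        qed
        finally show "9 * \<gamma> < r ^ 3 * \<delta> powr \<epsilon>" by (simp add: \<gamma>_def)
        fix l :: real assume l: "0 \<le> l" "l \<le> 1"
        have "\<exists>x\<in>W. \<exists>x'\<in>W. \<exists>y\<in>W. \<exists>y'\<in>W. \<bar>(x - x') $ j - l * (y - y') $ j\<bar> \<le> \<delta> \<and> r < \<bar>(y - y') $ i\<bar>"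
        proof (rule quotient_fill[OF bWk _ R WR \<delta>(1) _ r(3) l WW ppos])
          show "W \<noteq> {}" using W01 by blast
          show "\<delta> \<le> 1" using small by simp
          have "6 * R * (\<delta> powr (-\<nu>))\<^sup>2 = (6 * R) * \<delta> powr (-(2 * \<nu>))"
            using padd[of "-\<nu>" "-\<nu>"] by (simp add: power2_eq_square)
          also have "\<dots> < (108000 * R) * \<delta> powr (-(2 * \<nu>)) / 81" using R ppos[of "-(2 * \<nu>)"] by simp
          also have "\<dots> \<le> \<delta> powr (\<epsilon> - \<tau>) / 81"
            by (intro divide_right_mono absorb[OF small(4)]) (use \<nu>\<tau> \<epsilon> \<nu> in auto)
          also have "\<dots> = \<delta> * (\<delta> powr (\<epsilon> - 2 * \<tau>) / 9) * (\<delta> powr (-1 + \<tau>) / 9)"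
            unfolding times_divide_eq_right times_divide_eq_left d1 padd by simp
          also have "\<dots> \<le> \<delta> * real (pack (4 * r) (proj i W)) * real (pack (4 * \<delta>) (proj j W))"
          proof (intro mult_mono)
            show "\<delta> powr (\<epsilon> - 2 * \<tau>) / 9 \<le> real (pack (4 * r) (proj i W))" using lowW[of i] by simp
            have "real (pack \<delta> (proj j W)) \<le> 9 * real (pack (4 * \<delta>) (proj j W))"
              using pack_rescale_real[OF bounded_linear_image[where f = "\<lambda>x. x $ j", OF vec_nth_le_norm bWk] \<delta>(1), of 4] by simp
            then show "\<delta> powr (-1 + \<tau>) / 9 \<le> real (pack (4 * \<delta>) (proj j W))" using k(2)[of j] by (simp add: W_def)
          qed (use \<delta> in auto)
          finally show "6 * R * (\<delta> powr (-\<nu>))\<^sup>2 < \<delta> * real (pack (4 * r) (proj i W)) * real (pack (4 * \<delta>) (proj j W))" .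
        qed
        then show "\<exists>x\<in>ringgen A k. \<exists>x'\<in>ringgen A k. \<exists>y\<in>ringgen A k. \<exists>y'\<in>ringgen A k.
          \<bar>(x - x') $ j - l * (y - y') $ j\<bar> \<le> \<delta> \<and> r < \<bar>(y - y') $ i\<bar>" by (simp only: W_def)
      qed
    qed
    have "\<forall>i j. \<exists>e. i \<noteq> j \<longrightarrow> e \<in> ringgen A (k + 6) \<and> \<bar>e $ j\<bar> \<le> 3 * R\<^sup>2 * \<delta> \<and> \<gamma> < \<bar>e $ i\<bar>" using sep by blast
    then obtain ee where ee: "\<And>i j. i \<noteq> j \<Longrightarrow> ee i j \<in> ringgen A (k + 6) \<and> \<bar>ee i j $ j\<bar> \<le> 3 * R\<^sup>2 * \<delta> \<and> \<gamma> < \<bar>ee i j $ i\<bar>" by metis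
    \<comment> \<open>For each \<open>l\<close> different from \<open>i\<close> one factor is of
      order \<open>\<delta>\<close> in coordinate \<open>l\<close>, and no factor is smaller than
      \<open>\<gamma>\<close> in coordinate \<open>i\<close>. So the product is concentrated on
      coordinate \<open>i\<close>.\<close>
    define u where "u = (\<lambda>i. \<Prod>l\<in>UNIV - {i}. ee i l)"
    have u_in: "u i \<in> ringgen A k2" for i
    proof -
      have "u i \<in> ringgen A (k + 6 + card (UNIV - {i}))" unfolding u_def by (rule ringgen_prod) (use ee in auto)
      then show ?thesis
      proof (rule ringgen_mono)
        have "card (UNIV - {i}) \<le> CARD('n)" by (intro card_mono) auto
        then show "k + 6 + card (UNIV - {i}) \<le> k2" using kk2 by linarith
      qed
    qed
    have u_diag: "\<gamma> ^ N \<le> \<bar>u i $ i\<bar>" for i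
    proof -
      have "\<gamma> ^ N \<le> \<gamma> ^ card (UNIV - {i})"
        using \<gamma> by (intro power_decreasing) (auto simp: N_def intro: card_mono)
      also have "\<dots> = (\<Prod>l\<in>UNIV - {i}. \<gamma>)" by simp
      also have "\<dots> \<le> (\<Prod>l\<in>UNIV - {i}. \<bar>ee i l $ i\<bar>)"
        using ee \<gamma> by (intro prod_mono) (auto intro: less_imp_le)
      also have "\<dots> = \<bar>u i $ i\<bar>" unfolding u_def by (simp add: prod_component abs_prod)
      finally show ?thesis .
    qed
    have RN: "1 \<le> R ^ N" using R by (intro one_le_power)
    have u_off: "\<bar>u i $ j\<bar> \<le> 3 * R\<^sup>2 * \<delta> * R ^ N" if ij: "i \<noteq> j" for i j
    proof -
      have "\<bar>u i $ j\<bar> = (\<Prod>l\<in>UNIV - {i}. \<bar>ee i l $ j\<bar>)" unfolding u_def by (simp add: prod_component abs_prod)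
      also have "\<dots> = \<bar>ee i j $ j\<bar> * (\<Prod>l\<in>UNIV - {i} - {j}. \<bar>ee i l $ j\<bar>)" using ij by (intro prod.remove) auto
      also have "\<dots> \<le> (3 * R\<^sup>2 * \<delta>) * R ^ N"
      proof (rule mult_mono)
        show "\<bar>ee i j $ j\<bar> \<le> 3 * R\<^sup>2 * \<delta>" using ee[OF ij] by simp
        have "(\<Prod>l\<in>UNIV - {i} - {j}. \<bar>ee i l $ j\<bar>) \<le> (\<Prod>l\<in>UNIV - {i} - {j}. R)"
        proof (rule prod_mono)
          fix l assume "l \<in> UNIV - {i} - {j}"
          then have "ee i l \<in> ringgen A (k + 6)" using ee[of i l] by auto
          then show "0 \<le> \<bar>ee i l $ j\<bar> \<and> \<bar>ee i l $ j\<bar> \<le> R" using bR[of "ee i l" "k + 6" j] kk2 by simp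
        qed
        also have "\<dots> = R ^ card (UNIV - {i} - {j})" by simp
        also have "\<dots> \<le> R ^ N" using R by (intro power_increasing) (auto simp: N_def intro: card_mono)
        finally show "(\<Prod>l\<in>UNIV - {i} - {j}. \<bar>ee i l $ j\<bar>) \<le> R ^ N" .
        show "0 \<le> (\<Prod>l\<in>UNIV - {i} - {j}. \<bar>ee i l $ j\<bar>)" by (rule prod_nonneg) simp
      qed (use R \<delta> in simp)
      finally show ?thesis .
    qed
    obtain xs :: "'n list" where xs: "set xs = UNIV" "distinct xs" using finite_distinct_list[OF finite_class.finite_UNIV] by blast
    \<comment> \<open>Multiplication by \<open>u i\<close> may shrink coordinate \<open>i\<close> by
      \<open>\<gamma> ^ N = \<delta> powr (4 * b * n)\<close>. Separation
      \<open>\<delta> powr s\<close> becomes \<open>\<delta> powr (1 - 3 * \<nu>)\<close> after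
      that, still above the off-diagonal error of order
      \<open>\<delta> powr (1 - \<epsilon>)\<close>.\<close>
    define s where "s = 1 - 4 * b * n - 3 * \<nu>"
    define S where "S = lsum X (map u xs)"
    have lenxs: "length xs = CARD('n)" using xs by (metis distinct_card)
    have gN: "\<gamma> ^ N = \<delta> powr (4 * b * n)"
      using \<delta> by (simp add: \<gamma>_def powr_realpow[symmetric] powr_powr n_def N_def)
    have prodle: "(\<Prod>i\<in>UNIV. pack (\<delta> powr s) (proj i X)) \<le> pack \<delta> S"
    proof (rule prod_pack_le[OF XB _ _ u_diag u_off])
      show "bounded S" unfolding S_def by (rule bounded_lsum[OF bX])
      show "(\<Sum>i\<in>UNIV. u i * x i) \<in> S" if "\<And>i. x i \<in> X" for x
      proof -
        have "(\<Sum>i\<in>UNIV. u i * x i) = sum_list (map (\<lambda>i. u i * x i) xs)"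
          using sum_list_distinct_conv_sum_set[OF xs(2)] xs(1) by metis
        then show ?thesis unfolding S_def using sum_list_in_lsum[of xs x X u] that by simp
      qed
      have "\<delta> + real CARD('n) * (3 * R\<^sup>2 * \<delta> * R ^ N) * (2 * \<delta> powr (-\<epsilon>)) = \<delta> + (6 * n * R ^ (N + 2)) * (\<delta> * \<delta> powr (-\<epsilon>))"
        by (simp add: n_def power_add power2_eq_square mult_ac)
      also have "\<dots> = \<delta> + (6 * n * R ^ (N + 2)) * \<delta> powr (1 - \<epsilon>)" unfolding d1 by simp
      also have "\<dots> \<le> 1 * \<delta> powr (1 - \<nu>) + (6 * n * R ^ (N + 2)) * \<delta> powr (1 - \<nu>)"
        using mono[of "1 - \<nu>" 1] mono[of "1 - \<nu>" "1 - \<epsilon>"] \<nu> \<epsilon> n R \<delta> by (intro add_mono mult_left_mono) auto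
      also have "\<dots> = (1 + 6 * n * R ^ (N + 2)) * \<delta> powr (1 - \<nu>)" by (simp add: distrib_right)
      also have "\<dots> \<le> \<delta> powr (1 - 3 * \<nu>)" by (rule absorb[OF small(8)]) simp
      also have "\<dots> = \<gamma> ^ N * \<delta> powr s" unfolding gN padd s_def by simp
      finally show "\<delta> + real CARD('n) * (3 * R\<^sup>2 * \<delta> * R ^ N) * (2 * \<delta> powr (-\<epsilon>)) \<le> \<gamma> ^ N * \<delta> powr s" .
    qed (use \<delta> \<gamma> R ppos in auto)
    define \<theta> where "\<theta> = \<tau> + b + 4 * b * n + 6 * \<nu>"
    have projs: "\<delta> powr (-1 + \<theta>) \<le> real (pack (\<delta> powr s) (proj j X))" for j
    proof -
      define L where "L = \<delta> powr (-(4 * b * n + 3 * \<nu>))"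
      have "0 \<le> 4 * b * n + 3 * \<nu>" using b0 n \<nu> by (intro add_nonneg_nonneg) auto
      then have "-(4 * b * n + 3 * \<nu>) \<le> 0" by simp
      from mono[OF this] have L1: "L \<ge> 1" using \<delta> by (simp add: L_def)
      have Ls: "L * \<delta> = \<delta> powr s"
        unfolding L_def s_def using d1[of "-(4 * b * n + 3 * \<nu>)"] by (simp add: mult.commute algebra_simps)
      have "real (pack \<delta> (proj j X)) \<le> (2 * L + 1) * real (pack (L * \<delta>) (proj j X))"
        by (rule pack_rescale_real[OF bounded_linear_image[where f = "\<lambda>x. x $ j", OF vec_nth_le_norm bX] \<delta>(1)]) (use L1 in simp)
      also have "\<dots> \<le> (90 * L) * real (pack (\<delta> powr s) (proj j X))"
        unfolding Ls using L1 by (intro mult_right_mono) auto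
      also have "90 * L \<le> \<delta> powr (-(4 * b * n + 4 * \<nu>))" unfolding L_def by (rule absorb[OF small(6)]) simp
      finally have "\<delta> powr (-1 + \<tau> + b + 2 * \<nu>) \<le> \<delta> powr (-(4 * b * n + 4 * \<nu>)) * real (pack (\<delta> powr s) (proj j X))"
        using projX[of j] by (simp add: mult_right_mono)
      then have "\<delta> powr (4 * b * n + 4 * \<nu>) * \<delta> powr (-1 + \<tau> + b + 2 * \<nu>)
          \<le> \<delta> powr (4 * b * n + 4 * \<nu>) * (\<delta> powr (-(4 * b * n + 4 * \<nu>)) * real (pack (\<delta> powr s) (proj j X)))"
        by (intro mult_left_mono) auto
      also have "\<dots> = real (pack (\<delta> powr s) (proj j X))" using \<delta> by (simp add: mult.assoc[symmetric] padd)
      also have "\<delta> powr (4 * b * n + 4 * \<nu>) * \<delta> powr (-1 + \<tau> + b + 2 * \<nu>) = \<delta> powr (-1 + \<theta>)"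
        unfolding padd \<theta>_def by (simp add: algebra_simps)
      finally show ?thesis .
    qed
    \<comment> \<open>The product of the projections exceeds \<open>\<delta> powr (-n)\<close> up to
      the loss \<open>n * \<theta>\<close>, whereas \<open>X\<close> has at most about
      \<open>\<delta> powr (-(n - \<sigma>))\<close> points; these clash because
      \<open>n * \<theta> + 3 * \<nu> < \<sigma>\<close>.\<close>
    have "\<delta> powr (n * (-1 + \<theta>)) = (\<Prod>i\<in>(UNIV::'n set). \<delta> powr (-1 + \<theta>))"
      using \<delta> by (simp add: powr_realpow[symmetric] powr_powr n_def mult.commute)
    also have "\<dots> \<le> (\<Prod>i\<in>UNIV. real (pack (\<delta> powr s) (proj i X)))" using projs by (intro prod_mono) auto
    also have "\<dots> = real (\<Prod>i\<in>UNIV. pack (\<delta> powr s) (proj i X))" by simp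
    also have "\<dots> \<le> real (pack \<delta> S)" using prodle by (simp only: of_nat_le_iff)
    also have "\<dots> \<le> \<delta> powr (-\<nu>) * real (pack \<delta> X)"
      unfolding S_def by (rule Ln') (use lenxs u_in in auto)
    also have "\<dots> \<le> \<delta> powr (-\<nu>) * (c0 * \<delta> powr (-(n - \<sigma>) - \<epsilon>))"
    proof (rule mult_left_mono)
      have "real (pack \<delta> X) \<le> c0 * real (pack (2 * \<delta>) X)" by (rule resc[OF bX])
      also have "\<dots> \<le> c0 * \<delta> powr (-(n - \<sigma>) - \<epsilon>)" using Xup c0 by (intro mult_left_mono) (auto simp: n_def)
      finally show "real (pack \<delta> X) \<le> c0 * \<delta> powr (-(n - \<sigma>) - \<epsilon>)" .
    qed simp
    also have "\<dots> = c0 * \<delta> powr (-\<nu> + (-(n - \<sigma>) - \<epsilon>))" using padd[of "-\<nu>" "-(n - \<sigma>) - \<epsilon>"] by simp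
    also have "\<dots> \<le> \<delta> powr (-(n - \<sigma>) - 3 * \<nu>)" by (rule absorb[OF small(9)]) (use \<epsilon> in auto)
    finally have fin: "\<delta> powr (n * (-1 + \<theta>)) \<le> \<delta> powr (-(n - \<sigma>) - 3 * \<nu>)" .
    have "\<theta> \<le> 6 * (b * n)"
    proof -
      have "\<tau> \<le> b / 2" "6 * \<nu> \<le> 6 / 40 * b" using \<tau>b \<nu>\<tau> by linarith+
      moreover have "4 * b * n = 4 * (b * n)" by simp
      ultimately show ?thesis using b1n b0 unfolding \<theta>_def by linarith
    qed
    then have "n * \<theta> \<le> n * (6 * (b * n))" using n by (intro mult_left_mono) auto
    also have "\<dots> = 6 * (b * (n * n))" by simp
    also have "\<dots> \<le> 6 * (\<sigma> / 16)" using bsmall by simp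
    finally have "n * \<theta> \<le> 6 / 16 * \<sigma>" by simp
    moreover have "3 * \<nu> \<le> \<sigma> / 16"
    proof -
      have "b \<le> \<sigma> / 16" using bsmall b1n bnn by linarith
      then show ?thesis using \<nu>\<tau> \<tau>b \<tau> by linarith
    qed
    ultimately have "n * (-1 + \<theta>) < -(n - \<sigma>) - 3 * \<nu>" using \<sigma> by (simp add: algebra_simps)
    then have "\<delta> powr (-(n - \<sigma>) - 3 * \<nu>) < \<delta> powr (n * (-1 + \<theta>))"
      using \<delta> small(3) by (intro powr_less_mono') auto
    then show False using fin by linarith
  qed
  have pos: "min \<delta>r \<delta>2 > 0" using \<delta>r \<delta>2(1) by simp
  show ?thesis
    by (rule exI[of _ \<epsilon>], rule conjI[OF \<epsilon>(1)], rule exI[of _ "min \<delta>r \<delta>2"], rule conjI[OF pos],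
      intro allI impI, rule main)
qed

section \<open>Return to covering numbers\<close>

theorem theorem1p4:
  shows "\<exists>U :: (real^'n) set. open U \<and> (1::real^'n) \<in> U \<and> U \<subseteq> {g. \<forall>i. g $ i \<noteq> 0} \<and>
    (\<forall>\<kappa> \<sigma>. \<kappa> > 0 \<longrightarrow> 0 < \<sigma> \<longrightarrow> \<sigma> < real CARD('n) \<longrightarrow>
      (\<exists>\<epsilon>>0. \<exists>\<delta>0>0. \<forall>\<delta>. 0 < \<delta> \<longrightarrow> \<delta> < \<delta>0 \<longrightarrow>
        (\<forall>A X. A \<subseteq> U \<longrightarrow> X \<subseteq> cball 0 (\<delta> powr (-\<epsilon>)) \<longrightarrow>
          (\<forall>j \<rho>. \<rho> \<ge> \<delta> \<longrightarrow>
             covering_number \<rho> ((\<lambda>x. x $ j) ` A) \<ge> ennreal (\<delta> powr \<epsilon> * \<rho> powr (-\<kappa>))) \<longrightarrow>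
          away_from_subalgebras (\<delta> powr \<epsilon>) A \<longrightarrow>
          (\<forall>j \<rho>. \<rho> \<ge> \<delta> \<longrightarrow>
             covering_number \<rho> ((\<lambda>x. x $ j) ` X) \<ge> ennreal (\<delta> powr \<epsilon> * \<rho> powr (-\<kappa>))) \<longrightarrow>
          covering_number \<delta> X \<le> ennreal (\<delta> powr (-(real CARD('n) - \<sigma>) - \<epsilon>)) \<longrightarrow>
          covering_number \<delta> (sum_dil X 1) + (SUP a\<in>A. covering_number \<delta> (sum_dil X a))
            \<ge> ennreal (\<delta> powr (-\<epsilon>)) * covering_number \<delta> X)))"
proof (intro exI[of _ "ball (1::real^'n) (1/2)"] conjI allI impI)
  show "open (ball (1::real^'n) (1/2))" "(1::real^'n) \<in> ball 1 (1/2)" by auto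
  \<comment> \<open>On this ball the coordinates are nonzero and lie between 0 and 2, as the core
    estimate requires.\<close>
  have ball: "1/2 \<le> g $ i \<and> g $ i \<le> 2" if "g \<in> ball 1 (1/2)" for g :: "real^'n" and i
  proof -
    have "\<bar>(1 - g) $ i\<bar> \<le> norm (1 - g)" by (rule vec_nth_le_norm)
    then have "\<bar>1 - g $ i\<bar> < 1/2" using that by (simp add: dist_norm)
    then have "1 - g $ i < 1/2" "g $ i - 1 < 1/2" unfolding abs_less_iff by linarith+
    then show ?thesis by auto
  qed
  show "ball (1::real^'n) (1/2) \<subseteq> {g. \<forall>i. g $ i \<noteq> 0}"
  proof
    fix g :: "real^'n" assume "g \<in> ball 1 (1/2)"
    then have "1/2 \<le> g $ i" for i using ball by blast
    then have "g $ i \<noteq> 0" for i by (metis half_gt_zero_iff less_le_not_le zero_less_one)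
    then show "g \<in> {g. \<forall>i. g $ i \<noteq> 0}" by simp
  qed
  fix \<kappa> \<sigma> :: real assume \<kappa>: "\<kappa> > 0" and \<sigma>: "0 < \<sigma>"
  \<comment> \<open>Up to scale 1, non-concentration with a smaller exponent is weaker, so the
    exponent may be cut down to 1.\<close>
  define \<kappa>' where "\<kappa>' = min \<kappa> 1"
  have \<kappa>': "0 < \<kappa>'" "\<kappa>' \<le> 1" "\<kappa>' \<le> \<kappa>" using \<kappa> by (auto simp: \<kappa>'_def)
  obtain \<epsilon> \<delta>0 where \<epsilon>: "\<epsilon> > 0" and \<delta>0: "\<delta>0 > 0" and core: "\<forall>\<delta> (A :: (real^'n) set) X. 0 < \<delta> \<longrightarrow> \<delta> < \<delta>0 \<longrightarrow>
    (\<forall>a\<in>A. \<forall>i. 0 \<le> a $ i \<and> a $ i \<le> 2) \<longrightarrow> X \<subseteq> cball 0 (\<delta> powr (-\<epsilon>)) \<longrightarrow> X \<noteq> {} \<longrightarrow>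
    (\<forall>j \<rho>. \<delta> \<le> \<rho> \<longrightarrow> \<rho> \<le> 1 \<longrightarrow> \<rho> powr (-\<kappa>') \<le> \<delta> powr (-\<epsilon>) * real (pack \<rho> (proj j A))) \<longrightarrow>
    (\<forall>i j. i \<noteq> j \<longrightarrow> (\<exists>a\<in>A. \<delta> powr \<epsilon> \<le> \<bar>a $ i - a $ j\<bar>)) \<longrightarrow>
    (\<forall>j \<rho>. \<delta> \<le> \<rho> \<longrightarrow> \<rho> \<le> 1 \<longrightarrow> \<rho> powr (-\<kappa>') \<le> \<delta> powr (-\<epsilon>) * real (pack \<rho> (proj j X))) \<longrightarrow>
    real (pack (2 * \<delta>) X) \<le> \<delta> powr (-(real CARD('n) - \<sigma>) - \<epsilon>) \<longrightarrow>
    real (pack (2 * \<delta>) (X + X)) \<le> \<delta> powr (-\<epsilon>) * real (pack \<delta> X) \<longrightarrow>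
    (\<forall>a\<in>A. real (pack (2 * \<delta>) ((*) a ` X + X)) \<le> \<delta> powr (-\<epsilon>) * real (pack \<delta> X)) \<longrightarrow> False"
    using sum_product_core[OF \<kappa>'(1,2) \<sigma>, where 'n = 'n] by (elim exE conjE)
  show "\<exists>\<epsilon>>0. \<exists>\<delta>0>0. \<forall>\<delta>. 0 < \<delta> \<longrightarrow> \<delta> < \<delta>0 \<longrightarrow>
        (\<forall>A X. A \<subseteq> ball (1::real^'n) (1/2) \<longrightarrow> X \<subseteq> cball 0 (\<delta> powr (-\<epsilon>)) \<longrightarrow>
          (\<forall>j \<rho>. \<rho> \<ge> \<delta> \<longrightarrow>
             covering_number \<rho> ((\<lambda>x. x $ j) ` A) \<ge> ennreal (\<delta> powr \<epsilon> * \<rho> powr (-\<kappa>))) \<longrightarrow>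
          away_from_subalgebras (\<delta> powr \<epsilon>) A \<longrightarrow>
          (\<forall>j \<rho>. \<rho> \<ge> \<delta> \<longrightarrow>
             covering_number \<rho> ((\<lambda>x. x $ j) ` X) \<ge> ennreal (\<delta> powr \<epsilon> * \<rho> powr (-\<kappa>))) \<longrightarrow>
          covering_number \<delta> X \<le> ennreal (\<delta> powr (-(real CARD('n) - \<sigma>) - \<epsilon>)) \<longrightarrow>
          covering_number \<delta> (sum_dil X 1) + (SUP a\<in>A. covering_number \<delta> (sum_dil X a))
            \<ge> ennreal (\<delta> powr (-\<epsilon>)) * covering_number \<delta> X)"
  proof (rule exI[of _ \<epsilon>], rule conjI[OF \<epsilon>], rule exI[of _ \<delta>0], rule conjI[OF \<delta>0], intro allI impI, rule ccontr)
    fix \<delta> :: real and A X :: "(real^'n) set"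
    assume \<delta>: "0 < \<delta>" "\<delta> < \<delta>0" and A: "A \<subseteq> ball 1 (1/2)" and X: "X \<subseteq> cball 0 (\<delta> powr (-\<epsilon>))"
      and ncA: "\<forall>j \<rho>. \<rho> \<ge> \<delta> \<longrightarrow> covering_number \<rho> ((\<lambda>x. x $ j) ` A) \<ge> ennreal (\<delta> powr \<epsilon> * \<rho> powr (-\<kappa>))"
      and away: "away_from_subalgebras (\<delta> powr \<epsilon>) A"
      and ncX: "\<forall>j \<rho>. \<rho> \<ge> \<delta> \<longrightarrow> covering_number \<rho> ((\<lambda>x. x $ j) ` X) \<ge> ennreal (\<delta> powr \<epsilon> * \<rho> powr (-\<kappa>))"
      and up: "covering_number \<delta> X \<le> ennreal (\<delta> powr (-(real CARD('n) - \<sigma>) - \<epsilon>))"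
      and con: "\<not> covering_number \<delta> (sum_dil X 1) + (SUP a\<in>A. covering_number \<delta> (sum_dil X a))
            \<ge> ennreal (\<delta> powr (-\<epsilon>)) * covering_number \<delta> X"
    have bX: "bounded X" using X bounded_cball bounded_subset by blast
    have bA: "bounded A" using A bounded_ball bounded_subset by blast
    have nc: "\<rho> powr (-\<kappa>') \<le> \<delta> powr (-\<epsilon>) * real (pack \<rho> (proj j E))"
      if E: "bounded E" "covering_number \<rho> (proj j E) \<ge> ennreal (\<delta> powr \<epsilon> * \<rho> powr (-\<kappa>))" and \<rho>: "\<delta> \<le> \<rho>" "\<rho> \<le> 1"
      for E :: "(real^'n) set" and j \<rho>
    proof -
      have \<rho>0: "\<rho> > 0" using \<rho> \<delta> by linarith
      have "ennreal (\<delta> powr \<epsilon> * \<rho> powr (-\<kappa>)) \<le> of_nat (pack \<rho> (proj j E))"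
        using E(2) covering_number_le_pack[OF bounded_linear_image[where f = "\<lambda>x. x $ j", OF vec_nth_le_norm E(1)] \<rho>0] by (rule order_trans)
      then have "\<delta> powr \<epsilon> * \<rho> powr (-\<kappa>) \<le> real (pack \<rho> (proj j E))"
        by (simp add: ennreal_of_nat_eq_real_of_nat)
      then have "\<delta> powr (-\<epsilon>) * (\<delta> powr \<epsilon> * \<rho> powr (-\<kappa>)) \<le> \<delta> powr (-\<epsilon>) * real (pack \<rho> (proj j E))"
        by (intro mult_left_mono) auto
      moreover have "\<delta> powr (-\<epsilon>) * (\<delta> powr \<epsilon> * \<rho> powr (-\<kappa>)) = \<rho> powr (-\<kappa>)"
        using \<delta> by (simp add: mult.assoc[symmetric] powr_add[symmetric])
      moreover have "\<rho> powr (-\<kappa>') \<le> \<rho> powr (-\<kappa>)" using \<rho> \<rho>0 \<kappa>' by (intro powr_mono') auto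
      ultimately show ?thesis by linarith
    qed
    \<comment> \<open>An empty projection has covering number 0, against the positive lower bound at
      scale \<open>\<delta>\<close>.\<close>
    have Xne: "X \<noteq> {}"
    proof
      assume "X = {}"
      moreover have "covering_number \<delta> ({} :: real set) \<le> of_nat (pack \<delta> ({} :: real set))"
        by (rule covering_number_le_pack) (use \<delta> in auto)
      moreover have "pack \<delta> ({} :: real set) = 0" using pack_le_card[of "{} :: real set" \<delta>] \<delta> by simp
      ultimately have "ennreal (\<delta> powr \<epsilon> * \<delta> powr (-\<kappa>)) \<le> 0" using ncX[rule_format, of \<delta>] by simp
      moreover have "0 < \<delta> powr \<epsilon> * \<delta> powr (-\<kappa>)" using \<delta> by simp
      ultimately show False by (simp add: ennreal_eq_0_iff)
    qed
    \<comment> \<open>Covering numbers at \<open>\<delta>\<close> lie between packing numbers at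
      \<open>2 * \<delta>\<close> and at \<open>\<delta>\<close>, which explains the mixed radii in
      \<open>sum_product_core\<close>.\<close>
    have lt: "covering_number \<delta> (sum_dil X 1) + (SUP a\<in>A. covering_number \<delta> (sum_dil X a)) < ennreal (\<delta> powr (-\<epsilon>)) * of_nat (pack \<delta> X)"
    proof -
      have "ennreal (\<delta> powr (-\<epsilon>)) * covering_number \<delta> X \<le> ennreal (\<delta> powr (-\<epsilon>)) * of_nat (pack \<delta> X)"
        by (intro mult_left_mono covering_number_le_pack bX \<delta>) auto
      then show ?thesis using con by (meson not_le order_less_le_trans)
    qed
    have sums: "sum_dil X a = (*) a ` X + X" for a :: "real^'n"
    proof (intro equalityI subsetI)
      fix v assume "v \<in> sum_dil X a"
      then obtain x y where "x \<in> X" "y \<in> X" "v = a * y + x" by (auto simp: sum_dil_def)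
      then show "v \<in> (*) a ` X + X" by (auto intro: set_plus_intro)
    next
      fix v assume "v \<in> (*) a ` X + X"
      then obtain x y where "x \<in> X" "y \<in> X" "v = x + a * y" by (auto simp: set_plus_def)
      then show "v \<in> sum_dil X a" by (auto simp: sum_dil_def)
    qed
    have conv: "real (pack (2 * \<delta>) ((*) a ` X + X)) \<le> \<delta> powr (-\<epsilon>) * real (pack \<delta> X)"
      if "covering_number \<delta> (sum_dil X a) \<le> ennreal (\<delta> powr (-\<epsilon>)) * of_nat (pack \<delta> X)" for a
    proof -
      have "of_nat (pack (2 * \<delta>) ((*) a ` X + X)) \<le> covering_number \<delta> ((*) a ` X + X)"
        by (intro pack_le_covering_number bounded_set_plus bounded_mult_image bX \<delta>)
      also have "\<dots> \<le> ennreal (\<delta> powr (-\<epsilon>)) * of_nat (pack \<delta> X)" using that by (simp add: sums)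
      finally have "ennreal (real (pack (2 * \<delta>) ((*) a ` X + X))) \<le> ennreal (\<delta> powr (-\<epsilon>) * real (pack \<delta> X))"
        by (simp add: ennreal_of_nat_eq_real_of_nat ennreal_mult)
      then show ?thesis by (simp add: ennreal_le_iff)
    qed
    have away': "\<exists>a\<in>A. \<delta> powr \<epsilon> \<le> \<bar>a $ i - a $ j\<bar>" if ij: "i \<noteq> j" for i j
    proof -
      obtain a where a: "a \<in> A" "infdist a {x. x $ i = x $ j} \<ge> \<delta> powr \<epsilon>"
        using away ij unfolding away_from_subalgebras_def away_from_def by blast
      \<comment> \<open>Overwriting coordinate \<open>i\<close> by coordinate \<open>j\<close> lands
        in the subalgebra at distance at most the difference of the two.\<close>
      define a' where "a' = (\<chi> l. if l = i then a $ j else a $ l)"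
      have "a' \<in> {x. x $ i = x $ j}" by (simp add: a'_def)
      then have "infdist a {x. x $ i = x $ j} \<le> dist a a'" by (rule infdist_le)
      also have "dist a a' \<le> (\<Sum>l\<in>UNIV. \<bar>(a - a') $ l\<bar>)" unfolding dist_norm by (rule norm_le_l1_cart)
      also have "\<dots> = (\<Sum>l\<in>UNIV. if l = i then \<bar>a $ i - a $ j\<bar> else 0)"
        by (rule sum.cong) (auto simp: a'_def)
      also have "\<dots> = \<bar>a $ i - a $ j\<bar>" by simp
      finally show ?thesis using a by (intro bexI[of _ a]) auto
    qed
    show False
    proof (rule core[rule_format, of \<delta> A X])
      show "0 < \<delta>" "\<delta> < \<delta>0" by (rule \<delta>)+
      show "X \<subseteq> cball 0 (\<delta> powr (-\<epsilon>))" by (rule X)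
      show "X \<noteq> {}" by (rule Xne)
      show "real (pack (2 * \<delta>) X) \<le> \<delta> powr (-(real CARD('n) - \<sigma>) - \<epsilon>)"
      proof -
        have "of_nat (pack (2 * \<delta>) X) \<le> ennreal (\<delta> powr (-(real CARD('n) - \<sigma>) - \<epsilon>))"
          using pack_le_covering_number[OF bX \<delta>(1)] up by (rule order_trans)
        then show ?thesis by (simp add: ennreal_of_nat_eq_real_of_nat ennreal_le_iff)
      qed
      have "covering_number \<delta> (sum_dil X 1) \<le> covering_number \<delta> (sum_dil X 1) + (SUP a\<in>A. covering_number \<delta> (sum_dil X a))"
        by simp
      then have "covering_number \<delta> (sum_dil X 1) \<le> ennreal (\<delta> powr (-\<epsilon>)) * of_nat (pack \<delta> X)" using lt by (meson less_imp_le order_trans)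
      from conv[OF this] show "real (pack (2 * \<delta>) (X + X)) \<le> \<delta> powr (-\<epsilon>) * real (pack \<delta> X)" by simp
    next
      fix a and i assume a: "a \<in> A"
      show "0 \<le> a $ i \<and> a $ i \<le> 2" using ball[of a i] a A by fastforce
    next
      fix a assume a: "a \<in> A"
      have "covering_number \<delta> (sum_dil X a) \<le> (SUP a\<in>A. covering_number \<delta> (sum_dil X a))" by (rule SUP_upper[OF a])
      also have "\<dots> \<le> covering_number \<delta> (sum_dil X 1) + (SUP a\<in>A. covering_number \<delta> (sum_dil X a))" by simp
      also have "\<dots> \<le> ennreal (\<delta> powr (-\<epsilon>)) * of_nat (pack \<delta> X)" using lt by simp
      finally show "real (pack (2 * \<delta>) ((*) a ` X + X)) \<le> \<delta> powr (-\<epsilon>) * real (pack \<delta> X)" by (rule conv)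
    next
      fix j \<rho> assume "\<delta> \<le> \<rho>" "\<rho> \<le> 1"
      then show "\<rho> powr (-\<kappa>') \<le> \<delta> powr (-\<epsilon>) * real (pack \<rho> (proj j A))"
        "\<rho> powr (-\<kappa>') \<le> \<delta> powr (-\<epsilon>) * real (pack \<rho> (proj j X))"
        using nc[OF bA] nc[OF bX] ncA ncX by blast+
    next
      fix i j :: 'n assume "i \<noteq> j"
      then show "\<exists>a\<in>A. \<delta> powr \<epsilon> \<le> \<bar>a $ i - a $ j\<bar>" by (rule away')
    qed
  qed
qed

end
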